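(* Let $(X,\alpha)$ and $(Y,\beta)$ be Cantor minimal systems. The following are equivalent. (1) $K^0(X,\alpha)$ is unital order isomorphic to $K^0(Y,\beta)$. (2) $(X,\alpha)$ and $(Y,\beta)$ are strong orbit equivalent. (3) There is a homeomorphism $F:X\to Y$ such that $\overline{[[\alpha]]}=F^{-1}\,\overline{[[\beta]]}\,F$ (i.e. $\overline{[[\alpha]]}=\{F^{-1}\tau F:\tau\in\overline{[[\beta]]}\}$). (4) There exist homeomorphisms $\sigma_n\in[[\alpha]]$, $\tau_n\in[[\beta]]$ ($n\in\mathbb{N}$) and a homeomorphism $F:X\to Y$ such that $F\sigma_n\alpha\sigma_n^{-1}F^{-1}\to\beta$ in $\operatorname{Homeo}(Y)$ and $F^{-1}\tau_n\beta\tau_n^{-1}F\to\alpha$ in $\operatorname{Homeo}(X)$ as $n\to\infty$.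
   Context: A Cantor minimal system $(X,\alpha)$ consists of a Cantor set $X$ and a homeomorphism $\alpha$ of $X$ with no nontrivial closed invariant subsets. For a compact metrizable space $Z$, $\operatorname{Homeo}(Z)$ carries the topology of uniform convergence: $\gamma_n\to\gamma$ iff $\sup_{z\in Z}d(\gamma_n(z),\gamma(z))\to0$ for a compatible metric $d$ (equivalently $\sup_z|f(\gamma_n^{-1}(z))-f(\gamma^{-1}(z))|\to0$ for all $f\in C(Z)$); closures $\overline{\cdot}$ are taken in this topology. The coboundary subgroup is $B_\alpha=\{f-f\circ\alpha^{-1}: f\in C(X,\mathbb{Z})\}$ and $K^0(X,\alpha)=C(X,\mathbb{Z})/B_\alpha$, an ordered group with positive cone the classes of nonnegative functions and order unit $[1_X]$; a unital order isomorphism is a group isomorphism mapping positive cone onto positive cone and order unit to order unit. The full group $[\alpha]$ is the group of homeomorphisms $\gamma$ of $X$ with $\gamma(x)$ in the $\alpha$-orbit of $x$ for all $x$; its associated map $n:X\to\mathbb{Z}$ is given by $\gamma(x)=\alpha^{n(x)}(x)$. The topological full group $[[\alpha]]$ consists of those $\gamma\in[\alpha]$ whose associated map $n$ is continuous. $(X,\alpha)$ and $(Y,\beta)$ are strong orbit equivalent if there is a homeomorphism $F:X\to Y$ carrying $\alpha$-orbits onto $\beta$-orbits such that the functions $n:X\to\mathbb{Z}$, $m:Y\to\mathbb{Z}$ defined by $F(\alpha(x))=\beta^{n(x)}(F(x))$ and $F^{-1}(\beta(y))=\alpha^{m(y)}(F^{-1}(y))$ each have at most one point of discontinuity. *)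

theory Defs
  imports "HOL-Analysis.Analysis"
begin

definition cantor_set :: "'a::metric_space set \<Rightarrow> bool" where
  "cantor_set X \<longleftrightarrow> X \<noteq> {} \<and> compact X \<and> (\<forall>x\<in>X. x islimpt X)
     \<and> (\<forall>x\<in>X. connected_component_set X x = {x})"

definition hpow :: "'a set \<Rightarrow> ('a \<Rightarrow> 'a) \<Rightarrow> int \<Rightarrow> 'a \<Rightarrow> 'a" where
  "hpow X a n = (if 0 \<le> n then a ^^ nat n else inv_into X a ^^ nat (- n))"

definition orbit :: "'a set \<Rightarrow> ('a \<Rightarrow> 'a) \<Rightarrow> 'a \<Rightarrow> 'a set" where
  "orbit X a x = {hpow X a n x | n. True}"

definition cantor_minimal :: "'a::metric_space set \<Rightarrow> ('a \<Rightarrow> 'a) \<Rightarrow> bool" where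
  "cantor_minimal X a \<longleftrightarrow> cantor_set X \<and> (\<exists>g. homeomorphism X X a g)
     \<and> (\<forall>Z. Z \<subseteq> X \<and> closed Z \<and> a ` Z = Z \<longrightarrow> Z = {} \<or> Z = X)"

definition Homeo :: "'a::metric_space set \<Rightarrow> ('a \<Rightarrow> 'a) set" where
  "Homeo X = {g. (\<exists>h. homeomorphism X X g h) \<and> (\<forall>x. x \<notin> X \<longrightarrow> g x = x)}"

definition TFG :: "'a::metric_space set \<Rightarrow> ('a \<Rightarrow> 'a) \<Rightarrow> ('a \<Rightarrow> 'a) set" where
  "TFG X a = {g \<in> Homeo X. \<exists>n::'a \<Rightarrow> int. continuous_on X n \<and> (\<forall>x\<in>X. g x = hpow X a (n x) x)}"

(* closure in Homeo(X) w.r.t. the topology of uniform convergence (a metrizable topology) *)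
definition TFG_closure :: "'a::metric_space set \<Rightarrow> ('a \<Rightarrow> 'a) \<Rightarrow> ('a \<Rightarrow> 'a) set" where
  "TFG_closure X a = {g \<in> Homeo X. \<exists>s. (\<forall>k. s k \<in> TFG X a) \<and> uniform_limit X s g sequentially}"

(* F^{-1} t F, extended by the identity outside X *)
definition conjh :: "'a set \<Rightarrow> ('a \<Rightarrow> 'b) \<Rightarrow> ('b \<Rightarrow> 'a) \<Rightarrow> ('b \<Rightarrow> 'b) \<Rightarrow> 'a \<Rightarrow> 'a" where
  "conjh X F G t = (\<lambda>x. if x \<in> X then G (t (F x)) else x)"

definition at_most_one_discont :: "'a::metric_space set \<Rightarrow> ('a \<Rightarrow> int) \<Rightarrow> bool" where
  "at_most_one_discont S n \<longleftrightarrow> (\<exists>p. \<forall>x\<in>S. x \<noteq> p \<longrightarrow> continuous (at x within S) n)"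

definition strong_orbit_equiv ::
  "'a::metric_space set \<Rightarrow> ('a \<Rightarrow> 'a) \<Rightarrow> 'b::metric_space set \<Rightarrow> ('b \<Rightarrow> 'b) \<Rightarrow> bool" where
  "strong_orbit_equiv X a Y b \<longleftrightarrow> (\<exists>F G. homeomorphism X Y F G
     \<and> (\<forall>x\<in>X. F ` orbit X a x = orbit Y b (F x))
     \<and> (\<exists>n m. (\<forall>x\<in>X. F (a x) = hpow Y b (n x) (F x))
             \<and> (\<forall>y\<in>Y. G (b y) = hpow X a (m y) (G y))
             \<and> at_most_one_discont X n \<and> at_most_one_discont Y m))"

definition CZ :: "'a::topological_space set \<Rightarrow> ('a \<Rightarrow> int) set" where
  "CZ X = {f. continuous_on X f \<and> (\<forall>x. x \<notin> X \<longrightarrow> f x = 0)}"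

definition cob :: "'a::topological_space set \<Rightarrow> ('a \<Rightarrow> 'a) \<Rightarrow> ('a \<Rightarrow> int) set" where
  "cob X a = {(\<lambda>x. if x \<in> X then f x - f (inv_into X a x) else 0) | f. f \<in> CZ X}"

definition k0cls :: "'a::topological_space set \<Rightarrow> ('a \<Rightarrow> 'a) \<Rightarrow> ('a \<Rightarrow> int) \<Rightarrow> ('a \<Rightarrow> int) set" where
  "k0cls X a f = {g \<in> CZ X. (\<lambda>x. g x - f x) \<in> cob X a}"

definition K0 :: "'a::topological_space set \<Rightarrow> ('a \<Rightarrow> 'a) \<Rightarrow> ('a \<Rightarrow> int) set set" where
  "K0 X a = k0cls X a ` CZ X"

definition kplus :: "('a \<Rightarrow> int) set \<Rightarrow> ('a \<Rightarrow> int) set \<Rightarrow> ('a \<Rightarrow> int) set" where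
  "kplus c d = {(\<lambda>x. u x + v x) | u v. u \<in> c \<and> v \<in> d}"

definition K0pos :: "'a::topological_space set \<Rightarrow> ('a \<Rightarrow> 'a) \<Rightarrow> ('a \<Rightarrow> int) set set" where
  "K0pos X a = {k0cls X a f | f. f \<in> CZ X \<and> (\<forall>x\<in>X. 0 \<le> f x)}"

definition K0unit :: "'a::topological_space set \<Rightarrow> ('a \<Rightarrow> 'a) \<Rightarrow> ('a \<Rightarrow> int) set" where
  "K0unit X a = k0cls X a (\<lambda>x. if x \<in> X then 1 else 0)"

definition unital_order_iso ::
  "'a::topological_space set \<Rightarrow> ('a \<Rightarrow> 'a) \<Rightarrow> 'b::topological_space set \<Rightarrow> ('b \<Rightarrow> 'b)
   \<Rightarrow> (('a \<Rightarrow> int) set \<Rightarrow> ('b \<Rightarrow> int) set) \<Rightarrow> bool" where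
  "unital_order_iso X a Y b \<Phi> \<longleftrightarrow> bij_betw \<Phi> (K0 X a) (K0 Y b)
     \<and> (\<forall>c\<in>K0 X a. \<forall>d\<in>K0 X a. \<Phi> (kplus c d) = kplus (\<Phi> c) (\<Phi> d))
     \<and> \<Phi> ` K0pos X a = K0pos Y b
     \<and> \<Phi> (K0unit X a) = K0unit Y b"

end

theory Submission
  imports Defs
begin

text \<open>
  A homeomorphism \<open>F\<close> carrying the coboundaries of \<open>\<alpha>\<close> onto those of \<open>\<beta>\<close> is the hub of the argument. Coboundaries are
  controlled through towers: over a clopen base on which the transfer functions are constant, cohomologous
  colourings have equally many levels of each colour in every tower, so that levels can be permuted inside the
  towers. This shows that the closure of the topological full group is the group of all homeomorphisms preserving
  classes modulo coboundaries, which handles (3); cutting towers of one system into blocks of the heights of towers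
  of the other gives (4).

  From an isomorphism of dimension groups, a back-and-forth on finite clopen colourings yields such an \<open>F\<close> that
  moreover satisfies \<open>F p = q\<close> and \<open>F (\<alpha> p) = \<beta> q\<close> for prescribed points, so one may assume that both systems live on
  one space, have the same coboundaries, and that \<open>\<alpha> p = \<beta> p\<close>. The two maps are then conjugated alternately, by
  homeomorphisms that converge, so that each of them becomes a locally constant power of the other outside
  neighbourhoods shrinking to \<open>p\<close>; the powers never move a point across \<open>p\<close>, which is what keeps later conjugations
  from destroying earlier ones. In the limit \<open>p\<close> is the only discontinuity. Conversely, a single discontinuity of
  the orbit cocycle does no harm to coboundaries, since the transfer function may be shifted to vanish near its
  image.
\<close>

section \<open>Locally constant functions\<close>

text \<open>Equal coboundaries do not make the hub homeomorphism an orbit equivalence; they only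
  make each map a uniform limit of full-group elements of the other. For (2) the homeomorphism
  itself must be changed, and here is the obstacle: a conjugation turning \<alpha> into local powers
  of \<beta> on a larger clopen set tends to spoil the powers of \<alpha> by which \<beta> was
  already expressed. Two devices prevent this. A power whose path misses a clopen set
  \<open>N\<close> depends only on the values of the map off \<open>N\<close>; so it survives every
  later change inside \<open>N\<close>, and it is respected by every conjugation that commutes with
  the map off \<open>N\<close>. Moreover a colouring can record exponents, so that a conjugation
  respecting the colouring preserves them. The towers are cut between \<open>p\<close> and its
  image: \<open>p\<close> lies on top of one tower, its image at the bottom of another, and motions
  inside towers never pass between the two. Both systems have to be cut at the same pair, which is
  why the back-and-forth prescribes the images of two points and not of one.\<close>

definition locc :: "'a::metric_space set \<Rightarrow> ('a \<Rightarrow> 'c) \<Rightarrow> bool" where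
  "locc X f \<longleftrightarrow> (\<forall>x\<in>X. \<exists>e>0. \<forall>y\<in>X. dist x y < e \<longrightarrow> f y = f x)"

lemma loccI: "(\<And>x. x \<in> X \<Longrightarrow> \<exists>e>0. \<forall>y\<in>X. dist x y < e \<longrightarrow> f y = f x) \<Longrightarrow> locc X f"
  by (simp add: locc_def)

lemma loccD:
  assumes "locc X f" "x \<in> X"
  obtains e where "e > 0" "\<And>y. y \<in> X \<Longrightarrow> dist x y < e \<Longrightarrow> f y = f x"
  using assms unfolding locc_def by blast

lemma locc_const [simp]: "locc X (\<lambda>_. c)"
  by (auto simp: locc_def intro: exI[of _ 1])

lemma locc_cong: "(\<And>x. x \<in> X \<Longrightarrow> f x = g x) \<Longrightarrow> locc X f \<longleftrightarrow> locc X g"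
  by (simp add: locc_def)

text \<open>Near a point the index \<open>k x\<close> is frozen, so only one member of the family
  matters there. Tower heights and exponents of powers that vary with the point are substituted into
  formulas by this rule.\<close>

lemma locc_bind:
  assumes k: "locc X k" and F: "\<And>i. locc X (F i)"
  shows "locc X (\<lambda>x. F (k x) x)"
proof (rule loccI)
  fix x assume x: "x \<in> X"
  obtain e where e: "e > 0" "\<And>y. y \<in> X \<Longrightarrow> dist x y < e \<Longrightarrow> k y = k x" using loccD[OF k x] by metis
  obtain e' where e': "e' > 0" "\<And>y. y \<in> X \<Longrightarrow> dist x y < e' \<Longrightarrow> F (k x) y = F (k x) x"
    using loccD[OF F x] by metis
  show "\<exists>e>0. \<forall>y\<in>X. dist x y < e \<longrightarrow> F (k y) y = F (k x) x"
    using e e' by (intro exI[of _ "min e e'"]) auto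
qed

lemma locc_map: "locc X f \<Longrightarrow> locc X (\<lambda>x. g (f x))"
  unfolding locc_def by metis

lemma locc_map2: "locc X f \<Longrightarrow> locc X h \<Longrightarrow> locc X (\<lambda>x. g (f x) (h x))"
  by (rule locc_bind[where F="\<lambda>i x. g i (h x)"], assumption, rule locc_map)

lemma locc_list: "(\<And>i. i \<in> set xs \<Longrightarrow> locc X (F i)) \<Longrightarrow> locc X (\<lambda>x. map (\<lambda>i. F i x) xs)"
  by (induction xs) (auto intro!: locc_map2[where g="(#)"])

lemma locc_ball: "finite S \<Longrightarrow> (\<And>i. i \<in> S \<Longrightarrow> locc X (F i)) \<Longrightarrow> locc X (\<lambda>x. \<forall>i\<in>S. F i x)"
  by (induction S rule: finite_induct) (auto intro!: locc_map2[where g="(\<and>)"])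

text \<open>Bundles finitely many functions into a single colour. The default \<open>d\<close> off
  \<open>S\<close> matters: infinitely many locally constant functions need not be frozen on a
  common neighbourhood.\<close>

lemma locc_fun:
  assumes "finite S" "\<And>i. i \<in> S \<Longrightarrow> locc X (F i)"
  shows "locc X (\<lambda>x i. if i \<in> S then F i x else d)"
proof -
  obtain xs where xs: "set xs = S" using finite_list[OF assms(1)] by auto
  have "(\<lambda>i. if i \<in> S then F i x else d) =
      (\<lambda>i. case map_of (map (\<lambda>i. (i, F i x)) xs) i of None \<Rightarrow> d | Some v \<Rightarrow> v)" for x
    using xs by (auto simp: map_of_map_restrict restrict_map_def fun_eq_iff)
  moreover have "locc X (\<lambda>x. map (\<lambda>i. (i, F i x)) xs)"
    by (rule locc_list, rule locc_map[where g="Pair _"]) (use assms xs in auto)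
  then have "locc X (\<lambda>x. (\<lambda>l i. case map_of l i of None \<Rightarrow> d | Some v \<Rightarrow> v) (map (\<lambda>i. (i, F i x)) xs))"
    by (rule locc_map)
  ultimately show ?thesis by simp
qed

text \<open>If \<open>n\<close> is the least index at \<open>x\<close>, the truth values of
  \<open>P 0\<close>, ..., \<open>P n\<close> are jointly frozen near \<open>x\<close>, and later
  indices cannot affect the minimum. Return times to a clopen base are locally constant for this
  reason.\<close>

lemma locc_Least:
  fixes P :: "nat \<Rightarrow> 'a::metric_space \<Rightarrow> bool"
  assumes P: "\<And>j. locc X (P j)" and ex: "\<And>x. x \<in> X \<Longrightarrow> \<exists>j. P j x"
  shows "locc X (\<lambda>x. LEAST j. P j x)"
proof (rule loccI)
  fix x assume x: "x \<in> X"
  define n where "n = (LEAST j. P j x)"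
  have "locc X (\<lambda>x. map (\<lambda>j. P j x) [0..<Suc n])" by (rule locc_list) (rule P)
  then obtain e where e: "e > 0"
    "\<And>y. y \<in> X \<Longrightarrow> dist x y < e \<Longrightarrow> map (\<lambda>j. P j y) [0..<Suc n] = map (\<lambda>j. P j x) [0..<Suc n]"
    using loccD[where f="\<lambda>x. map (\<lambda>j. P j x) [0..<Suc n]" and X=X, OF _ x] by metis
  have "(LEAST j. P j y) = n" if y: "y \<in> X" "dist x y < e" for y
  proof (rule Least_equality)
    have eq: "P j y = P j x" if "j \<le> n" for j
      using e(2)[OF y] that by (auto simp: map_eq_conv simp del: upt_Suc)
    have "P n x" unfolding n_def using ex[OF x] by (rule LeastI_ex)
    then show "P n y" using eq by simp
    show "n \<le> j" if "P j y" for j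
    proof (rule ccontr)
      assume "\<not> n \<le> j"
      then have "P j x" using eq[of j] that by simp
      then have "n \<le> j" unfolding n_def by (rule Least_le)
      with \<open>\<not> n \<le> j\<close> show False by simp
    qed
  qed
  then show "\<exists>e>0. \<forall>y\<in>X. dist x y < e \<longrightarrow> (LEAST j. P j y) = (LEAST j. P j x)"
    using e(1) n_def by blast
qed

lemma locc_compose:
  assumes f: "locc Y f" and g: "continuous_on X g" "g ` X \<subseteq> Y"
  shows "locc X (\<lambda>x. f (g x))"
proof (rule loccI)
  fix x assume x: "x \<in> X"
  then have "g x \<in> Y" using g by auto
  then obtain e where e: "e > 0" "\<And>y. y \<in> Y \<Longrightarrow> dist (g x) y < e \<Longrightarrow> f y = f (g x)"
    using loccD[OF f] by metis
  obtain d where d: "d > 0" "\<And>y. y \<in> X \<Longrightarrow> dist y x < d \<Longrightarrow> dist (g y) (g x) < e"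
    using g(1) x e(1) unfolding continuous_on_iff by metis
  show "\<exists>e>0. \<forall>y\<in>X. dist x y < e \<longrightarrow> f (g y) = f (g x)"
    using d e(2) g(2) by (intro exI[of _ d]) (auto simp: dist_commute image_subset_iff)
qed

text \<open>The Lebesgue number of the cover by all open sets whose trace on \<open>X\<close> has
  \<open>P\<close>; heredity passes \<open>P\<close> down to small sets.\<close>

lemma locc_Lebesgue:
  assumes X: "compact X" and P: "\<And>x. x \<in> X \<Longrightarrow> \<exists>e>0. P (ball x e \<inter> X)"
    and mono: "\<And>A B. P B \<Longrightarrow> A \<subseteq> B \<Longrightarrow> P A"
  shows "\<exists>e>0. \<forall>A\<subseteq>X. A \<noteq> {} \<longrightarrow> (\<forall>x\<in>A. \<forall>y\<in>A. dist x y < e) \<longrightarrow> P A"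
proof -
  define \<G> where "\<G> = {G. open G \<and> P (G \<inter> X)}"
  have cov: "X \<subseteq> \<Union>\<G>" 
  proof
    fix x assume "x \<in> X"
    from P[OF this] obtain e where "e > 0" "P (ball x e \<inter> X)" by auto
    then have "ball x e \<in> \<G>" "x \<in> ball x e" unfolding \<G>_def by auto
    then show "x \<in> \<Union>\<G>" by blast
  qed
  have op: "\<And>G. G \<in> \<G> \<Longrightarrow> open G" by (auto simp: \<G>_def)
  obtain e where e: "e > 0" "\<And>x. x \<in> X \<Longrightarrow> \<exists>G\<in>\<G>. ball x e \<subseteq> G"
    using Heine_Borel_lemma[OF X cov op] by blast
  show ?thesis
  proof (intro exI[of _ e] conjI e(1) allI impI)
    fix A assume A: "A \<subseteq> X" "A \<noteq> {}" "\<forall>x\<in>A. \<forall>y\<in>A. dist x y < e"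
    then obtain x where x: "x \<in> A" by auto
    then obtain G where G: "G \<in> \<G>" "ball x e \<subseteq> G" using e A by blast
    have "A \<subseteq> G \<inter> X" using G(2) A x by (auto simp: subset_iff)
    then show "P A" using G(1) mono unfolding \<G>_def by blast
  qed
qed

lemma locc_uniform:
  assumes X: "compact X" and f: "locc X f"
  shows "\<exists>e>0. \<forall>x\<in>X. \<forall>y\<in>X. dist x y < e \<longrightarrow> f x = f y"
proof -
  have loc: "\<exists>e>0. \<forall>y\<in>ball x e \<inter> X. \<forall>z\<in>ball x e \<inter> X. f y = f z" if x: "x \<in> X" for x
  proof -
    obtain e where "e > 0" "\<forall>y\<in>X. dist x y < e \<longrightarrow> f y = f x" using f x unfolding locc_def by blast
    then show ?thesis by (intro exI[of _ e]) auto
  qed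
  have "\<exists>e>0. \<forall>A\<subseteq>X. A \<noteq> {} \<longrightarrow> (\<forall>x\<in>A. \<forall>y\<in>A. dist x y < e) \<longrightarrow> (\<forall>x\<in>A. \<forall>y\<in>A. f x = f y)"
    by (rule locc_Lebesgue[OF X, where P="\<lambda>A. \<forall>x\<in>A. \<forall>y\<in>A. f x = f y"]) (use loc in blast)+
  then obtain e where e: "e > 0"
    "\<And>A. A \<subseteq> X \<Longrightarrow> A \<noteq> {} \<Longrightarrow> \<forall>x\<in>A. \<forall>y\<in>A. dist x y < e \<Longrightarrow> \<forall>x\<in>A. \<forall>y\<in>A. f x = f y"
    by blast
  have "f x = f y" if "x \<in> X" "y \<in> X" "dist x y < e" for x y
  proof -
    have "dist a b < e" if "a \<in> {x,y}" "b \<in> {x,y}" for a b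
      using that \<open>dist x y < e\<close> e(1) dist_commute[of x y] by auto
    then have "\<forall>a\<in>{x,y}. \<forall>b\<in>{x,y}. f a = f b" using that(1,2) by (intro e(2)) auto
    then show ?thesis by (metis insertCI)
  qed
  with e(1) show ?thesis by (intro exI[of _ e] conjI ballI impI) assumption+
qed

lemma locc_finite_range:
  assumes X: "compact X" and f: "locc X f"
  shows "finite (f ` X)"
proof -
  obtain e where e: "e > 0" "\<forall>x\<in>X. \<forall>y\<in>X. dist x y < e \<longrightarrow> f x = f y"
    using locc_uniform[OF X f] by blast
  obtain k where k: "finite k" "k \<subseteq> X" "X \<subseteq> (\<Union>x\<in>k. ball x e)"
    using compactE_image[OF X, of X "\<lambda>x. ball x e"] e(1) by (metis UN_I centre_in_ball open_ball subsetI)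
  have "f ` X \<subseteq> f ` k"
  proof
    fix z assume "z \<in> f ` X"
    then obtain x where x: "x \<in> X" "z = f x" by blast
    then obtain y where y: "y \<in> k" "dist y x < e" using k(3) by auto
    then have "f y = f x" using e(2) x(1) k(2) by blast
    then show "z \<in> f ` k" using y(1) x(2) by (metis image_eqI)
  qed
  then show ?thesis using k(1) finite_subset by blast
qed

lemma locc_bounded:
  fixes f :: "'a::metric_space \<Rightarrow> int"
  assumes X: "compact X" and f: "locc X f"
  shows "\<exists>K\<ge>0. \<forall>x\<in>X. \<bar>f x\<bar> \<le> K"
proof -
  have fin: "finite (insert 0 (abs ` f ` X))" using locc_finite_range[OF X f] by simp
  then have "\<bar>f x\<bar> \<le> Max (insert 0 (abs ` f ` X))" if "x \<in> X" for x
    using that by (intro Max_ge) auto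
  moreover have "0 \<le> Max (insert 0 (abs ` f ` X))" using fin by (intro Max_ge) auto
  ultimately show ?thesis by blast
qed

lemma locc_closed:
  assumes X: "closed X" and f: "locc X P"
  shows "closed {x\<in>X. P x}"
proof -
  have "closedin (top_of_set X) {x\<in>X. P x}"
  proof -
    have "openin (top_of_set X) (X - {x\<in>X. P x})"
      unfolding openin_euclidean_subtopology_iff
    proof (intro conjI ballI)
      fix x assume "x \<in> X - {x\<in>X. P x}"
      then have x: "x \<in> X" "\<not> P x" by auto
      obtain e where e: "e > 0" "\<forall>y\<in>X. dist x y < e \<longrightarrow> P y = P x" using f x(1) unfolding locc_def by metis
      have *: "x' \<in> X - {x\<in>X. P x}" if "x' \<in> X" "dist x' x < e" for x'
        using that e(2) x by (simp add: dist_commute)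
      show "\<exists>e>0. \<forall>x'\<in>X. dist x' x < e \<longrightarrow> x' \<in> X - {x\<in>X. P x}"
        using * e(1) by blast
    qed auto
    then show ?thesis by (simp add: closedin_def)
  qed
  then show ?thesis using X by (rule closedin_closed_trans)
qed

lemma locc_sum:
  fixes F :: "'i \<Rightarrow> 'a::metric_space \<Rightarrow> int"
  assumes "\<And>i. i \<in> S \<Longrightarrow> locc X (F i)"
  shows "locc X (\<lambda>x. \<Sum>i\<in>S. F i x)"
  using assms
proof (induction S rule: infinite_finite_induct)
  case (insert i S)
  have "locc X (\<lambda>x. F i x + (\<Sum>i\<in>S. F i x))"
    by (rule locc_map2[where g="(+)"]) (use insert in auto)
  then show ?case using insert by simp
qed auto

lemma continuous_within_int_iff:
  fixes f :: "'a::metric_space \<Rightarrow> int"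
  shows "continuous (at x within X) f \<longleftrightarrow> (\<exists>e>0. \<forall>y\<in>X. dist x y < e \<longrightarrow> f y = f x)"
  unfolding continuous_within tendsto_discrete eventually_at
  by (rule ex_cong1, rule conj_cong[OF refl], rule ball_cong[OF refl]) (auto simp: dist_commute)

lemma locc_iff_continuous:
  fixes f :: "'a::metric_space \<Rightarrow> int"
  shows "locc X f \<longleftrightarrow> continuous_on X f"
  by (simp add: locc_def continuous_on_eq_continuous_within continuous_within_int_iff)

text \<open>Zero-dimensionality in the form in which it is applied: clopen partitions of arbitrarily
  small mesh, each presented as a colouring by natural numbers.\<close>

definition zero_dim :: "'a::metric_space set \<Rightarrow> bool" where
  "zero_dim X \<longleftrightarrow> (\<forall>e>0. \<exists>v::'a \<Rightarrow> nat. locc X v \<and> (\<forall>x\<in>X. \<forall>y\<in>X. v x = v y \<longrightarrow> dist x y < e))"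

text \<open>In a compact Hausdorff space components and quasi-components coincide, so distinct
  points of a totally disconnected one are separated by clopen sets; compactness is then used twice,
  for small clopen neighbourhoods and for a finite cover by them.\<close>

lemma cantor_set_zero_dim:
  assumes "cantor_set X"
  shows "zero_dim X"
  unfolding zero_dim_def
proof safe
  fix e :: real assume e: "e > 0"
  have X: "compact X" and cc: "\<And>x. x \<in> X \<Longrightarrow> connected_component_set X x = {x}"
    using assms by (auto simp: cantor_set_def)
  let ?T = "top_of_set X"
  have "compact_space ?T" "Hausdorff_space ?T"
    using X by (auto simp: compact_space_subtopology compactin_euclidean_iff Hausdorff_space_subtopology)
  then have q: "quasi_components_of ?T = connected_components_of ?T"
    using quasi_eq_connected_components_of by blast
  have qc: "quasi_component_of ?T x y \<Longrightarrow> x = y" for x y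
  proof -
    assume a: "quasi_component_of ?T x y"
    then have xy: "x \<in> X" "y \<in> X" by (auto dest: quasi_component_in_topspace)
    have "quasi_component_of ?T x = connected_component_of ?T x"
      using q xy unfolding quasi_eq_connected_components_of_pointwise by simp
    then have "connected_component_of ?T x y" using a by simp
    then obtain C where "connectedin ?T C" "x \<in> C" "y \<in> C" unfolding connected_component_of_def by blast
    then have "connected_component X x y"
      unfolding connected_component_def by (auto simp: connectedin_subtopology)
    then show "x = y" using cc[OF xy(1)] by auto
  qed
  have small: "\<exists>T. x \<in> T \<and> closedin ?T T \<and> openin ?T T \<and> T \<subseteq> ball x (e/2)" if x: "x \<in> X" for x
  proof -
    define K where "K = X - ball x (e/2)"
    have K: "compact K" unfolding K_def using X by (simp add: compact_diff)
    \<comment> \<open>Clopen sets missing \<open>x\<close>. Finitely many of them cover the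
      complement of the ball, and what they leave over is a clopen neighbourhood of \<open>x\<close>
      inside the ball.\<close>
    define \<C> where "\<C> = {T. x \<notin> T \<and> closedin ?T T \<and> openin ?T T}"
    have "\<exists>V. open V \<and> y \<in> V \<and> X \<inter> V \<in> \<C>" if y: "y \<in> K" for y
    proof -
      have "x \<noteq> y" "y \<in> X" using y e by (auto simp: K_def)
      then obtain T where T: "closedin ?T T" "openin ?T T" "y \<in> T" "x \<notin> T"
        using qc[of y x] x by (auto simp: quasi_component_of)
      then obtain V where "open V" "T = X \<inter> V" by (auto simp: openin_open)
      then show ?thesis using T \<C>_def by auto
    qed
    then obtain V where V: "\<forall>y\<in>K. open (V y) \<and> y \<in> V y \<and> X \<inter> V y \<in> \<C>" by metis
    then obtain K' where K': "K' \<subseteq> K" "finite K'" "K \<subseteq> (\<Union>y\<in>K'. V y)"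
      by (rule_tac compactE_image[OF K, of K V]) (metis, blast+)
    have KX: "K \<subseteq> X" by (auto simp: K_def)
    let ?U = "\<Union>y\<in>K'. X \<inter> V y"
    have "closedin ?T ?U" "openin ?T ?U" "x \<notin> ?U"
    proof -
      have *: "closedin ?T (X \<inter> V y)" "openin ?T (X \<inter> V y)" "x \<notin> X \<inter> V y" if "y \<in> K'" for y
        using V K'(1) that unfolding \<C>_def by blast+
      show "closedin ?T ?U" using *(1) K'(2) by (intro closedin_Union) blast+
      show "openin ?T ?U" using *(2) by (intro openin_Union) blast
      show "x \<notin> ?U" using *(3) by blast
    qed
    then have "x \<in> X - ?U \<and> closedin ?T (X - ?U) \<and> openin ?T (X - ?U) \<and> X - ?U \<subseteq> ball x (e/2)"
      using K' KX x by (auto simp: K_def openin_diff closedin_diff)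
    then show ?thesis by blast
  qed
  then obtain T where T: "\<And>x. x \<in> X \<Longrightarrow> x \<in> T x \<and> closedin ?T (T x) \<and> openin ?T (T x) \<and> T x \<subseteq> ball x (e/2)"
    by metis
  have "\<forall>x\<in>X. \<exists>V. open V \<and> T x = X \<inter> V" using T by (auto simp: openin_open)
  then obtain V where V: "\<And>x. x \<in> X \<Longrightarrow> open (V x) \<and> T x = X \<inter> V x" by metis
  obtain X' where X': "X' \<subseteq> X" "finite X'" "X \<subseteq> (\<Union>y\<in>X'. V y)"
  proof (rule compactE_image[OF X, of X V])
    show "\<And>x. x \<in> X \<Longrightarrow> open (V x)" using V by simp
    have "x \<in> V x" if "x \<in> X" for x using V[OF that] T[OF that] by auto
    then show "X \<subseteq> (\<Union>x\<in>X. V x)" by auto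
  qed auto
  obtain xs where xs: "set xs = X'" using finite_list[OF X'(2)] by auto
  have loc: "locc X (\<lambda>y. y \<in> T x)" if xX: "x \<in> X" for x
  proof (rule loccI)
    fix y assume y: "y \<in> X"
    show "\<exists>d>0. \<forall>z\<in>X. dist y z < d \<longrightarrow> (z \<in> T x) = (y \<in> T x)"
    proof (cases "y \<in> T x")
      case True
      then obtain d where "d > 0" "\<forall>z\<in>X. dist z y < d \<longrightarrow> z \<in> T x"
        using T[OF xX] unfolding openin_euclidean_subtopology_iff by blast
      then show ?thesis using True by (intro exI[of _ d]) (auto simp: dist_commute)
    next
      case False
      have "openin ?T (X - T x)" using T[OF xX] by (simp add: closedin_def)
      then obtain d where "d > 0" "\<forall>z\<in>X. dist z y < d \<longrightarrow> z \<in> X - T x"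
        using False y unfolding openin_euclidean_subtopology_iff by blast
      then show ?thesis using False by (intro exI[of _ d]) (auto simp: dist_commute)
    qed
  qed
  \<comment> \<open>Taking the first member of the cover that contains \<open>y\<close> makes the
    finite clopen cover disjoint.\<close>
  define v where "v y = (LEAST i. i < length xs \<and> y \<in> T (xs ! i))" for y
  have ex: "\<exists>i. i < length xs \<and> y \<in> T (xs ! i)" if y: "y \<in> X" for y
  proof -
    obtain x where "x \<in> X'" "y \<in> V x" using X' y by auto
    moreover from this obtain i where "i < length xs" "x = xs ! i" using xs by (auto simp: in_set_conv_nth)
    moreover have "y \<in> T x" using calculation V[of x] X'(1) y by blast
    ultimately show ?thesis by blast
  qed
  have "locc X (\<lambda>y. i < length xs \<and> y \<in> T (xs ! i))" for i
  proof (cases "i < length xs")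
    case True
    then have "xs ! i \<in> X" using xs X'(1) nth_mem by blast
    then show ?thesis using loc True by simp
  qed simp
  then have "locc X v" unfolding v_def using ex by (rule locc_Least)
  moreover have "dist x y < e" if "x \<in> X" "y \<in> X" "v x = v y" for x y
  proof -
    have *: "v z < length xs \<and> z \<in> T (xs ! v z)" if "z \<in> X" for z
      unfolding v_def using ex[OF that] by (rule LeastI_ex)
    have "x \<in> T (xs ! v x)" "y \<in> T (xs ! v x)" using *[OF that(1)] *[OF that(2)] that(3) by auto
    moreover have "xs ! v x \<in> X" using *[OF that(1)] xs X'(1) nth_mem by blast
    ultimately have "x \<in> T (xs ! v x)" "y \<in> T (xs ! v x)" "xs ! v x \<in> X" by auto
    then have "dist (xs ! v x) x < e/2" "dist (xs ! v x) y < e/2" using T by (auto simp: subset_iff)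
    then show ?thesis using dist_triangle3[of x y "xs ! v x"] by simp
  qed
  ultimately show "\<exists>v::'a \<Rightarrow> nat. locc X v \<and> (\<forall>x\<in>X. \<forall>y\<in>X. v x = v y \<longrightarrow> dist x y < e)" by blast
qed

text \<open>The cells of a partition of mesh below the Lebesgue number inherit the local
  property.\<close>

lemma zero_dim_cover:
  assumes X: "compact X" "zero_dim X" and P: "\<And>x. x \<in> X \<Longrightarrow> \<exists>e>0. P (ball x e \<inter> X)"
    and mono: "\<And>A B. P B \<Longrightarrow> A \<subseteq> B \<Longrightarrow> P A"
  obtains v :: "'a::metric_space \<Rightarrow> nat" where "locc X v" "\<And>x. x \<in> X \<Longrightarrow> P {y\<in>X. v y = v x}"
proof -
  have "\<exists>e>0. \<forall>A\<subseteq>X. A \<noteq> {} \<longrightarrow> (\<forall>x\<in>A. \<forall>y\<in>A. dist x y < e) \<longrightarrow> P A"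
    by (rule locc_Lebesgue[OF X(1)], erule P, erule (1) mono)
  then obtain e where e: "e > 0" "\<forall>A\<subseteq>X. A \<noteq> {} \<longrightarrow> (\<forall>x\<in>A. \<forall>y\<in>A. dist x y < e) \<longrightarrow> P A"
    by blast
  obtain v :: "'a \<Rightarrow> nat" where v: "locc X v" "\<forall>x\<in>X. \<forall>y\<in>X. v x = v y \<longrightarrow> dist x y < e"
    using X(2) e(1) unfolding zero_dim_def by blast
  have "P {y\<in>X. v y = v x}" if "x \<in> X" for x
  proof -
    have "{y\<in>X. v y = v x} \<noteq> {}" using that by blast
    moreover have "\<forall>y\<in>{y\<in>X. v y = v x}. \<forall>z\<in>{y\<in>X. v y = v x}. dist y z < e" using v(2) by simp
    ultimately show ?thesis using e(2) by (metis (no_types, lifting) mem_Collect_eq subsetI)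
  qed
  then show thesis using that v(1) by blast
qed

section \<open>Homeomorphisms and their integer powers\<close>

text \<open>Unlike \<open>hpow\<close> this uses the inverse on the whole type. Elements of
  \<open>Homeo X\<close> are the identity off \<open>X\<close>, hence bijections of the type, so the
  power laws need no membership conditions.\<close>

definition zpow :: "('a \<Rightarrow> 'a) \<Rightarrow> int \<Rightarrow> 'a \<Rightarrow> 'a" where
  "zpow g n = (if 0 \<le> n then g ^^ nat n else inv g ^^ nat (- n))"

lemma zpow_0 [simp]: "zpow g 0 x = x"
  and zpow_1 [simp]: "zpow g 1 = g"
  and zpow_m1: "zpow g (-1) = inv g"
  by (auto simp: zpow_def)

lemma zpow_Suc:
  assumes "bij g"
  shows "zpow g (n + 1) x = g (zpow g n x)"
proof (cases "0 \<le> n")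
  case True
  then have "nat (n + 1) = Suc (nat n)" by simp
  then show ?thesis using True by (simp add: zpow_def)
next
  case False
  then have "nat (- n) = Suc (nat (- (n + 1)))" by simp
  moreover have "inv g ^^ nat (-(n+1)) = zpow g (n + 1)"
    using False by (cases "n = -1") (auto simp: zpow_def)
  moreover have "g (inv g y) = y" for y using assms by (simp add: bij_is_surj surj_f_inv_f)
  ultimately show ?thesis using False by (simp add: zpow_def)
qed

lemma zpow_pred:
  assumes "bij g"
  shows "zpow g (n - 1) x = inv g (zpow g n x)"
  using zpow_Suc[OF assms, of "n - 1" x] assms by (simp add: bij_is_inj)

lemma zpow_add:
  assumes "bij g"
  shows "zpow g (m + n) x = zpow g m (zpow g n x)"
proof (induction m rule: int_induct[where k=0])
  case (step1 i)
  have "zpow g (i + 1 + n) x = zpow g (i + n + 1) x" by (simp add: algebra_simps)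
  then show ?case using step1 by (simp add: zpow_Suc[OF assms])
next
  case (step2 i)
  have "zpow g (i - 1 + n) x = zpow g (i + n - 1) x" by (simp add: algebra_simps)
  then show ?case using step2 by (simp add: zpow_pred[OF assms])
qed simp

lemma zpow_inverse [simp]:
  assumes "bij g"
  shows "zpow g (- n) (zpow g n x) = x" "zpow g n (zpow g (- n) x) = x"
  using zpow_add[OF assms, of "-n" n x] zpow_add[OF assms, of n "-n" x] by auto

lemma HomeoD:
  assumes "g \<in> Homeo X"
  shows "bij g" "g ` X = X" "continuous_on X g" "\<And>x. g x \<in> X \<longleftrightarrow> x \<in> X" "\<And>x. x \<notin> X \<Longrightarrow> g x = x"
    "continuous_on X (inv g)"
proof -
  obtain h where h: "homeomorphism X X g h" and out: "\<And>x. x \<notin> X \<Longrightarrow> g x = x"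
    using assms by (auto simp: Homeo_def)
  have gh: "\<And>x. x \<in> X \<Longrightarrow> h (g x) = x" "\<And>x. x \<in> X \<Longrightarrow> g (h x) = x" and im: "g ` X = X" "h ` X = X"
    and c: "continuous_on X g" "continuous_on X h"
    using h by (auto simp: homeomorphism_def)
  show iff: "g x \<in> X \<longleftrightarrow> x \<in> X" for x using im(1) out by (metis image_eqI)
  have "inj g"
  proof (rule injI)
    fix x y assume e: "g x = g y"
    show "x = y"
    proof (cases "x \<in> X")
      case True
      then have "y \<in> X" using e iff by metis
      then show ?thesis using True e gh(1) by metis
    next
      case False
      then have "y \<notin> X" using e iff by metis
      then show ?thesis using False e out by metis
    qed
  qed
  moreover have "surj g"
  proof (rule surjI[where f="\<lambda>x. if x \<in> X then h x else x"])
    show "g (if x \<in> X then h x else x) = x" for x using gh(2) out by simp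
  qed
  ultimately show bij: "bij g" by (rule bijI)
  show "g ` X = X" "continuous_on X g" "\<And>x. x \<notin> X \<Longrightarrow> g x = x" using im c out by auto
  have "inv g x = h x" if "x \<in> X" for x
    using gh(2)[OF that] \<open>inj g\<close> by (metis inv_f_f)
  then show "continuous_on X (inv g)" using c(2) continuous_on_cong by metis
qed

lemma HomeoI:
  assumes "compact X" "continuous_on X g" "bij_betw g X X" "\<And>x. x \<notin> X \<Longrightarrow> g x = x"
  shows "g \<in> Homeo X"
proof -
  have "\<exists>h. homeomorphism X X g h"
    using assms by (intro homeomorphism_compact) (auto simp: bij_betw_def)
  then show ?thesis using assms(4) by (simp add: Homeo_def)
qed

lemma Homeo_id: "(\<lambda>x. x) \<in> Homeo X"
  by (auto simp: Homeo_def homeomorphism_ident intro!: exI[of _ "\<lambda>x. x"])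

lemma Homeo_comp:
  assumes "f \<in> Homeo X" "g \<in> Homeo X"
  shows "(\<lambda>x. f (g x)) \<in> Homeo X"
proof -
  obtain h k where "homeomorphism X X f h" "homeomorphism X X g k" using assms by (auto simp: Homeo_def)
  then have "homeomorphism X X (f \<circ> g) (k \<circ> h)" by (rule homeomorphism_compose[rotated])
  then show ?thesis using assms by (auto simp: Homeo_def o_def)
qed

lemma inv_Homeo [simp]:
  assumes "g \<in> Homeo X"
  shows "inv g (g x) = x" "g (inv g x) = x"
  using HomeoD(1)[OF assms] by (auto simp: bij_is_inj bij_is_surj surj_f_inv_f)

lemma Homeo_inv_iff:
  assumes "g \<in> Homeo X"
  shows "inv g x \<in> X \<longleftrightarrow> x \<in> X"
  using HomeoD(4)[OF assms, of "inv g x"] assms by simp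

lemma Homeo_inv:
  assumes "g \<in> Homeo X"
  shows "inv g \<in> Homeo X"
proof -
  have "inv g x = x" if "x \<notin> X" for x
    using HomeoD(5)[OF assms that] assms by (metis inv_Homeo(1))
  moreover have "homeomorphism X X (inv g) g"
    unfolding homeomorphism_def
  proof (intro conjI ballI)
    show "inv g ` X = X"
      using HomeoD(2)[OF assms] by (metis HomeoD(1) assms bij_is_inj image_inv_f_f)
  qed (use assms HomeoD[OF assms] in auto)
  ultimately show ?thesis by (auto simp: Homeo_def)
qed

lemma Homeo_zpow:
  assumes "g \<in> Homeo X"
  shows "zpow g n \<in> Homeo X"
proof (induction n rule: int_induct[where k=0])
  case base
  show ?case using Homeo_id by (simp add: zpow_def id_def)
next
  case (step1 i)
  have "zpow g (i + 1) = (\<lambda>x. g (zpow g i x))" using zpow_Suc[OF HomeoD(1)[OF assms]] by auto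
  then show ?case using Homeo_comp[OF assms step1(2)] by simp
next
  case (step2 i)
  have "zpow g (i - 1) = (\<lambda>x. inv g (zpow g i x))" using zpow_pred[OF HomeoD(1)[OF assms]] by auto
  then show ?case using Homeo_comp[OF Homeo_inv[OF assms] step2(2)] by simp
qed

lemma Homeo_zpow_iff [simp]: "g \<in> Homeo X \<Longrightarrow> zpow g n x \<in> X \<longleftrightarrow> x \<in> X"
  using HomeoD(4)[OF Homeo_zpow] by blast

lemma locc_Homeo: "locc X f \<Longrightarrow> g \<in> Homeo X \<Longrightarrow> locc X (\<lambda>x. f (g x))"
  using locc_compose[of X f X g] HomeoD(2,3)[of g X] by simp

text \<open>The given maps are arbitrary off \<open>X\<close>; this normalises them to elements of
  \<open>Homeo X\<close>, and \<open>hpow_restr\<close> identifies the powers on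
  \<open>X\<close>.\<close>

definition restr :: "'a set \<Rightarrow> ('a \<Rightarrow> 'a) \<Rightarrow> 'a \<Rightarrow> 'a" where
  "restr X a = (\<lambda>x. if x \<in> X then a x else x)"

lemma restr_Homeo:
  assumes "homeomorphism X X a g"
  shows "restr X a \<in> Homeo X"
proof -
  have "homeomorphism X X (restr X a) g"
    using assms by (auto simp: homeomorphism_def restr_def cong: continuous_on_cong)
  then show ?thesis by (auto simp: Homeo_def restr_def)
qed

lemma inv_into_restr:
  fixes X :: "'a::metric_space set"
  assumes "homeomorphism X X a g" "x \<in> X"
  shows "inv_into X a x = inv (restr X a) x"
proof -
  let ?y = "inv (restr X a) x"
  have h: "restr X a \<in> Homeo X" using restr_Homeo[OF assms(1)] .
  have y: "?y \<in> X" using Homeo_inv_iff[OF h] assms(2) by simp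
  then have "a ?y = x" using inv_Homeo(2)[OF h, of x] by (simp add: restr_def)
  moreover have "inj_on a X" using assms(1) unfolding homeomorphism_def by (metis inj_onI)
  ultimately show ?thesis using y by (metis inv_into_f_f)
qed

lemma hpow_restr:
  fixes X :: "'a::metric_space set"
  assumes "homeomorphism X X a g" "x \<in> X"
  shows "hpow X a n x = zpow (restr X a) n x"
proof -
  have h: "restr X a \<in> Homeo X" using restr_Homeo[OF assms(1)] .
  have p: "(a ^^ k) x = (restr X a ^^ k) x \<and> (restr X a ^^ k) x \<in> X" for k
  proof (induction k)
    case (Suc k)
    then have "a ((restr X a ^^ k) x) = restr X a ((restr X a ^^ k) x)" by (simp add: restr_def)
    then show ?case using Suc HomeoD(4)[OF h] by simp
  qed (use assms(2) in simp)
  have m: "(inv_into X a ^^ k) x = (inv (restr X a) ^^ k) x \<and> (inv (restr X a) ^^ k) x \<in> X" for k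
    using assms(2) Homeo_inv_iff[OF h] by (induction k) (auto simp: inv_into_restr[OF assms(1)])
  show ?thesis unfolding hpow_def zpow_def using p m by auto
qed

subsection \<open>Cocycles avoiding a set\<close>

text \<open>The exponents are \<open>0\<close>, ..., \<open>k - 1\<close> for positive
  \<open>k\<close> and \<open>k\<close>, ..., \<open>-1\<close> for negative \<open>k\<close>. In
  either direction these are the sources \<open>z\<close> of the edges from \<open>z\<close> to
  \<open>a z\<close> that are traversed, so the condition says that no traversed edge starts in
  \<open>N\<close>. Reversing or concatenating paths therefore preserves it.\<close>

definition avoid :: "('a \<Rightarrow> 'a) \<Rightarrow> 'a set \<Rightarrow> int \<Rightarrow> 'a \<Rightarrow> bool" where
  "avoid a N k x \<longleftrightarrow> (\<forall>i. min 0 k \<le> i \<and> i < max 0 k \<longrightarrow> zpow a i x \<notin> N)"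

lemma avoid_0 [simp]: "avoid a N 0 x"
  by (auto simp: avoid_def)

lemma avoid_mono: "avoid a N k x \<Longrightarrow> M \<subseteq> N \<Longrightarrow> avoid a M k x"
  by (auto simp: avoid_def)

lemma avoid_add:
  assumes "bij a" "avoid a N k x" "avoid a N l (zpow a k x)"
  shows "avoid a N (l + k) x"
  unfolding avoid_def
proof (intro allI impI)
  fix i assume i: "min 0 (l + k) \<le> i \<and> i < max 0 (l + k)"
  show "zpow a i x \<notin> N"
  proof (cases "min 0 k \<le> i \<and> i < max 0 k")
    case True
    then show ?thesis using assms(2) by (simp add: avoid_def)
  next
    case False
    then have "min 0 l \<le> i - k \<and> i - k < max 0 l" using i by (auto simp: min_def max_def split: if_splits)
    then have "zpow a (i - k) (zpow a k x) \<notin> N" using assms(3) by (simp add: avoid_def)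
    then show ?thesis using zpow_add[OF assms(1), of "i - k" k x] by simp
  qed
qed

lemma avoid_uminus:
  assumes "bij a" "avoid a N k x"
  shows "avoid a N (- k) (zpow a k x)"
  unfolding avoid_def
proof (intro allI impI)
  fix i assume i: "min 0 (- k) \<le> i \<and> i < max 0 (- k)"
  then have "min 0 k \<le> i + k \<and> i + k < max 0 k" by (auto simp: min_def max_def split: if_splits)
  then have "zpow a (i + k) x \<notin> N" using assms(2) by (simp add: avoid_def)
  then show "zpow a i (zpow a k x) \<notin> N" using zpow_add[OF assms(1)] by simp
qed

text \<open>Local membership in the full group of \<open>a\<close>, with control of the path. For
  empty \<open>N\<close> it describes the topological full group (\<open>TFG_iff\<close>); for
  \<open>N = {p}\<close> it says in addition that the power never passes from \<open>p\<close> to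
  \<open>a p\<close> or back.\<close>

definition inner_at :: "'a::metric_space set \<Rightarrow> ('a \<Rightarrow> 'a) \<Rightarrow> 'a set \<Rightarrow> ('a \<Rightarrow> 'a) \<Rightarrow> 'a \<Rightarrow> bool" where
  "inner_at X a N f x \<longleftrightarrow>
     (\<exists>k. (\<exists>e>0. \<forall>y\<in>X. dist x y < e \<longrightarrow> f y = zpow a k y) \<and> avoid a N k x)"

lemma inner_at_zpow: "avoid a N k x \<Longrightarrow> inner_at X a N (zpow a k) x"
  unfolding inner_at_def by (rule exI[of _ k]) (simp add: gt_ex)

lemma inner_at_mono: "inner_at X a N f x \<Longrightarrow> M \<subseteq> N \<Longrightarrow> inner_at X a M f x"
  unfolding inner_at_def by (elim exE conjE, rule exI, rule conjI, (rule exI, rule conjI, assumption+)[1], rule avoid_mono)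

lemma inner_at_local:
  assumes "inner_at X a N f x" "e > 0" "\<And>y. y \<in> X \<Longrightarrow> dist x y < e \<Longrightarrow> g y = f y"
  shows "inner_at X a N g x"
proof -
  obtain k d where d: "d > 0" "\<forall>y\<in>X. dist x y < d \<longrightarrow> f y = zpow a k y" "avoid a N k x"
    using assms(1) unfolding inner_at_def by blast
  have "g y = zpow a k y" if "y \<in> X" "dist x y < min d e" for y
    using d(2) assms(3)[OF that(1)] that by simp
  moreover have "min d e > 0" using d(1) assms(2) by simp
  ultimately show ?thesis unfolding inner_at_def using d(3) by metis
qed

lemma continuous_near:
  fixes X :: "'a::metric_space set"
  assumes "continuous_on X f" "x \<in> X" "(d::real) > 0"
  obtains e where "e > 0" "\<And>y. y \<in> X \<Longrightarrow> dist x y < e \<Longrightarrow> dist (f x) (f y) < d"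
proof -
  obtain e where e: "e > 0" "\<forall>y\<in>X. dist y x < e \<longrightarrow> dist (f y) (f x) < d"
    using assms unfolding continuous_on_iff by metis
  show thesis
    by (rule that[OF e(1)]) (use e(2) in \<open>simp add: dist_commute\<close>)
qed

lemma inner_at_comp:
  assumes a: "a \<in> Homeo X" and x: "x \<in> X" and f: "inner_at X a N f x" and g: "inner_at X a N g (f x)"
  shows "inner_at X a N (\<lambda>y. g (f y)) x"
proof -
  have b: "bij a" using HomeoD[OF a] by blast
  obtain k d where k: "d > 0" "\<forall>y\<in>X. dist x y < d \<longrightarrow> f y = zpow a k y" "avoid a N k x"
    using f unfolding inner_at_def by blast
  obtain l e where l: "e > 0" "\<forall>y\<in>X. dist (f x) y < e \<longrightarrow> g y = zpow a l y" "avoid a N l (f x)"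
    using g unfolding inner_at_def by blast
  have fx: "f x = zpow a k x" using k(1,2) x by simp
  obtain d' where d': "d' > 0" "\<And>y. y \<in> X \<Longrightarrow> dist x y < d' \<Longrightarrow> dist (zpow a k x) (zpow a k y) < e"
    using continuous_near[OF HomeoD(3)[OF Homeo_zpow[OF a]] x l(1)] by metis
  have "g (f y) = zpow a (l + k) y" if y: "y \<in> X" "dist x y < min d d'" for y
  proof -
    have "f y = zpow a k y" using k(2) y by simp
    moreover have "dist (f x) (zpow a k y) < e" using d'(2) y fx by simp
    ultimately show ?thesis using l(2) y(1) a zpow_add[OF b] by simp
  qed
  moreover have "avoid a N (l + k) x" using avoid_add[OF b k(3)] l(3) fx by simp
  moreover have "min d d' > 0" using k(1) d'(1) by simp
  ultimately show ?thesis unfolding inner_at_def by metis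
qed

lemma inner_at_inverse:
  assumes a: "a \<in> Homeo X" and x: "x \<in> X" and f: "inner_at X a N f x" and g: "\<And>y. y \<in> X \<Longrightarrow> g (f y) = y"
  shows "inner_at X a N g (f x)"
proof -
  have b: "bij a" using HomeoD[OF a] by blast
  obtain k d where k: "d > 0" "\<forall>y\<in>X. dist x y < d \<longrightarrow> f y = zpow a k y" "avoid a N k x"
    using f unfolding inner_at_def by blast
  have fx: "f x = zpow a k x" using k(1,2) x by simp
  obtain e where e: "e > 0" "\<And>y. y \<in> X \<Longrightarrow> dist (f x) y < e \<Longrightarrow> dist (zpow a (-k) (f x)) (zpow a (-k) y) < d"
    using continuous_near[OF HomeoD(3)[OF Homeo_zpow[OF a]] _ k(1)] fx a x by (metis Homeo_zpow_iff)
  have "g y = zpow a (-k) y" if y: "y \<in> X" "dist (f x) y < e" for y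
  proof -
    have "dist x (zpow a (-k) y) < d" using e(2)[OF y] fx b by simp
    then have "f (zpow a (-k) y) = zpow a k (zpow a (-k) y)" using k(2) y(1) a by simp
    then have "f (zpow a (-k) y) = y" using b by simp
    then show ?thesis using g[of "zpow a (-k) y"] y(1) a by simp
  qed
  moreover have "avoid a N (-k) (f x)" using avoid_uminus[OF b k(3)] fx by simp
  ultimately show ?thesis unfolding inner_at_def using e(1) by metis
qed

lemma zpow_conj:
  assumes a: "a \<in> Homeo X" and F: "F \<in> Homeo X"
  shows "zpow (\<lambda>x. F (a (inv F x))) k x = F (zpow a k (inv F x))"
proof -
  let ?c = "\<lambda>x. F (a (inv F x))"
  have c: "bij ?c" using HomeoD(1)[OF Homeo_comp[OF F Homeo_comp[OF a Homeo_inv[OF F]]]] .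
  have b: "bij a" using HomeoD(1)[OF a] .
  show ?thesis
  proof (induction k rule: int_induct[where k=0])
    case base
    then show ?case using F by simp
  next
    case (step1 i)
    then show ?case using zpow_Suc[OF c] zpow_Suc[OF b] F by simp
  next
    case (step2 i)
    have "?c (zpow ?c (i - 1) x) = zpow ?c i x" using zpow_Suc[OF c, of "i - 1" x] by simp
    also have "\<dots> = ?c (F (zpow a (i - 1) (inv F x)))"
      using step2 zpow_Suc[OF b, of "i - 1" "inv F x"] F by simp
    finally show ?case by (rule injD[OF bij_is_inj[OF c]])
  qed
qed

lemma Homeo_piecewise:
  assumes X: "compact X" and b: "bij_betw F X X" and out: "\<And>x. x \<notin> X \<Longrightarrow> F x = x"
    and loc: "\<And>x. x \<in> X \<Longrightarrow> \<exists>H\<in>Homeo X. \<exists>e>0. \<forall>y\<in>X. dist x y < e \<longrightarrow> F y = H y"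
  shows "F \<in> Homeo X"
proof (rule HomeoI[OF X _ b out])
  show "continuous_on X F"
    unfolding continuous_on_iff
  proof (intro ballI allI impI)
    fix x and e :: real assume x: "x \<in> X" and e: "e > 0"
    obtain H d where d: "H \<in> Homeo X" "d > 0" "\<forall>y\<in>X. dist x y < d \<longrightarrow> F y = H y" using loc[OF x] by metis
    obtain d' where d': "d' > 0" "\<And>y. y \<in> X \<Longrightarrow> dist x y < d' \<Longrightarrow> dist (H x) (H y) < e"
      using continuous_near[OF HomeoD(3)[OF d(1)] x e] by metis
    have "dist (F y) (F x) < e" if "y \<in> X" "dist y x < min d d'" for y
      using d(2,3) d'(2)[OF that(1)] that x by (simp add: dist_commute[of _ x] dist_commute[of _ "H x"])
    moreover have "min d d' > 0" using d(2) d'(1) by simp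
    ultimately show "\<exists>d>0. \<forall>y\<in>X. dist y x < d \<longrightarrow> dist (F y) (F x) < e" by metis
  qed
qed

section \<open>Minimal systems and their coboundaries\<close>

text \<open>The coboundaries of the dimension group, written with \<open>h \<circ> a - h\<close>
  (substitute \<open>f = h \<circ> a\<close> in \<open>f - f \<circ> inv a\<close>) and without any
  condition off \<open>X\<close>; \<open>cob_iff\<close> translates.\<close>

definition coh :: "'a::metric_space set \<Rightarrow> ('a \<Rightarrow> 'a) \<Rightarrow> ('a \<Rightarrow> int) \<Rightarrow> bool" where
  "coh X a f \<longleftrightarrow> (\<exists>h. locc X h \<and> (\<forall>x\<in>X. f x = h (a x) - h x))"

lemma cohI: "locc X h \<Longrightarrow> (\<And>x. x \<in> X \<Longrightarrow> f x = h (a x) - h x) \<Longrightarrow> coh X a f"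
  by (auto simp: coh_def)

lemma coh_cong: "(\<And>x. x \<in> X \<Longrightarrow> f x = g x) \<Longrightarrow> coh X a f \<longleftrightarrow> coh X a g"
  by (simp add: coh_def)

lemma coh_0 [simp]: "coh X a (\<lambda>_. 0)"
  by (rule cohI[where h="\<lambda>_. 0"]) auto

lemma coh_add: "coh X a f \<Longrightarrow> coh X a g \<Longrightarrow> coh X a (\<lambda>x. f x + g x)"
proof -
  assume "coh X a f" "coh X a g"
  then obtain h k where h: "locc X h" "\<forall>x\<in>X. f x = h (a x) - h x" and k: "locc X k" "\<forall>x\<in>X. g x = k (a x) - k x"
    by (auto simp: coh_def)
  show ?thesis
    by (rule cohI[OF locc_map2[OF h(1) k(1), where g="(+)"]]) (use h(2) k(2) in auto)
qed

lemma coh_uminus: "coh X a f \<Longrightarrow> coh X a (\<lambda>x. - f x)"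
proof -
  assume "coh X a f"
  then obtain h where h: "locc X h" "\<forall>x\<in>X. f x = h (a x) - h x" by (auto simp: coh_def)
  show ?thesis
    by (rule cohI[OF locc_map[OF h(1), where g=uminus]]) (use h(2) in auto)
qed

lemma coh_diff: "coh X a f \<Longrightarrow> coh X a g \<Longrightarrow> coh X a (\<lambda>x. f x - g x)"
  using coh_add[OF _ coh_uminus, of X a f g] by simp

lemma coh_sum: "(\<And>i. i \<in> S \<Longrightarrow> coh X a (F i)) \<Longrightarrow> coh X a (\<lambda>x. \<Sum>i\<in>S. F i x)"
proof (induction S rule: infinite_finite_induct)
  case (insert i S)
  have "coh X a (\<lambda>x. F i x + (\<Sum>i\<in>S. F i x))" by (rule coh_add) (use insert in auto)
  then show ?case using insert by simp
qed auto

lemma coh_zpow: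
  assumes a: "a \<in> Homeo X" and f: "locc X f"
  shows "coh X a (\<lambda>x. f (zpow a k x) - f x)"
proof (induction k rule: int_induct[where k=0])
  case (step1 i)
  have "coh X a (\<lambda>x. f (zpow a (i + 1) x) - f (zpow a i x))"
    by (rule cohI[OF locc_Homeo[OF f Homeo_zpow[OF a, of i]]])
      (use zpow_add[OF HomeoD(1)[OF a], of i 1] in simp)
  from coh_add[OF this step1(2)] show ?case by simp
next
  case (step2 i)
  have "coh X a (\<lambda>x. f (zpow a i x) - f (zpow a (i - 1) x))"
    by (rule cohI[OF locc_Homeo[OF f Homeo_zpow[OF a, of "i - 1"]]])
      (use zpow_add[OF HomeoD(1)[OF a], of "i - 1" 1] in simp)
  from coh_diff[OF step2(2) this] show ?case by simp
qed simp

text \<open>The homeomorphisms acting trivially on functions modulo coboundaries. It will be the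
  closure of the topological full group (\<open>TFG_closure_eq\<close>), but it depends on
  \<open>a\<close> only through its coboundaries, which is what makes it transferable to another
  system.\<close>

definition class_pres :: "'a::metric_space set \<Rightarrow> ('a \<Rightarrow> 'a) \<Rightarrow> ('a \<Rightarrow> 'a) set" where
  "class_pres X a = {g \<in> Homeo X. \<forall>f. locc X f \<longrightarrow> coh X a (\<lambda>x. f (g x) - f x)}"

lemma class_pres_zpow: "a \<in> Homeo X \<Longrightarrow> zpow a k \<in> class_pres X a"
  by (simp add: class_pres_def Homeo_zpow coh_zpow)

lemma class_pres_comp:
  assumes "f \<in> class_pres X a" "g \<in> class_pres X a"
  shows "(\<lambda>x. f (g x)) \<in> class_pres X a"
  unfolding class_pres_def
proof (intro CollectI conjI allI impI)
  show "(\<lambda>x. f (g x)) \<in> Homeo X" using assms by (auto simp: class_pres_def Homeo_comp)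
  fix h :: "'a \<Rightarrow> int" assume h: "locc X h"
  have "locc X (\<lambda>x. h (f x))" using assms(1) h by (auto simp: class_pres_def locc_Homeo)
  then have "coh X a (\<lambda>x. h (f (g x)) - h (f x))" using assms(2) by (auto simp: class_pres_def)
  moreover have "coh X a (\<lambda>x. h (f x) - h x)" using assms(1) h by (auto simp: class_pres_def)
  ultimately have "coh X a (\<lambda>x. (h (f (g x)) - h (f x)) + (h (f x) - h x))" by (rule coh_add)
  then show "coh X a (\<lambda>x. h (f (g x)) - h x)" by simp
qed

lemma coh_comp_class_pres:
  assumes "g \<in> class_pres X a" "locc X f"
  shows "coh X a (\<lambda>x. f (g x)) \<longleftrightarrow> coh X a f"
proof -
  have c: "coh X a (\<lambda>x. f (g x) - f x)" using assms by (auto simp: class_pres_def)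
  show ?thesis
    using coh_add[OF c, of f] coh_diff[OF _ c, of "\<lambda>x. f (g x)"] by auto
qed

text \<open>A homeomorphism that is piecewise in the group preserves classes; pieces on which the function vanishes
  do not matter, which is what makes one point of discontinuity harmless.\<close>

lemma coh_piecewise:
  assumes X: "compact X" "zero_dim X" and a: "a \<in> Homeo X" and t: "t \<in> Homeo X" and f: "locc X f"
    and loc: "\<And>x. x \<in> X \<Longrightarrow> f (t x) \<noteq> 0 \<Longrightarrow> \<exists>g\<in>class_pres X a. \<exists>e>0. \<forall>y\<in>X. dist x y < e \<longrightarrow> t y = g y"
  shows "coh X a (\<lambda>x. f (t x) - f x)"
proof -
  have ft: "locc X (\<lambda>x. f (t x))" using locc_Homeo[OF f t] .
  define P where "P A \<longleftrightarrow> (\<exists>g\<in>class_pres X a. \<forall>y\<in>A. f (t y) = 0 \<or> t y = g y)" for A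
  have "\<exists>e>0. P (ball x e \<inter> X)" if x: "x \<in> X" for x
  proof (cases "f (t x) = 0")
    case True
    obtain e where e: "e > 0" "\<forall>y\<in>X. dist x y < e \<longrightarrow> f (t y) = f (t x)"
      using ft x unfolding locc_def by metis
    have "zpow a 0 \<in> class_pres X a" using class_pres_zpow[OF a] .
    then have "P (ball x e \<inter> X)" unfolding P_def using e(2) True by auto
    then show ?thesis using e(1) by metis
  next
    case False
    obtain g e where "g \<in> class_pres X a" "e > 0" "\<forall>y\<in>X. dist x y < e \<longrightarrow> t y = g y" using loc[OF x False] by metis
    then have "P (ball x e \<inter> X)" unfolding P_def by auto
    then show ?thesis using \<open>e > 0\<close> by metis
  qed
  moreover have "P B \<Longrightarrow> A \<subseteq> B \<Longrightarrow> P A" for A B unfolding P_def by blast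
  ultimately obtain v :: "'a \<Rightarrow> nat" where v: "locc X v" "\<forall>x\<in>X. P {y\<in>X. v y = v x}"
    by (rule zero_dim_cover[OF X, of P]) blast+
  define S where "S = v ` X"
  have fS: "finite S" unfolding S_def by (rule locc_finite_range[OF X(1) v(1)])
  have "\<exists>g. g \<in> class_pres X a \<and> (\<forall>y\<in>X. v y = n \<longrightarrow> f (t y) = 0 \<or> t y = g y)" if "n \<in> S" for n
    using v(2) that unfolding S_def P_def by blast
  then obtain g where g: "\<And>n. n \<in> S \<Longrightarrow> g n \<in> class_pres X a"
    "\<And>n y. n \<in> S \<Longrightarrow> y \<in> X \<Longrightarrow> v y = n \<Longrightarrow> f (t y) = 0 \<or> t y = g n y" by metis
  \<comment> \<open>Cuts \<open>f\<close> along the images under \<open>t\<close> of the cells of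
    \<open>v\<close>. On cell \<open>n\<close> the map \<open>t\<close> agrees with
    \<open>g n\<close> wherever \<open>f \<circ> t\<close> is nonzero, so
    \<open>F n \<circ> g n\<close> is \<open>f \<circ> t\<close> restricted to cell
    \<open>n\<close>, and \<open>f \<circ> t - f\<close> becomes a finite sum of
    coboundaries.\<close>
  define F where "F n y = (if v (inv t y) = n then f y else 0)" for n y
  have vt: "locc X (\<lambda>y. v (inv t y))" by (rule locc_Homeo[OF v(1) Homeo_inv[OF t]])
  have F: "locc X (F n)" for n
    unfolding F_def by (rule locc_map2[OF vt f, where g="\<lambda>v f. if v = n then f else 0"])
  have "coh X a (\<lambda>x. F n (g n x) - F n x)" if "n \<in> S" for n
    using g(1)[OF that] F by (auto simp: class_pres_def)
  then have "coh X a (\<lambda>x. \<Sum>n\<in>S. F n (g n x) - F n x)" by (rule coh_sum)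
  moreover have "(\<Sum>n\<in>S. F n (g n x) - F n x) = f (t x) - f x" if x: "x \<in> X" for x
  proof -
    have g_in: "g n x \<in> X" if "n \<in> S" for n using g(1)[OF that] x HomeoD(4) by (auto simp: class_pres_def)
    have *: "F n (g n x) = (if n = v x then f (t x) else 0)" if n: "n \<in> S" for n
    proof (cases "F n (g n x) = 0")
      case True
      have "f (t x) = 0" if "n = v x"
      proof (rule ccontr)
        assume nz: "f (t x) \<noteq> 0"
        then have "t x = g n x" using g(2)[OF n x] that by metis
        then have "F n (g n x) = f (t x)" unfolding F_def using that t by (metis inv_Homeo(1))
        then show False using True nz by simp
      qed
      then show ?thesis using True by simp
    next
      case False
      \<comment> \<open>A nonzero value at \<open>g n x\<close> comes from a point \<open>y\<close>
        of cell \<open>n\<close> with \<open>t y = g n x\<close>. There also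
        \<open>t y = g n y\<close>, and injectivity of \<open>g n\<close> forces
        \<open>y = x\<close>.\<close>
      define y where "y = inv t (g n x)"
      have y: "y \<in> X" "v y = n" "f (t y) \<noteq> 0" "t y = g n x" 
        using False g_in[OF n] t Homeo_inv_iff[OF t] unfolding y_def F_def by (auto split: if_splits)
      then have "t y = g n y" using g(2)[OF n y(1)] by blast
      then have "x = y" using y(4) g(1)[OF n] HomeoD(1) unfolding class_pres_def by (metis (lifting) bij_pointE mem_Collect_eq)
      then show ?thesis using y inv_Homeo(1)[OF t, of y] unfolding F_def by auto
    qed
    have vx: "v x \<in> S" "v (inv t x) \<in> S" using x Homeo_inv_iff[OF t] by (auto simp: S_def)
    have "(\<Sum>n\<in>S. F n (g n x) - F n x) = (\<Sum>n\<in>S. (if n = v x then f (t x) else 0)) - (\<Sum>n\<in>S. (if n = v (inv t x) then f x else 0))"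
      unfolding sum_subtractf[symmetric] by (rule sum.cong[OF refl]) (use * in \<open>auto simp: F_def\<close>)
    also have "\<dots> = f (t x) - f x" using vx fS by simp
    finally show ?thesis .
  qed
  ultimately show ?thesis using coh_cong by (metis (no_types, lifting))
qed

lemma class_pres_piecewise:
  assumes "compact X" "zero_dim X" and a: "a \<in> Homeo X" and t: "t \<in> Homeo X"
    and loc: "\<And>x. x \<in> X \<Longrightarrow> \<exists>g\<in>class_pres X a. \<exists>e>0. \<forall>y\<in>X. dist x y < e \<longrightarrow> t y = g y"
  shows "t \<in> class_pres X a"
  using coh_piecewise[OF assms(1-4) _ loc] t by (simp add: class_pres_def)

lemma class_pres_inner:
  assumes "compact X" "zero_dim X" and a: "a \<in> Homeo X" and t: "t \<in> Homeo X"
    and loc: "\<And>x. x \<in> X \<Longrightarrow> inner_at X a N t x"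
  shows "t \<in> class_pres X a"
proof (rule class_pres_piecewise[OF assms(1-4)])
  fix x assume "x \<in> X"
  then show "\<exists>g\<in>class_pres X a. \<exists>e>0. \<forall>y\<in>X. dist x y < e \<longrightarrow> t y = g y"
    using loc class_pres_zpow[OF a] unfolding inner_at_def by blast
qed

lemma class_pres_inv:
  assumes "g \<in> class_pres X a"
  shows "inv g \<in> class_pres X a"
  unfolding class_pres_def
proof (intro CollectI conjI allI impI)
  have h: "g \<in> Homeo X" using assms by (auto simp: class_pres_def)
  show i: "inv g \<in> Homeo X" using Homeo_inv[OF h] .
  fix f :: "'a \<Rightarrow> int" assume "locc X f"
  then have l: "locc X (\<lambda>x. f (inv g x))" using locc_Homeo i by blast
  then have "coh X a (\<lambda>x. f (inv g (g x)) - f (inv g x))" using assms by (auto simp: class_pres_def)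
  then have "coh X a (\<lambda>x. - (f x - f (inv g x)))" using h by (intro coh_uminus) simp
  then show "coh X a (\<lambda>x. f (inv g x) - f x)" by simp
qed

section \<open>Minimal systems: aperiodicity, return times, nonnegative coboundaries\<close>

locale cms =
  fixes X :: "'a::metric_space set" and a :: "'a \<Rightarrow> 'a"
  assumes compact: "compact X" and zd: "zero_dim X" and inf: "infinite X" and hom: "a \<in> Homeo X"
    and min: "\<And>Z. Z \<subseteq> X \<Longrightarrow> closed Z \<Longrightarrow> a ` Z = Z \<Longrightarrow> Z = {} \<or> Z = X"
begin

lemma bij: "bij a"
  using HomeoD(1)[OF hom] .

lemma zadd: "zpow a (m + n) x = zpow a m (zpow a n x)"
  using zpow_add[OF bij] .

lemma zinv [simp]: "zpow a (- n) (zpow a n x) = x" "zpow a n (zpow a (- n) x) = x"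
  using zpow_inverse[OF bij] by auto

lemma zin [simp]: "zpow a n x \<in> X \<longleftrightarrow> x \<in> X"
  using Homeo_zpow_iff[OF hom] .

lemma ain [simp]: "a x \<in> X \<longleftrightarrow> x \<in> X"
  using HomeoD(4)[OF hom] .

lemma locc_z: "locc X f \<Longrightarrow> locc X (\<lambda>x. f (zpow a n x))"
  using locc_Homeo[OF _ Homeo_zpow[OF hom]] .

lemma locc_bind_z: "locc X k \<Longrightarrow> locc X f \<Longrightarrow> locc X (\<lambda>x. f (zpow a (k x) x))"
  by (rule locc_bind[where F="\<lambda>i x. f (zpow a i x)"]) (auto intro: locc_z)

text \<open>A periodic orbit would be finite, hence closed and invariant, hence by minimality all of
  the infinite set \<open>X\<close>.\<close>

lemma aper:
  assumes x: "x \<in> X" and k: "zpow a k x = x"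
  shows "k = 0"
proof (rule ccontr)
  assume "k \<noteq> 0"
  have per: "zpow a (k * int m) x = x" for m
  proof (induction m)
    case (Suc m)
    have "k * int (Suc m) = k + k * int m" by (simp add: algebra_simps)
    then show ?case using Suc k zadd by metis
  qed simp
  have per': "zpow a (i + k * m) x = zpow a i x" for i m
  proof (cases "0 \<le> m")
    case True
    then show ?thesis using per[of "nat m"] zadd[of i "k * m" x] by simp
  next
    case False
    then have "zpow a (k * - m) x = x" using per[of "nat (- m)"] by simp
    then have "zpow a (i + k * m) x = zpow a (i + k * m) (zpow a (k * - m) x)" by simp
    also have "\<dots> = zpow a i x" using zadd[of "i + k * m" "k * - m" x] by simp
    finally show ?thesis .
  qed
  define Z where "Z = range (\<lambda>i. zpow a i x)"
  have "Z \<subseteq> (\<lambda>i. zpow a i x) ` {-\<bar>k\<bar>..\<bar>k\<bar>}"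
  proof
    fix z assume "z \<in> Z"
    then obtain i where i: "z = zpow a i x" by (auto simp: Z_def)
    then have "z = zpow a (i mod k) x" using per'[of "i mod k" "i div k"] by (simp add: add.commute)
    moreover have "i mod k \<in> {-\<bar>k\<bar>..\<bar>k\<bar>}" using abs_mod_less[OF \<open>k \<noteq> 0\<close>, of i] by auto
    ultimately show "z \<in> (\<lambda>i. zpow a i x) ` {-\<bar>k\<bar>..\<bar>k\<bar>}" by blast
  qed
  then have fin: "finite Z" using finite_subset by blast
  have "Z \<subseteq> X" using x by (auto simp: Z_def)
  moreover have "a ` Z = Z"
  proof -
    have "a ` Z = range (\<lambda>i. zpow a (i + 1) x)" unfolding Z_def image_image using zpow_Suc[OF bij] by simp
    also have "\<dots> = (\<lambda>i. zpow a i x) ` range (\<lambda>i. i + 1)" unfolding image_image ..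
    also have "range (\<lambda>i::int. i + 1) = UNIV" by (rule surjI[where f="\<lambda>i. i - 1"]) simp
    finally show ?thesis unfolding Z_def .
  qed
  ultimately have "Z = {} \<or> Z = X" using min finite_imp_closed[OF fin] by blast
  then show False using fin inf by (auto simp: Z_def)
qed

lemma zpow_inj:
  assumes "x \<in> X" "zpow a k x = zpow a l x"
  shows "k = l"
proof -
  have "zpow a (-l + k) x = x" using assms(2) zadd[of "-l" k x] by simp
  then show ?thesis using aper[OF assms(1)] by fastforce
qed

lemma separate:
  assumes "x \<in> X" "y \<in> X" "x \<noteq> y"
  shows "\<exists>s::'a \<Rightarrow> nat. locc X s \<and> s x \<noteq> s y"
proof -
  have "dist x y > 0" using assms by simp
  then obtain s :: "'a \<Rightarrow> nat" where s: "locc X s" "\<forall>x'\<in>X. \<forall>y'\<in>X. s x' = s y' \<longrightarrow> dist x' y' < dist x y"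
    using zd unfolding zero_dim_def by blast
  have "s x \<noteq> s y" using s(2) assms by blast
  then show ?thesis using s(1) by blast
qed

text \<open>The points whose orbit misses the clopen set form a closed invariant set that does not
  contain \<open>z\<close>, so there are none. The first hitting time is locally constant, hence
  bounded by compactness.\<close>

lemma hit:
  assumes P: "locc X P" and z: "z \<in> X" "P z"
  obtains M :: nat where "\<And>x. x \<in> X \<Longrightarrow> \<exists>i. \<bar>i\<bar> \<le> int M \<and> P (zpow a i x)"
proof -
  define Z where "Z = {x\<in>X. \<forall>n. \<not> P (zpow a n x)}"
  have "Z = (\<Inter>n. {x\<in>X. \<not> P (zpow a n x)})" unfolding Z_def by auto
  moreover have "closed {x\<in>X. \<not> P (zpow a n x)}" for n
    using locc_closed[OF compact_imp_closed[OF compact] locc_map[OF locc_z[OF P], where g=Not]] .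
  ultimately have "closed Z" by auto
  moreover have "a ` Z = Z"
  proof
    have "zpow a n (a x) = zpow a (n + 1) x" for n x using zadd[of n 1 x] by simp
    then show "a ` Z \<subseteq> Z" unfolding Z_def by auto
    show "Z \<subseteq> a ` Z"
    proof
      fix x assume x: "x \<in> Z"
      have "zpow a (-1) x \<in> Z" using x unfolding Z_def by (auto simp flip: zadd)
      moreover have "x = a (zpow a (-1) x)" using zinv(2)[of 1 x] by simp
      ultimately show "x \<in> a ` Z" by blast
    qed
  qed
  moreover have "z \<notin> Z" using z zpow_0 unfolding Z_def by (metis (mono_tags, lifting) mem_Collect_eq)
  ultimately have "Z = {}" using min[of Z] z(1) unfolding Z_def by blast
  then have ex: "\<exists>n. P (zpow a n x)" if "x \<in> X" for x using that unfolding Z_def by blast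
  define Q where "Q j x \<longleftrightarrow> P (zpow a (int j) x) \<or> P (zpow a (- int j) x)" for j x
  have lQ: "locc X (Q j)" for j unfolding Q_def by (rule locc_map2[OF locc_z[OF P] locc_z[OF P], where g="(\<or>)"])
  have exQ: "\<exists>j. Q j x" if x: "x \<in> X" for x
  proof -
    obtain n where n: "P (zpow a n x)" using ex[OF x] by blast
    have "Q (nat \<bar>n\<bar>) x" unfolding Q_def using n by (cases "0 \<le> n") auto
    then show ?thesis by blast
  qed
  have fin: "finite ((\<lambda>x. LEAST j. Q j x) ` X)" using locc_finite_range[OF compact locc_Least[OF lQ exQ]] by simp
  define M where "M = Max (insert 0 ((\<lambda>x. LEAST j. Q j x) ` X))"
  show thesis
  proof (rule that[of M])
    fix x assume x: "x \<in> X"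
    let ?j = "LEAST j. Q j x"
    have "Q ?j x" using exQ[OF x] by (rule LeastI_ex)
    moreover have "?j \<le> M" unfolding M_def using fin x by (intro Max_ge) auto
    ultimately show "\<exists>i. \<bar>i\<bar> \<le> int M \<and> P (zpow a i x)"
      unfolding Q_def by (elim disjE) (rule exI, rule conjI[rotated], assumption, simp)+
  qed
qed

text \<open>The two-sided bound \<open>M\<close> yields one-sided returns: counted from the point
  \<open>M\<close> steps below \<open>x\<close>, the hit occurs at an exponent at most
  \<open>M\<close>, which is not above \<open>x\<close>.\<close>

lemma hit_dn:
  assumes "locc X P" "z \<in> X" "P z" "x \<in> X"
  shows "\<exists>j::nat. P (zpow a (- int j) x)"
proof -
  obtain M where M: "\<And>x. x \<in> X \<Longrightarrow> \<exists>i. \<bar>i\<bar> \<le> int M \<and> P (zpow a i x)" using hit[OF assms(1-3)] by metis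
  obtain i where i: "\<bar>i\<bar> \<le> int M" "P (zpow a i (zpow a (- int M) x))" using M[of "zpow a (- int M) x"] assms(4) by auto
  have "i + - int M = - int (nat (int M - i))" using i(1) by auto
  then show ?thesis using i(2) zadd by metis
qed

lemma hit_up:
  assumes "locc X P" "z \<in> X" "P z" "x \<in> X"
  shows "\<exists>j::nat. P (zpow a (int j + 1) x)"
proof -
  obtain M where M: "\<And>x. x \<in> X \<Longrightarrow> \<exists>i. \<bar>i\<bar> \<le> int M \<and> P (zpow a i x)" using hit[OF assms(1-3)] by metis
  obtain i where i: "\<bar>i\<bar> \<le> int M" "P (zpow a i (zpow a (int M + 1) x))" using M[of "zpow a (int M + 1) x"] assms(4) by auto
  have "i + (int M + 1) = int (nat (int M + i)) + 1" using i(1) by auto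
  then show ?thesis using i(2) zadd by metis
qed

text \<open>The transfer function does not decrease along orbits, yet each of its values recurs
  later on every orbit, so it is constant. Consequently the class of a nonempty clopen set is never
  zero.\<close>

lemma coh_nonneg:
  assumes f: "coh X a f" and pos: "\<And>x. x \<in> X \<Longrightarrow> 0 \<le> f x" and x: "x \<in> X"
  shows "f x = 0"
proof -
  obtain h where h: "locc X h" "\<forall>x\<in>X. f x = h (a x) - h x" using f by (auto simp: coh_def)
  have mono: "h y \<le> h (zpow a (int j) y)" if "y \<in> X" for y j
  proof (induction j)
    case (Suc j)
    have "zpow a (int (Suc j)) y = a (zpow a (int j) y)" using zpow_Suc[OF bij, of "int j"] by (simp add: add.commute)
    moreover have "h (zpow a (int j) y) \<le> h (a (zpow a (int j) y))"
      using h(2) pos[of "zpow a (int j) y"] that by simp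
    ultimately show ?case using Suc by simp
  qed simp
  have fin: "finite (h ` X)" using locc_finite_range[OF compact h(1)] .
  have "h y = h z" if y: "y \<in> X" and z: "z \<in> X" for y z
  proof -
    have "h y \<le> h z" if y: "y \<in> X" and z: "z \<in> X" for y z
    proof -
      have "\<exists>j. h (zpow a (int j + 1) y) = h z"
        by (rule hit_up[where P="\<lambda>x. h x = h z", OF _ z refl y]) (rule locc_map[OF h(1), where g="\<lambda>v. v = h z"])
      then obtain j where "h (zpow a (int (Suc j)) y) = h z" by (auto simp: add.commute)
      then show ?thesis using mono[OF y, of "Suc j"] by simp
    qed
    then show ?thesis using y z by (metis order_antisym)
  qed
  then have "h (a x) = h x" using x ain by metis
  then show ?thesis using h(2) x by simp
qed

end

section \<open>Towers\<close>

text \<open>For a clopen base \<open>D\<close>, \<open>dn\<close> and \<open>up\<close> give the position of a point in its tower (counted from the bottom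
  and from the top), and \<open>wd\<close> lists the colours along the whole tower.\<close>

definition dn :: "('a \<Rightarrow> 'a) \<Rightarrow> 'a set \<Rightarrow> 'a \<Rightarrow> nat" where
  "dn a D x = (LEAST j. zpow a (- int j) x \<in> D)"

definition up :: "('a \<Rightarrow> 'a) \<Rightarrow> 'a set \<Rightarrow> 'a \<Rightarrow> nat" where
  "up a D x = (LEAST j. zpow a (int j + 1) x \<in> D)"

definition wd :: "('a \<Rightarrow> 'a) \<Rightarrow> 'a set \<Rightarrow> ('a \<Rightarrow> 'c) \<Rightarrow> 'a \<Rightarrow> 'c list" where
  "wd a D u x = map (\<lambda>i. u (zpow a (int i - int (dn a D x)) x)) [0..<dn a D x + up a D x + 1]"

locale tower = cms X a for X :: "'a::metric_space set" and a +
  fixes D :: "'a set"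
  assumes locc_D: "locc X (\<lambda>x. x \<in> D)" and D_ne: "X \<inter> D \<noteq> {}"
begin

abbreviation "dnD \<equiv> dn a D"
abbreviation "upD \<equiv> up a D"
abbreviation "wdD \<equiv> wd a D"

lemma ex_dn: "x \<in> X \<Longrightarrow> \<exists>j. zpow a (- int j) x \<in> D"
  using hit_dn[OF locc_D] D_ne by auto

lemma ex_up: "x \<in> X \<Longrightarrow> \<exists>j. zpow a (int j + 1) x \<in> D"
  using hit_up[OF locc_D] D_ne by auto

lemma dn_D: "x \<in> X \<Longrightarrow> zpow a (- int (dnD x)) x \<in> D"
  unfolding dn_def using ex_dn by (rule LeastI_ex)

lemma up_D: "x \<in> X \<Longrightarrow> zpow a (int (upD x) + 1) x \<in> D"
  unfolding up_def using ex_up by (rule LeastI_ex)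

lemma mid:
  assumes "x \<in> X" "- int (dnD x) < i" "i \<le> int (upD x)"
  shows "zpow a i x \<notin> D"
proof (cases "i \<le> 0")
  case True
  then have "nat (- i) < dnD x" using assms(2) by simp
  then show ?thesis unfolding dn_def using not_less_Least[of "nat (- i)" "\<lambda>j. zpow a (- int j) x \<in> D"] True by simp
next
  case False
  then have "nat (i - 1) < upD x" using assms(3) by simp
  then show ?thesis unfolding up_def using not_less_Least[of "nat (i - 1)" "\<lambda>j. zpow a (int j + 1) x \<in> D"] False by simp
qed

lemma dn_up_unique:
  assumes "zpow a (- int m) x \<in> D" "zpow a (int n + 1) x \<in> D"
    and mid: "\<And>i. - int m < i \<Longrightarrow> i \<le> int n \<Longrightarrow> zpow a i x \<notin> D"
  shows "dnD x = m" "upD x = n"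
proof -
  show "dnD x = m" unfolding dn_def
  proof (rule Least_equality[where P="\<lambda>j. zpow a (- int j) x \<in> D"])
    show "m \<le> j" if "zpow a (- int j) x \<in> D" for j
      using mid[of "- int j"] that by (cases "j < m") auto
  qed (rule assms(1))
  show "upD x = n" unfolding up_def
  proof (rule Least_equality[where P="\<lambda>j. zpow a (int j + 1) x \<in> D"])
    show "n \<le> j" if "zpow a (int j + 1) x \<in> D" for j
      using mid[of "int j + 1"] that by (cases "j < n") auto
  qed (rule assms(2))
qed

lemma shift:
  assumes x: "x \<in> X" and k: "- int (dnD x) \<le> k" "k \<le> int (upD x)"
  shows "int (dnD (zpow a k x)) = int (dnD x) + k" "int (upD (zpow a k x)) = int (upD x) - k"
    "wdD u (zpow a k x) = wdD u x"
proof -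
  define m n where "m = nat (int (dnD x) + k)" and "n = nat (int (upD x) - k)"
  have mn: "int m = int (dnD x) + k" "int n = int (upD x) - k" using k by (auto simp: m_def n_def)
  have "zpow a (- int m) (zpow a k x) \<in> D" using dn_D[OF x] mn by (simp flip: zadd)
  moreover have "zpow a (int n + 1) (zpow a k x) \<in> D" using up_D[OF x] mn by (simp flip: zadd)
  moreover have "zpow a i (zpow a k x) \<notin> D" if "- int m < i" "i \<le> int n" for i
    using mid[OF x, of "i + k"] mn that by (simp flip: zadd)
  ultimately have du: "dnD (zpow a k x) = m" "upD (zpow a k x) = n"
    using dn_up_unique[of m "zpow a k x" n] by simp_all
  then show "int (dnD (zpow a k x)) = int (dnD x) + k" "int (upD (zpow a k x)) = int (upD x) - k" using mn by auto
  have e: "m + n = dnD x + upD x" using mn by linarith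
  show "wdD u (zpow a k x) = wdD u x"
    unfolding wd_def du e using mn by (auto simp flip: zadd simp del: upt_Suc)
qed

text \<open>An edge ending in the base is exactly one that leaves a tower through its top, so
  avoiding the sources of such edges means staying in the tower.\<close>

lemma avoid_iff:
  assumes x: "x \<in> X"
  shows "avoid a {y. a y \<in> D} k x \<longleftrightarrow> - int (dnD x) \<le> k \<and> k \<le> int (upD x)"
proof
  have s: "a (zpow a i x) = zpow a (i + 1) x" for i using zpow_Suc[OF bij] by simp
  assume A: "avoid a {y. a y \<in> D} k x"
  have n: "zpow a (i + 1) x \<notin> D" if "min 0 k \<le> i" "i < max 0 k" for i
    using A that s unfolding avoid_def by auto
  show "- int (dnD x) \<le> k \<and> k \<le> int (upD x)"
  proof (intro conjI)
    show "- int (dnD x) \<le> k"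
    proof (rule ccontr)
      assume "\<not> - int (dnD x) \<le> k"
      then have "zpow a (- int (dnD x) - 1 + 1) x \<notin> D" by (intro n) auto
      then show False using dn_D[OF x] by simp
    qed
    show "k \<le> int (upD x)"
    proof (rule ccontr)
      assume "\<not> k \<le> int (upD x)"
      then have "zpow a (int (upD x) + 1) x \<notin> D" by (intro n) auto
      then show False using up_D[OF x] by simp
    qed
  qed
next
  have s: "a (zpow a i x) = zpow a (i + 1) x" for i using zpow_Suc[OF bij] by simp
  assume "- int (dnD x) \<le> k \<and> k \<le> int (upD x)"
  then show "avoid a {y. a y \<in> D} k x"
    unfolding avoid_def using mid[OF x] s by (auto simp: min_def max_def split: if_splits)
qed

lemma locc_dn: "locc X dnD"
  unfolding dn_def by (rule locc_Least[OF locc_z[OF locc_D] ex_dn])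

lemma locc_up: "locc X upD"
  unfolding up_def by (rule locc_Least[OF locc_z[OF locc_D] ex_up])

lemma locc_wd:
  assumes "locc X u"
  shows "locc X (wdD u)"
proof -
  have "locc X (\<lambda>x. map (\<lambda>i. u (zpow a (int i - int m) x)) [0..<m + n + 1])" for m n
    by (rule locc_list) (rule locc_z[OF assms])
  then have "locc X (\<lambda>x. map (\<lambda>i. u (zpow a (int i - int m) x)) [0..<m + upD x + 1])" for m
    by (rule locc_bind[OF locc_up, where F="\<lambda>n x. map (\<lambda>i. u (zpow a (int i - int m) x)) [0..<m + n + 1]"])
  then show ?thesis unfolding wd_def
    by (rule locc_bind[OF locc_dn, where F="\<lambda>m x. map (\<lambda>i. u (zpow a (int i - int m) x)) [0..<m + upD x + 1]"])
qed

lemma length_wd [simp]: "length (wdD u x) = dnD x + upD x + 1"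
  by (simp add: wd_def)

lemma wd_nth: "i < dnD x + upD x + 1 \<Longrightarrow> wdD u x ! i = u (zpow a (int i - int (dnD x)) x)"
  unfolding wd_def by (simp del: upt_Suc)

lemma wd_at [simp]: "wdD u x ! dnD x = u x"
  by (simp add: wd_nth)

lemma dn_less [simp]: "dnD x < length (wdD u x)"
  by simp

lemma dn_zero_iff: "x \<in> X \<Longrightarrow> dnD x = 0 \<longleftrightarrow> x \<in> D"
  using dn_D[of x] mid[of x 0] by (cases "dnD x = 0") auto

lemma up_zero_iff: "x \<in> X \<Longrightarrow> upD x = 0 \<longleftrightarrow> a x \<in> D"
  using up_D[of x] mid[of x 1] by (cases "upD x = 0") auto

lemma sum_wd:
  fixes \<phi> :: "'c \<Rightarrow> int"
  shows "sum_list (map \<phi> (wdD u x)) = (\<Sum>i<dnD x + upD x + 1. \<phi> (u (zpow a (int i - int (dnD x)) x)))"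
  unfolding wd_def by (simp add: sum_list_sum_nth atLeast0LessThan del: upt_Suc)

lemma telescope:
  fixes h :: "'a \<Rightarrow> int"
  shows "(\<Sum>i<n. h (a (zpow a (int i + k) x)) - h (zpow a (int i + k) x)) = h (zpow a (int n + k) x) - h (zpow a k x)"
proof (induction n)
  case (Suc n)
  have "a (zpow a (int n + k) x) = zpow a (int (Suc n) + k) x"
    using zpow_Suc[OF bij, of "int n + k" x] by (simp add: algebra_simps)
  then show ?case using Suc by simp
qed simp

text \<open>The sum over a tower telescopes to the difference of \<open>h\<close> at two points of
  the base. The function enters through the colours by \<phi>, so that the conclusion concerns the
  word alone.\<close>

lemma coh_sum_wd:
  fixes f :: "'a \<Rightarrow> int"
  assumes f: "\<And>x. x \<in> X \<Longrightarrow> f x = h (a x) - h x" and h: "\<And>x y. x \<in> D \<Longrightarrow> y \<in> D \<Longrightarrow> h x = h y"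
    and \<phi>: "\<And>x. x \<in> X \<Longrightarrow> \<phi> (u x) = f x" and x: "x \<in> X"
  shows "sum_list (map \<phi> (wdD u x)) = 0"
proof -
  have "sum_list (map \<phi> (wdD u x)) = (\<Sum>i<dnD x + upD x + 1. f (zpow a (int i - int (dnD x)) x))"
    unfolding sum_wd by (rule sum.cong) (use x \<phi> in auto)
  also have "\<dots> = (\<Sum>i<dnD x + upD x + 1. h (a (zpow a (int i + - int (dnD x)) x)) - h (zpow a (int i + - int (dnD x)) x))"
    by (rule sum.cong) (use x f in auto)
  also have "\<dots> = h (zpow a (int (upD x) + 1) x) - h (zpow a (- int (dnD x)) x)"
    unfolding telescope by (simp add: algebra_simps)
  also have "\<dots> = 0" using h[OF up_D[OF x] dn_D[OF x]] by simp
  finally show ?thesis .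
qed

text \<open>The transfer function is the partial sum from the bottom of the tower up to the point;
  the vanishing total makes it consistent when an orbit passes from a top to the next bottom, where
  it restarts at 0.\<close>

lemma sum_wd_coh:
  fixes f :: "'a \<Rightarrow> int"
  assumes f: "locc X f" and s: "\<And>x. x \<in> X \<Longrightarrow> sum_list (wdD f x) = 0"
  shows "coh X a f"
proof -
  define h where "h x = (\<Sum>i<dnD x. f (zpow a (int i - int (dnD x)) x))" for x
  have "locc X (\<lambda>x. \<Sum>i<m. f (zpow a (int i - int m) x))" for m
    by (rule locc_sum) (rule locc_z[OF f])
  then have lh: "locc X h" unfolding h_def
    by (rule locc_bind[OF locc_dn, where F="\<lambda>m x. \<Sum>i<m. f (zpow a (int i - int m) x)"])
  show ?thesis
  proof (rule cohI[OF lh])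
    fix x assume x: "x \<in> X"
    have tot: "(\<Sum>i<dnD x + upD x + 1. f (zpow a (int i - int (dnD x)) x)) = 0"
      using s[OF x] sum_wd[of "\<lambda>c. c" f x] by simp
    show "f x = h (a x) - h x"
    proof (cases "upD x = 0")
      case True
      then have "a x \<in> D" using up_zero_iff[OF x] by simp
      then have "dnD (a x) = 0" using dn_zero_iff x by simp
      then have "h (a x) = 0" by (simp add: h_def)
      moreover have "h x + f x = 0" using tot True by (simp add: h_def)
      ultimately show ?thesis by simp
    next
      case False
      then have "int (dnD (zpow a 1 x)) = int (dnD x) + 1" using shift(1)[OF x, of 1] by simp
      then have d: "dnD (a x) = Suc (dnD x)" by simp
      have "h (a x) = (\<Sum>i<Suc (dnD x). f (zpow a (int i - int (dnD x)) x))"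
        unfolding h_def d
      proof (rule sum.cong[OF refl])
        fix i
        have "int i - int (dnD x) = (int i - int (Suc (dnD x))) + 1" by simp
        then show "f (zpow a (int i - int (Suc (dnD x))) (a x)) = f (zpow a (int i - int (dnD x)) x)"
          using zadd[of "int i - int (Suc (dnD x))" 1 x] by simp
      qed
      then show ?thesis by (simp add: h_def)
    qed
  qed
qed

end

section \<open>Rearranging the levels of towers\<close>

context cms
begin

text \<open>Shrinking the base around \<open>x0\<close> makes finitely many transfer functions
  constant on it, which is what \<open>coh_sum_wd\<close> asks for.\<close>

lemma small_base:
  fixes h :: "'i \<Rightarrow> 'a \<Rightarrow> 'c"
  assumes "finite S" "\<And>c. c \<in> S \<Longrightarrow> locc X (h c)" "locc X (\<lambda>x. x \<in> W)" "x0 \<in> X" "x0 \<in> W"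
  shows "\<exists>D. x0 \<in> D \<and> D \<subseteq> X \<inter> W \<and> (\<forall>c\<in>S. \<forall>x\<in>D. \<forall>y\<in>D. h c x = h c y) \<and> tower X a D"
proof -
  define D where "D = {x\<in>X. x \<in> W \<and> (\<forall>c\<in>S. h c x = h c x0)}"
  have "locc X (\<lambda>x. \<forall>c\<in>S. h c x = h c x0)"
    by (rule locc_ball[OF assms(1)]) (rule locc_map[OF assms(2), where g="\<lambda>v. v = h _ x0"])
  then have "locc X (\<lambda>x. x \<in> W \<and> (\<forall>c\<in>S. h c x = h c x0))" by (rule locc_map2[OF assms(3), where g="(\<and>)"])
  then have l: "locc X (\<lambda>x. x \<in> D)" unfolding D_def by (subst locc_cong[of X]) auto
  have t: "tower X a D" by unfold_locales (use l assms(4,5) in \<open>auto simp: D_def\<close>)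
  have "\<forall>c\<in>S. \<forall>x\<in>D. \<forall>y\<in>D. h c x = h c y" unfolding D_def by simp
  then show ?thesis using t assms(4,5) by (intro exI[of _ D]) (auto simp: D_def)
qed

lemma piecewise_zpow:
  assumes k: "locc X k" and b: "bij_betw \<gamma> X X" and \<gamma>: "\<And>x. x \<in> X \<Longrightarrow> \<gamma> x = zpow a (k x) x" "\<And>x. x \<notin> X \<Longrightarrow> \<gamma> x = x"
    and av: "\<And>x. x \<in> X \<Longrightarrow> avoid a N (k x) x"
  shows "\<gamma> \<in> Homeo X" "\<And>x. x \<in> X \<Longrightarrow> inner_at X a N \<gamma> x"
proof -
  have loc: "\<exists>e>0. \<forall>y\<in>X. dist x y < e \<longrightarrow> \<gamma> y = zpow a (k x) y" if x: "x \<in> X" for x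
  proof -
    obtain e where e: "e > 0" "\<forall>y\<in>X. dist x y < e \<longrightarrow> k y = k x" using k x unfolding locc_def by metis
    then have "\<forall>y\<in>X. dist x y < e \<longrightarrow> \<gamma> y = zpow a (k x) y" using \<gamma>(1) by simp
    then show ?thesis using e(1) by metis
  qed
  then show "inner_at X a N \<gamma> x" if "x \<in> X" for x using that av unfolding inner_at_def by metis
  show "\<gamma> \<in> Homeo X"
    by (rule Homeo_piecewise[OF compact b \<gamma>(2)]) (use loc Homeo_zpow[OF hom] in blast)+
qed

lemma count_list_sum: "int (count (mset xs) c) = sum_list (map (\<lambda>x. of_bool (x = c)) xs)"
  by (induction xs) auto

text \<open>Over a base on which the transfer functions are constant, every tower carries equally many levels of
  each colour for both colourings, so the levels can be permuted inside the tower.\<close>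

lemma permute_colours:
  fixes e e' :: "'a \<Rightarrow> 'c"
  assumes e: "locc X e" "locc X e'" and c: "\<And>c. coh X a (\<lambda>x. of_bool (e x = c) - of_bool (e' x = c))" and p: "p \<in> X"
  obtains \<gamma> where "\<gamma> \<in> Homeo X" "\<And>x. x \<in> X \<Longrightarrow> e' (\<gamma> x) = e x" "\<And>x. x \<in> X \<Longrightarrow> inner_at X a {p} \<gamma> x"
proof -
  define S where "S = e ` X \<union> e' ` X"
  have S: "finite S" unfolding S_def using locc_finite_range[OF compact] e by auto
  have "\<forall>c. \<exists>h :: 'a \<Rightarrow> int. locc X h \<and> (\<forall>x\<in>X. of_bool (e x = c) - of_bool (e' x = c) = h (a x) - h x)" using c unfolding coh_def by blast
  then obtain h :: "'c \<Rightarrow> 'a \<Rightarrow> int" where h: "\<And>c. locc X (h c)"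
    "\<And>c x. x \<in> X \<Longrightarrow> of_bool (e x = c) - of_bool (e' x = c) = h c (a x) - h c x"
    unfolding choice_iff by blast
  \<comment> \<open>The base contains \<open>a p\<close>, so \<open>p\<close> lies on top of its
    tower and motions inside towers do not cross \<open>p\<close>.\<close>
  obtain D where D: "a p \<in> D" "\<forall>c\<in>S. \<forall>x\<in>D. \<forall>y\<in>D. h c x = h c y" "tower X a D"
    using small_base[of S h UNIV "a p"] S h(1) p by auto
  interpret tower X a D by (rule D(3))
  define u where "u x = (e x, e' x)" for x
  have u: "locc X u" unfolding u_def by (rule locc_map2[OF e, where g=Pair])
  have ms: "mset (map fst (wdD u x)) = mset (map snd (wdD u x))" if x: "x \<in> X" for x
  proof (rule multiset_eqI)
    fix c
    define \<phi> :: "'c \<times> 'c \<Rightarrow> int" where "\<phi> q = of_bool (fst q = c) - of_bool (snd q = c)" for q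
    have "sum_list (map \<phi> (wdD u x)) = 0"
    proof (cases "c \<in> S")
      case True
      show ?thesis by (rule coh_sum_wd[where h="h c" and f="\<lambda>x. of_bool (e x = c) - of_bool (e' x = c)"])
          (fact h(2), use D(2) True in blast, simp add: \<phi>_def u_def, fact x)
    next
      case False
      \<comment> \<open>A colour outside \<open>S\<close> occurs nowhere, so the difference vanishes
        identically and the zero transfer function serves.\<close>
      show ?thesis by (rule coh_sum_wd[where h="\<lambda>_. 0" and f="\<lambda>x. of_bool (e x = c) - of_bool (e' x = c)"])
          (use False x in \<open>auto simp: \<phi>_def u_def S_def\<close>)
    qed
    moreover have "sum_list (map \<phi> xs) = int (count (mset (map fst xs)) c) - int (count (mset (map snd xs)) c)" for xs
      unfolding count_list_sum \<phi>_def by (induction xs) auto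
    ultimately show "count (mset (map fst (wdD u x))) c = count (mset (map snd (wdD u x))) c" by simp
  qed
  have "\<exists>\<pi>. \<pi> permutes {..<length w} \<and> (\<forall>j<length w. snd (w ! \<pi> j) = fst (w ! j))"
    if w: "mset (map fst w) = mset (map snd w)" for w :: "('c \<times> 'c) list"
  proof -
    obtain \<pi> where \<pi>: "\<pi> permutes {..<length (map snd w)}" "permute_list \<pi> (map snd w) = map fst w"
      using mset_eq_permutation[OF w] by metis
    have "snd (w ! \<pi> j) = fst (w ! j)" if j: "j < length w" for j
    proof -
      have pj: "\<pi> j < length w" using permutes_in_image[OF \<pi>(1), of j] j by simp
      have "fst (w ! j) = permute_list \<pi> (map snd w) ! j" using \<pi>(2) j by simp
      also have "\<dots> = snd (w ! \<pi> j)" using permute_list_nth[OF \<pi>(1)] j pj by simp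
      finally show ?thesis by simp
    qed
    then show ?thesis using \<pi>(1) by auto
  qed
  \<comment> \<open>The permutation is chosen for each word and not for each point: all points of
    one tower then use the same permutation, and the exponent \<open>k\<close> is locally
    constant.\<close>
  then obtain \<pi> where \<pi>: "\<And>w :: ('c \<times> 'c) list. mset (map fst w) = mset (map snd w) \<Longrightarrow>
      \<pi> w permutes {..<length w} \<and> (\<forall>j<length w. snd (w ! \<pi> w j) = fst (w ! j))" by metis
  define k where "k x = int (\<pi> (wdD u x) (dnD x)) - int (dnD x)" for x
  define \<gamma> where "\<gamma> x = (if x \<in> X then zpow a (k x) x else x)" for x
  have lk: "locc X k" unfolding k_def by (rule locc_map2[OF locc_wd[OF u] locc_dn, where g="\<lambda>w j. int (\<pi> w j) - int j"])
  have perm: "\<pi> (wdD u x) permutes {..<dnD x + upD x + 1}" if "x \<in> X" for x using \<pi>[OF ms[OF that]] by simp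
  have k: "- int (dnD x) \<le> k x" "k x \<le> int (upD x)" if x: "x \<in> X" for x
    using permutes_in_image[OF perm[OF x], of "dnD x"] unfolding k_def by auto
  have sh: "int (dnD (\<gamma> x)) = int (\<pi> (wdD u x) (dnD x))" "wdD u (\<gamma> x) = wdD u x" if x: "x \<in> X" for x
    using shift[OF x k[OF x]] x by (auto simp: \<gamma>_def k_def)
  have "bij_betw \<gamma> X X"
  proof (rule bij_betw_imageI)
    show "inj_on \<gamma> X"
    proof (rule inj_onI)
      fix x y assume xy: "x \<in> X" "y \<in> X" "\<gamma> x = \<gamma> y"
      have w: "wdD u x = wdD u y" using sh(2)[OF xy(1)] sh(2)[OF xy(2)] xy(3) by simp
      then have "\<pi> (wdD u x) (dnD x) = \<pi> (wdD u x) (dnD y)" using sh(1)[OF xy(1)] sh(1)[OF xy(2)] xy(3) by simp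
      then have "dnD x = dnD y" using permutes_inj[OF perm[OF xy(1)]] by (simp add: inj_eq)
      then have "k x = k y" using w by (simp add: k_def)
      then show "x = y" using xy zinv(1) by (metis \<gamma>_def)
    qed
    show "\<gamma> ` X = X"
    proof
      show "\<gamma> ` X \<subseteq> X" by (auto simp: \<gamma>_def)
      show "X \<subseteq> \<gamma> ` X"
      proof
        fix y assume y: "y \<in> X"
        define j where "j = inv (\<pi> (wdD u y)) (dnD y)"
        have j: "\<pi> (wdD u y) j = dnD y" unfolding j_def using permutes_inverses(1)[OF perm[OF y]] .
        have jl: "j < dnD y + upD y + 1" using permutes_in_image[OF perm[OF y], of j] j by simp
        define x where "x = zpow a (int j - int (dnD y)) y"
        have x: "x \<in> X" using y by (simp add: x_def)
        have s: "int (dnD x) = int j" "wdD u x = wdD u y"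
          using shift[OF y, of "int j - int (dnD y)"] jl unfolding x_def by auto
        have "k x = int (dnD y) - int j" unfolding k_def s(2) using s(1) j by simp
        then have "\<gamma> x = y" unfolding \<gamma>_def using x by (simp add: x_def flip: zadd)
        then show "y \<in> \<gamma> ` X" using x by blast
      qed
    qed
  qed
  moreover have "avoid a {p} (k x) x" if x: "x \<in> X" for x
  proof -
    have "avoid a {y. a y \<in> D} (k x) x" using avoid_iff[OF x] k[OF x] by blast
    then show ?thesis by (rule avoid_mono) (use D(1) in auto)
  qed
  ultimately have "\<gamma> \<in> Homeo X" "\<And>x. x \<in> X \<Longrightarrow> inner_at X a {p} \<gamma> x"
    using piecewise_zpow[OF lk, of \<gamma> "{p}"] by (auto simp: \<gamma>_def)
  moreover have "e' (\<gamma> x) = e x" if x: "x \<in> X" for x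
  proof -
    have "e' (\<gamma> x) = snd (wdD u (\<gamma> x) ! dnD (\<gamma> x))" by (simp add: u_def)
    also have "\<dots> = snd (wdD u x ! \<pi> (wdD u x) (dnD x))" using sh[OF x] by simp
    also have "\<dots> = fst (wdD u x ! dnD x)" using \<pi>[OF ms[OF x]] dn_less by blast
    finally show ?thesis by (simp add: u_def)
  qed
  ultimately show thesis using that by blast
qed

lemma inner_class_pres: "t \<in> Homeo X \<Longrightarrow> (\<And>x. x \<in> X \<Longrightarrow> inner_at X a N t x) \<Longrightarrow> t \<in> class_pres X a"
  using class_pres_inner[OF compact zd hom] by blast

text \<open>That \<open>g\<close> preserves classes says precisely that the colourings
  \<open>v \<circ> g\<close> and \<open>v\<close> are cohomologous colour by colour.\<close>

lemma approx_class_pres: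
  assumes g: "g \<in> class_pres X a" and v: "locc X v" and p: "p \<in> X"
  obtains s where "s \<in> Homeo X" "\<And>x. x \<in> X \<Longrightarrow> v (s x) = v (g x)" "\<And>x. x \<in> X \<Longrightarrow> inner_at X a {p} s x"
proof (rule permute_colours[OF _ v _ p, of "\<lambda>x. v (g x)"])
  have h: "g \<in> Homeo X" using g by (auto simp: class_pres_def)
  show "locc X (\<lambda>x. v (g x))" by (rule locc_Homeo[OF v h])
  fix c
  have "locc X (\<lambda>x. of_bool (v x = c) :: int)" by (rule locc_map[OF v, where g="\<lambda>v. of_bool (v = c)"])
  then show "coh X a (\<lambda>x. of_bool (v (g x) = c) - of_bool (v x = c))" using g by (auto simp: class_pres_def)
qed (use that in blast)

end

section \<open>The interlacing step\<close>

text \<open>One step of the back-and-forth: \<open>b\<close> is already expressed through \<open>a\<close> off \<open>N\<close>. Inside the towers of \<open>a\<close> over a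
  small base, levels that meet the \<open>b\<close>-base are matched by elements \<open>sx\<close> of the full group of \<open>b\<close>; the map \<open>F\<close>
  conjugates \<open>a\<close> so that it is given by these elements off a smaller neighbourhood \<open>N'\<close> of \<open>p\<close>, while commuting
  with \<open>b\<close> off \<open>N\<close>.\<close>

locale interlace = A: cms X a + B: cms X b
  for X :: "'a::metric_space set" and a b +
  fixes p :: 'a and N M :: "'a set" and v :: "'a \<Rightarrow> 'c"
  assumes coh_eq: "\<And>f. coh X a f \<longleftrightarrow> coh X b f"
    and p: "p \<in> X" and ap: "a p = b p" and N: "locc X (\<lambda>x. x \<in> N)" "p \<in> N" "N \<subseteq> X"
    and bN: "\<And>x. x \<in> X \<Longrightarrow> x \<notin> N \<Longrightarrow> inner_at X a {p} b x"
    and M: "locc X (\<lambda>x. x \<in> M)" "p \<in> M" and v: "locc X v"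
begin

text \<open>The image of \<open>N\<close> under \<open>b\<close>, so that the tops of the
  \<open>b\<close>-towers are exactly the points of \<open>N\<close>.\<close>

definition B0 where "B0 = {x\<in>X. inv b x \<in> N}"

lemma B0_iff: "x \<in> X \<Longrightarrow> b x \<in> B0 \<longleftrightarrow> x \<in> N"
  using B.hom by (auto simp: B0_def)

lemma ap_B0: "a p \<in> B0"
  using B0_iff[OF p] N(2) ap by simp

sublocale TB: tower X b B0
proof unfold_locales
  have "locc X (\<lambda>x. inv b x \<in> N)" by (rule locc_Homeo[OF N(1) Homeo_inv[OF B.hom]])
  then show "locc X (\<lambda>x. x \<in> B0)" by (subst locc_cong[of X]) (auto simp: B0_def)
  have "a p \<in> X \<inter> B0" using ap_B0 p by simp
  then show "X \<inter> B0 \<noteq> {}" by blast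
qed

abbreviation "dnB \<equiv> dn b B0"
abbreviation "upB \<equiv> up b B0"

text \<open>The bottom of the \<open>b\<close>-tower through \<open>x\<close>.\<close>

definition bs where "bs x = zpow b (- int (dnB x)) x"

lemma bs_in [simp]: "bs x \<in> X \<longleftrightarrow> x \<in> X"
  by (simp add: bs_def)

text \<open>Descending inside a \<open>b\<close>-tower only uses edges that start off
  \<open>N\<close>, where \<open>b\<close> is already a power of \<open>a\<close> that does not
  cross \<open>p\<close>.\<close>

lemma inner_down:
  assumes x: "x \<in> X"
  shows "m \<le> dnB x \<Longrightarrow> inner_at X a {p} (zpow b (- int m)) x"
proof (induction m)
  case 0
  have e: "zpow b (- int 0) = zpow a 0" by (simp add: zpow_def)
  show ?case unfolding e by (rule inner_at_zpow) simp
next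
  case (Suc m)
  define z where "z = zpow b (- int m) x"
  have z: "z \<in> X" using x by (simp add: z_def)
  have "z \<notin> B0" unfolding z_def by (rule TB.mid[OF x]) (use Suc in auto)
  then have y: "inv b z \<in> X" "inv b z \<notin> N" using z Homeo_inv_iff[OF B.hom] by (auto simp: B0_def)
  have "inner_at X a {p} (inv b) (b (inv b z))"
    by (rule inner_at_inverse[OF A.hom y(1) bN[OF y]]) (use B.hom in simp)
  then have "inner_at X a {p} (inv b) z" using B.hom by simp
  then have "inner_at X a {p} (\<lambda>y. inv b (zpow b (- int m) y)) x"
    using inner_at_comp[OF A.hom x, of "{p}" "zpow b (- int m)" "inv b"] Suc by (simp add: z_def)
  moreover have "inv b (zpow b (- int m) y) = zpow b (- int (Suc m)) y" for y
  proof -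
    have "- int (Suc m) = - int m - 1" by simp
    then show ?thesis using zpow_pred[OF B.bij, of "- int m" y] by (simp only:)
  qed
  ultimately show ?case by simp
qed

text \<open>The exponent by which \<open>a\<close> takes \<open>x\<close> to the bottom of its
  \<open>b\<close>-tower; unique because \<open>a\<close> is aperiodic.\<close>

definition \<kappa> where "\<kappa> x = (THE k. bs x = zpow a k x)"

lemma inner_bs: assumes x: "x \<in> X" shows "inner_at X a {p} bs x"
proof -
  obtain e where e: "e > 0" "\<forall>y\<in>X. dist x y < e \<longrightarrow> dnB y = dnB x" using TB.locc_dn x unfolding locc_def by metis
  show ?thesis by (rule inner_at_local[OF inner_down[OF x order_refl] e(1)]) (use e(2) in \<open>simp add: bs_def\<close>)
qed

lemma kappaI: "x \<in> X \<Longrightarrow> bs x = zpow a k x \<Longrightarrow> \<kappa> x = k"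
  unfolding \<kappa>_def using A.zpow_inj by (metis (mono_tags, lifting) the_equality)

lemma kappa: assumes x: "x \<in> X" shows "bs x = zpow a (\<kappa> x) x" "avoid a {p} (\<kappa> x) x"
proof -
  obtain k e where k: "e > 0" "\<forall>y\<in>X. dist x y < e \<longrightarrow> bs y = zpow a k y" "avoid a {p} k x"
    using inner_bs[OF x] unfolding inner_at_def by metis
  then have "bs x = zpow a k x" using x by simp
  then show "bs x = zpow a (\<kappa> x) x" "avoid a {p} (\<kappa> x) x" using kappaI[OF x, of k] k(3) by auto
qed

lemma locc_kappa: "locc X \<kappa>"
proof (rule loccI)
  fix x assume x: "x \<in> X"
  obtain k e where k: "e > 0" "\<forall>y\<in>X. dist x y < e \<longrightarrow> bs y = zpow a k y"
    using inner_bs[OF x] unfolding inner_at_def by metis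
  have "\<kappa> y = k" if "y \<in> X" "dist x y < e" for y using kappaI k(2) that by simp
  then have "\<forall>y\<in>X. dist x y < e \<longrightarrow> \<kappa> y = \<kappa> x" using x k(1) by simp
  then show "\<exists>e>0. \<forall>y\<in>X. dist x y < e \<longrightarrow> \<kappa> y = \<kappa> x" using k(1) by metis
qed

definition K where "K = (SOME K. 0 \<le> K \<and> (\<forall>x\<in>X. \<bar>\<kappa> x\<bar> \<le> K))"

lemma K: "x \<in> X \<Longrightarrow> \<bar>\<kappa> x\<bar> \<le> K"
  using someI_ex[OF locc_bounded[OF A.compact locc_kappa]] unfolding K_def by blast

definition on_path where "on_path i k \<longleftrightarrow> min 0 k \<le> i \<and> i < max (0::int) k"

text \<open>Removes from \<open>N \<inter> M\<close> every source of an edge on some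
  \<open>a\<close>-path from a point to the bottom of its \<open>b\<close>-tower: \<open>q\<close>
  is visited at time \<open>i\<close> by the path starting at \<open>zpow a (- i) q\<close>, and
  only times up to the bound \<open>K\<close> of \<kappa> can occur. The point \<open>p\<close>
  stays, since these paths avoid it.\<close>

definition N' where
  "N' = {q\<in>X. q \<in> N \<and> q \<in> M \<and> (\<forall>i\<in>{-K..K}. \<not> on_path i (\<kappa> (zpow a (- i) q)))}"

lemma locc_N': "locc X (\<lambda>x. x \<in> N')"
proof -
  have "locc X (\<lambda>q. \<forall>i\<in>{-K..K}. \<not> on_path i (\<kappa> (zpow a (- i) q)))"
    by (rule locc_ball, simp) (rule locc_map[OF A.locc_z[OF locc_kappa], where g="\<lambda>k. \<not> on_path _ k"])
  from locc_map2[OF N(1) locc_map2[OF M(1) this, where g="(\<and>)"], where g="(\<and>)"]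
  show ?thesis by (subst locc_cong[of X]) (auto simp: N'_def)
qed

lemma p_N': "p \<in> N'"
proof -
  have "\<not> on_path i (\<kappa> (zpow a (- i) p))" for i
  proof
    assume "on_path i (\<kappa> (zpow a (- i) p))"
    then have "zpow a i (zpow a (- i) p) \<noteq> p"
      using kappa(2)[of "zpow a (- i) p"] p unfolding avoid_def on_path_def by auto
    then show False by simp
  qed
  then show ?thesis using p N(2) M(2) by (simp add: N'_def)
qed

lemma N'_sub: "N' \<subseteq> N" "N' \<subseteq> M" "N' \<subseteq> X"
  by (auto simp: N'_def)

lemma avoid_N': assumes x: "x \<in> X" shows "avoid a N' (\<kappa> x) x"
  unfolding avoid_def
proof (intro allI impI notI)
  fix i assume i: "min 0 (\<kappa> x) \<le> i \<and> i < max 0 (\<kappa> x)" and n: "zpow a i x \<in> N'"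
  have "i \<in> {-K..K}" using K[OF x] i by auto
  moreover have "\<forall>j\<in>{-K..K}. \<not> on_path j (\<kappa> (zpow a (- j) (zpow a i x)))" using n by (simp add: N'_def)
  ultimately have "\<not> on_path i (\<kappa> (zpow a (- i) (zpow a i x)))" by (rule bspec[rotated])
  then show False using i by (simp add: on_path_def)
qed

text \<open>The image of \<open>N'\<close> under \<open>a\<close>, so that the tops of the
  \<open>a\<close>-towers are exactly the points of \<open>N'\<close>.\<close>

definition C where "C = {x\<in>X. inv a x \<in> N'}"

lemma C_iff: "a x \<in> C \<longleftrightarrow> x \<in> N'"
  using A.hom N'_sub(3) by (auto simp: C_def)

lemma C_eq: "{y. a y \<in> C} = N'"
  using C_iff by auto

sublocale TA: tower X a C
proof unfold_locales
  have "locc X (\<lambda>x. inv a x \<in> N')" by (rule locc_Homeo[OF locc_N' Homeo_inv[OF A.hom]])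
  then show "locc X (\<lambda>x. x \<in> C)" by (subst locc_cong[of X]) (auto simp: C_def)
  have "a p \<in> X \<inter> C" using C_iff[of p] p_N' p by simp
  then show "X \<inter> C \<noteq> {}" by blast
qed

abbreviation "dnA \<equiv> dn a C"
abbreviation "upA \<equiv> up a C"

text \<open>Every point of a \<open>b\<close>-tower lies in the \<open>a\<close>-tower of its
  bottom, so the \<open>a\<close>-towers are unions of \<open>b\<close>-towers. This is why
  \<open>N'\<close> had to avoid the paths.\<close>

lemma kappa_range: "x \<in> X \<Longrightarrow> - int (dnA x) \<le> \<kappa> x" "x \<in> X \<Longrightarrow> \<kappa> x \<le> int (upA x)"
  using TA.avoid_iff[of x "\<kappa> x"] avoid_N'[of x] C_eq by auto

definition yp where "yp = zpow a (- int (dnA p)) p"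

text \<open>Tells apart the bottoms \<open>a p\<close> and \<open>yp\<close> of the towers
  containing \<open>a p\<close> and \<open>p\<close>. The two towers then have different words, and
  their reference levels can be prescribed independently.\<close>

definition sep :: "'a \<Rightarrow> nat" where "sep = (SOME s. locc X s \<and> s (a p) \<noteq> s yp)"

lemma sep: "locc X sep" "sep (a p) \<noteq> sep yp"
proof -
  have "yp \<noteq> a p"
  proof
    assume e: "yp = a p"
    have "zpow a (- int (dnA p)) p = zpow a 1 p" using e by (simp add: yp_def)
    then have "- int (dnA p) = 1" using A.zpow_inj[OF p] by blast
    then show False by simp
  qed
  moreover have "yp \<in> X" "a p \<in> X" using p by (auto simp: yp_def)
  ultimately have "\<exists>s::'a \<Rightarrow> nat. locc X s \<and> s (a p) \<noteq> s yp" using A.separate[of "a p" yp] by metis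
  from someI_ex[OF this] show "locc X sep" "sep (a p) \<noteq> sep yp" unfolding sep_def by blast+
qed

text \<open>All that the conjugation has to respect: the prescribed colour, the position in the
  \<open>b\<close>-tower, the exponents \<kappa> along the whole \<open>b\<close>-tower (whose
  length also gives its height), and the separating colour.\<close>

definition u where "u x = (v x, dnB x, wd b B0 \<kappa> x, sep x)"

lemma locc_u: "locc X u"
  unfolding u_def
  by (rule locc_map2[OF v locc_map2[OF TB.locc_dn locc_map2[OF TB.locc_wd[OF locc_kappa] sep(1), where g=Pair], where g=Pair], where g=Pair])

abbreviation "w \<equiv> wd a C u"

definition lev where "lev x = (w x, int (dnA x))"

lemma locc_lev: "locc X lev"
  unfolding lev_def by (rule locc_map2[OF TA.locc_wd[OF locc_u] TA.locc_dn, where g="\<lambda>w d. (w, int d)"])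

lemma lev_u: "lev x = lev y \<Longrightarrow> u x = u y"
  unfolding lev_def by (metis TA.wd_at Pair_inject of_nat_eq_iff)

lemma lev_up: assumes "lev x = lev y" shows "upA x = upA y"
proof -
  have "length (w x) = length (w y)" "dnA x = dnA y" using assms by (auto simp: lev_def)
  then show ?thesis by simp
qed

lemma lev_shift:
  assumes "x \<in> X" "- int (dnA x) \<le> k" "k \<le> int (upA x)"
  shows "lev (zpow a k x) = (w x, int (dnA x) + k)"
  unfolding lev_def using TA.shift[OF assms] by simp

lemma lev_B:
  assumes "lev x = lev y"
  shows "dnB x = dnB y" "upB x = upB y" "wd b B0 \<kappa> x = wd b B0 \<kappa> y" "v x = v y"
proof -
  have e: "u x = u y" using lev_u[OF assms] .
  then show 1: "dnB x = dnB y" and 2: "wd b B0 \<kappa> x = wd b B0 \<kappa> y" and "v x = v y" by (auto simp: u_def)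
  have "length (wd b B0 \<kappa> x) = length (wd b B0 \<kappa> y)" using 2 by simp
  then show "upB x = upB y" using 1 by simp
qed

lemma bs_facts:
  assumes x: "x \<in> X"
  shows "dnB (bs x) = 0" "upB (bs x) = dnB x + upB x" "wd b B0 \<kappa> (bs x) = wd b B0 \<kappa> x"
    "lev (bs x) = (w x, int (dnA x) + \<kappa> x)" "w (bs x) = w x"
proof -
  have s: "int (dnB (bs x)) = int (dnB x) + - int (dnB x)" "int (upB (bs x)) = int (upB x) - - int (dnB x)"
    "wd b B0 \<kappa> (bs x) = wd b B0 \<kappa> x"
    unfolding bs_def by (rule TB.shift[OF x]; simp)+
  show "dnB (bs x) = 0" "upB (bs x) = dnB x + upB x" using s(1,2) by linarith+
  show "wd b B0 \<kappa> (bs x) = wd b B0 \<kappa> x" by (rule s(3))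
  show l: "lev (bs x) = (w x, int (dnA x) + \<kappa> x)"
    using lev_shift[OF x kappa_range[OF x]] kappa(1)[OF x] by simp
  show "w (bs x) = w x" using l by (simp add: lev_def)
qed

text \<open>A reference level for each word, sitting at the bottom of a \<open>b\<close>-tower. For
  the words of the towers of \<open>a p\<close> and \<open>p\<close> it is the bottom below that
  very point; reference levels are not moved, so \<open>F\<close> fixes both points.\<close>

definition bref where
  "bref \<omega> = (if \<omega> = w (a p) then a p else if \<omega> = w p then bs p else bs (SOME x. x \<in> X \<and> w x = \<omega>))"

lemma bref:
  assumes x: "x \<in> X"
  shows "w (bref (w x)) = w x"
proof -
  have "\<exists>y. y \<in> X \<and> w y = w x" using x by blast
  from someI_ex[OF this] have "w (bs (SOME y. y \<in> X \<and> w y = w x)) = w x"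
    using bs_facts(5)[of "SOME y. y \<in> X \<and> w y = w x"] by simp
  then show ?thesis using bs_facts(5)[OF p] by (auto simp: bref_def)
qed

definition jr where "jr \<omega> = int (dnA (bref \<omega>))"

lemma jr_range:
  assumes x: "x \<in> X"
  shows "- int (dnA x) \<le> jr (w x) - int (dnA x)" "jr (w x) - int (dnA x) \<le> int (upA x)"
proof -
  have "length (w (bref (w x))) = length (w x)" using bref[OF x] by simp
  then show "- int (dnA x) \<le> jr (w x) - int (dnA x)" "jr (w x) - int (dnA x) \<le> int (upA x)"
    unfolding jr_def by simp_all
qed

text \<open>The point of the \<open>a\<close>-tower of \<open>x\<close> on the reference level of
  its word.\<close>

definition rho where "rho x = zpow a (jr (w x) - int (dnA x)) x"

lemma rho_in [simp]: "rho x \<in> X \<longleftrightarrow> x \<in> X"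
  by (simp add: rho_def)

lemma lev_rho: "x \<in> X \<Longrightarrow> lev (rho x) = (w x, jr (w x))"
  unfolding rho_def using lev_shift[OF _ jr_range] by simp

text \<open>An element of the full group of \<open>b\<close> that carries the reference level of the
  word onto the level \<open>L\<close>, thus imitating by \<open>b\<close> what a power of
  \<open>a\<close> does; the identity if \<open>L\<close> is the reference level itself.\<close>

definition is_sx where
  "is_sx L s \<longleftrightarrow> s \<in> Homeo X \<and> (\<forall>y\<in>X. lev (s y) = L \<longleftrightarrow> lev y = (fst L, jr (fst L))) \<and>
     (\<forall>y\<in>X. inner_at X b {p} s y) \<and> (L = (fst L, jr (fst L)) \<longrightarrow> s = (\<lambda>y. y))"

definition sx where "sx L = (SOME s. is_sx L s)"

text \<open>The two levels are translates of each other under a power of \<open>a\<close>, so their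
  indicators are cohomologous for \<open>a\<close> and hence for \<open>b\<close>;
  \<open>permute_colours\<close> applied to \<open>b\<close> supplies the map.\<close>

lemma sx:
  assumes x: "x \<in> X"
  shows "is_sx (lev x) (sx (lev x))"
proof -
  have "\<exists>s. is_sx (lev x) s"
  proof (cases "lev x = (fst (lev x), jr (fst (lev x)))")
    case True
    have "inner_at X b {p} (\<lambda>y. y) y" for y
      using inner_at_zpow[of b "{p}" 0 y X] by (simp add: zpow_def id_def)
    moreover have "lev y = lev x \<longleftrightarrow> lev y = (fst (lev x), jr (fst (lev x)))" for y using True by metis
    ultimately have "is_sx (lev x) (\<lambda>y. y)" unfolding is_sx_def using Homeo_id by blast
    then show ?thesis by (rule exI[of "is_sx (lev x)" "\<lambda>y. y"])
  next
    case False
    define r where "r = (w x, jr (w x))"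
    define k where "k = int (dnA x) - jr (w x)"
    have iff: "lev y = r \<longleftrightarrow> lev (zpow a k y) = lev x" if y: "y \<in> X" for y
    proof
      assume l: "lev y = r"
      then have d: "int (dnA y) = jr (w x)" "w y = w x" by (auto simp: lev_def r_def)
      have "length (w y) = length (w x)" using d by simp
      then have "- int (dnA y) \<le> k" "k \<le> int (upA y)" unfolding k_def using d(1) by simp_all
      from lev_shift[OF y this] show "lev (zpow a k y) = lev x" using d by (simp add: lev_def k_def)
    next
      define z where "z = zpow a k y"
      assume "lev (zpow a k y) = lev x"
      then have l: "lev z = lev x" by (simp add: z_def)
      have z: "z \<in> X" using y by (simp add: z_def)
      have d: "dnA z = dnA x" "w z = w x" "upA z = upA x" using l lev_up[OF l] by (auto simp: lev_def)
      have "- int (dnA z) \<le> - k" "- k \<le> int (upA z)" using jr_range[OF x] d by (auto simp: k_def)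
      from lev_shift[OF z this] have "lev (zpow a (- k) z) = r" using d by (simp add: r_def k_def)
      then show "lev y = r" by (simp add: z_def)
    qed
    define f :: "'a \<Rightarrow> int" where "f y = of_bool (lev y = lev x)" for y
    have "locc X f" unfolding f_def by (rule locc_map[OF locc_lev, where g="\<lambda>l. of_bool (l = lev x)"])
    then have c: "coh X b (\<lambda>y. f (zpow a k y) - f y)" using coh_zpow[OF A.hom] coh_eq by blast
    have cc: "coh X b (\<lambda>y. of_bool ((lev y = r) = t) - of_bool ((lev y = lev x) = t))" for t
    proof (cases t)
      case True
      show ?thesis by (rule iffD1[OF coh_cong c]) (use True iff in \<open>simp add: f_def\<close>)
    next
      case False
      show ?thesis by (rule iffD1[OF coh_cong coh_uminus[OF c]]) (use False iff in \<open>simp add: f_def\<close>)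
    qed
    have l: "locc X (\<lambda>y. lev y = r)" "locc X (\<lambda>y. lev y = lev x)"
      using locc_map[OF locc_lev, where g="\<lambda>l. l = r"] locc_map[OF locc_lev, where g="\<lambda>l. l = lev x"] by auto
    obtain s where s: "s \<in> Homeo X" "\<forall>y\<in>X. (lev (s y) = lev x) = (lev y = r)" "\<forall>y\<in>X. inner_at X b {p} s y"
      by (rule B.permute_colours[OF l cc p]) blast
    have "fst (lev x) = w x" by (simp add: lev_def)
    then have "is_sx (lev x) s" unfolding is_sx_def using s False by (simp add: r_def)
    then show ?thesis by (rule exI[where x=s])
  qed
  then show ?thesis unfolding sx_def by (rule someI_ex)
qed

lemma sxD:
  assumes x: "x \<in> X"
  shows "sx (lev x) \<in> Homeo X" "\<And>y. y \<in> X \<Longrightarrow> lev (sx (lev x) y) = lev x \<longleftrightarrow> lev y = (w x, jr (w x))"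
    "\<And>y. y \<in> X \<Longrightarrow> inner_at X b {p} (sx (lev x)) y" "int (dnA x) = jr (w x) \<Longrightarrow> sx (lev x) = (\<lambda>y. y)"
  using sx[OF x] unfolding is_sx_def by (auto simp: lev_def)

text \<open>Goes to the reference level by \<open>a\<close> and returns to the original level by an
  element of the full group of \<open>b\<close>.\<close>

definition F0 where "F0 z = sx (lev z) (rho z)"

lemma F0:
  assumes z: "z \<in> X"
  shows "F0 z \<in> X" "lev (F0 z) = lev z"
  unfolding F0_def using sxD(2)[OF z, of "rho z"] lev_rho[OF z] z HomeoD(4)[OF sxD(1)[OF z]] by auto

text \<open>\<open>F0\<close> is used on bottoms of \<open>b\<close>-towers only and continued
  upwards by powers of \<open>b\<close>, which makes \<open>F\<close> commute with \<open>b\<close>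
  inside \<open>b\<close>-towers.\<close>

definition F where "F x = (if x \<in> X then zpow b (int (dnB x)) (F0 (bs x)) else x)"

lemma F_facts:
  assumes x: "x \<in> X"
  shows "F x \<in> X" "dnB (F x) = dnB x" "bs (F x) = F0 (bs x)" "lev (F x) = lev x"
proof -
  define z' where "z' = F0 (bs x)"
  have z: "bs x \<in> X" using x by simp
  have z': "z' \<in> X" "lev z' = lev (bs x)" using F0[OF z] by (auto simp: z'_def)
  have Fx: "F x = zpow b (int (dnB x)) z'" using x by (simp add: F_def z'_def)
  show Fin: "F x \<in> X" using z'(1) Fx by simp
  have "dnB z' = 0" "upB z' = dnB x + upB x" using lev_B[OF z'(2)] bs_facts[OF x] by auto
  then have r: "- int (dnB z') \<le> int (dnB x)" "int (dnB x) \<le> int (upB z')" by auto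
  note s = TB.shift[OF z'(1) r]
  show d: "dnB (F x) = dnB x" using s(1) \<open>dnB z' = 0\<close> Fx by simp
  show bsF: "bs (F x) = F0 (bs x)" unfolding bs_def d by (simp add: Fx z'_def bs_def)
  \<comment> \<open>The exponent \<kappa> at \<open>x\<close> is a letter of its
    \<open>b\<close>-tower word, which \<open>F0\<close> preserves at the bottom. Since the level of
    a point is recovered from the level of its bottom and \<kappa>, it is preserved as well.\<close>
  have W: "wd b B0 \<kappa> (F x) = wd b B0 \<kappa> x" using s(3)[of \<kappa>] lev_B(3)[OF z'(2)] bs_facts(3)[OF x] Fx by simp
  have "\<kappa> (F x) = \<kappa> x" using TB.wd_at[of \<kappa> "F x"] TB.wd_at[of \<kappa> x] W d by simp
  moreover have "lev (bs (F x)) = lev (bs x)" using bsF z'(2) by (simp add: z'_def)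
  ultimately show "lev (F x) = lev x" using bs_facts(4)[OF x] bs_facts(4)[OF Fin] by (simp add: lev_def)
qed

lemma F0_inj:
  assumes "z \<in> X" "z' \<in> X" "F0 z = F0 z'"
  shows "z = z'"
proof -
  have l: "lev z = lev z'" using F0(2)[OF assms(1)] F0(2)[OF assms(2)] assms(3) by simp
  have "inj (sx (lev z))" using HomeoD(1)[OF sxD(1)[OF assms(1)]] bij_is_inj by blast
  then have "rho z = rho z'" using assms(3) l unfolding F0_def by (simp add: inj_eq)
  then have "zpow a (jr (w z) - int (dnA z)) z = zpow a (jr (w z) - int (dnA z)) z'"
    using l by (simp add: rho_def lev_def)
  then show ?thesis using A.zinv(1) by metis
qed

lemma F0_surj:
  assumes z': "z' \<in> X"
  obtains z where "z \<in> X" "F0 z = z'"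
proof -
  define q where "q = inv (sx (lev z')) z'"
  have q: "q \<in> X" "sx (lev z') q = z'" using sxD(1)[OF z'] Homeo_inv_iff[OF sxD(1)[OF z']] z' by (auto simp: q_def)
  then have lq: "lev q = (w z', jr (w z'))" using sxD(2)[OF z' q(1)] by simp
  define z where "z = zpow a (int (dnA z') - jr (w z')) q"
  have d: "int (dnA q) = jr (w z')" "w q = w z'" using lq by (auto simp: lev_def)
  have "dnA q + upA q = dnA z' + upA z'" using arg_cong[OF d(2), of length] by simp
  then have "- int (dnA q) \<le> int (dnA z') - jr (w z')" "int (dnA z') - jr (w z') \<le> int (upA q)" using d(1) by simp_all
  from lev_shift[OF q(1) this] have lz: "lev z = lev z'" using d by (simp add: z_def lev_def)
  have "rho z = q"
  proof -
    have "rho z = zpow a (jr (w z') - int (dnA z')) z" using lz by (simp add: rho_def lev_def)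
    also have "\<dots> = q" unfolding z_def by (simp flip: A.zadd)
    finally show ?thesis .
  qed
  then have "F0 z = z'" using lz q(2) by (simp add: F0_def)
  moreover have "z \<in> X" using q(1) by (simp add: z_def)
  ultimately show thesis using that by blast
qed

lemma F_bij: "bij_betw F X X"
proof (rule bij_betw_imageI)
  show "inj_on F X"
  proof (rule inj_onI)
    fix x y assume xy: "x \<in> X" "y \<in> X" "F x = F y"
    have "bs x = bs y" using F0_inj[of "bs x" "bs y"] F_facts(3)[OF xy(1)] F_facts(3)[OF xy(2)] xy by simp
    moreover have "dnB x = dnB y" using F_facts(2)[OF xy(1)] F_facts(2)[OF xy(2)] xy(3) by simp
    ultimately show "x = y" unfolding bs_def using B.zinv(2) by metis
  qed
  show "F ` X = X"
  proof
    show "F ` X \<subseteq> X" using F_facts(1) by blast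
    show "X \<subseteq> F ` X"
    proof
      fix y assume y: "y \<in> X"
      obtain z where z: "z \<in> X" "F0 z = bs y" using F0_surj[of "bs y"] y by auto
      have l: "lev z = lev (bs y)" using F0(2)[OF z(1)] z(2) by simp
      have d: "dnB z = 0" "upB z = dnB y + upB y" using lev_B[OF l] bs_facts[OF y] by auto
      define x where "x = zpow b (int (dnB y)) z"
      have x: "x \<in> X" using z by (simp add: x_def)
      have "int (dnB x) = int (dnB y)" using TB.shift(1)[OF z(1), of "int (dnB y)"] d by (simp add: x_def)
      then have dx: "dnB x = dnB y" by simp
      then have "bs x = z" unfolding bs_def by (simp add: x_def)
      then have "F x = y" using x dx z(2) by (simp add: F_def bs_def)
      then show "y \<in> F ` X" using x by blast
    qed
  qed
qed

lemma class_pres_eq: "class_pres X a = class_pres X b"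
  unfolding class_pres_def using coh_eq by simp

lemma sx_class_pres: "x \<in> X \<Longrightarrow> sx (lev x) \<in> class_pres X a"
  unfolding class_pres_eq using B.inner_class_pres[OF sxD(1,3)] by blast

lemma F_local:
  assumes x: "x \<in> X"
  shows "\<exists>H\<in>class_pres X a. \<exists>e>0. \<forall>y\<in>X. dist x y < e \<longrightarrow> F y = H y"
proof -
  have "locc X (\<lambda>x. lev (bs x))" unfolding bs_def
    by (rule B.locc_bind_z[OF locc_map[OF TB.locc_dn, where g="\<lambda>n. - int n"] locc_lev])
  from locc_map2[OF TB.locc_dn this, where g=Pair]
  obtain e where e: "e > 0" "\<forall>y\<in>X. dist x y < e \<longrightarrow> (dnB y, lev (bs y)) = (dnB x, lev (bs x))"
    using x unfolding locc_def by metis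
  define m k where "m = int (dnB x)" and "k = jr (w (bs x)) - int (dnA (bs x))"
  define H where "H y = zpow b m (sx (lev (bs x)) (zpow a k (zpow b (- m) y)))" for y
  have "H \<in> class_pres X a"
  proof -
    have g: "zpow b j \<in> class_pres X a" for j using class_pres_zpow[OF B.hom] class_pres_eq by simp
    have s: "sx (lev (bs x)) \<in> class_pres X a" using sx_class_pres[of "bs x"] x by simp
    show ?thesis unfolding H_def[abs_def]
      by (rule class_pres_comp[OF g class_pres_comp[OF s class_pres_comp[OF class_pres_zpow[OF A.hom] g]]])
  qed
  moreover have "F y = H y" if y: "y \<in> X" "dist x y < e" for y
  proof -
    have d: "dnB y = dnB x" "lev (bs y) = lev (bs x)" using e(2) y by auto
    have "rho (bs y) = zpow a k (bs y)" using d(2) by (simp add: rho_def k_def lev_def)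
    moreover have "bs y = zpow b (- m) y" using d(1) by (simp add: bs_def m_def)
    ultimately show ?thesis using y(1) d by (simp add: F_def F0_def H_def m_def)
  qed
  ultimately show ?thesis using e(1) by blast
qed

lemma F_Homeo: "F \<in> Homeo X"
proof (rule Homeo_piecewise[OF A.compact F_bij])
  show "\<exists>H\<in>Homeo X. \<exists>e>0. \<forall>y\<in>X. dist x y < e \<longrightarrow> F y = H y" if "x \<in> X" for x
    using F_local[OF that] unfolding class_pres_def by blast
qed (simp add: F_def)

lemma F_class_pres: "F \<in> class_pres X a"
  by (rule class_pres_piecewise[OF A.compact A.zd A.hom F_Homeo F_local])

lemma F_fix: "z \<in> X \<Longrightarrow> int (dnA (bs z)) = jr (w (bs z)) \<Longrightarrow> F z = z"
proof -
  assume z: "z \<in> X" and e: "int (dnA (bs z)) = jr (w (bs z))"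
  have "F0 (bs z) = bs z" unfolding F0_def rho_def using sxD(4)[of "bs z"] e z by simp
  then show ?thesis using z by (simp add: F_def bs_def)
qed

lemma w_ne: "w p \<noteq> w (a p)"
proof
  assume e: "w p = w (a p)"
  have "a p \<in> C" using C_iff p_N' by simp
  then have d: "dnA (a p) = 0" using TA.dn_zero_iff p by simp
  have "w (a p) ! 0 = u (a p)" using TA.wd_at[of u "a p"] d by simp
  moreover have "w p ! 0 = u yp" using TA.wd_nth[of 0 p u] by (simp add: yp_def)
  ultimately have "u yp = u (a p)" using e by simp
  then show False using sep(2) by (simp add: u_def)
qed

lemma F_p: "F p = p"
proof (rule F_fix[OF p])
  have "bref (w p) = bs p" using w_ne by (simp add: bref_def)
  then show "int (dnA (bs p)) = jr (w (bs p))" using bs_facts(5)[OF p] by (simp add: jr_def)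
qed

lemma F_ap: "F (a p) = a p"
proof (rule F_fix)
  show apX: "a p \<in> X" using p by simp
  have "dnB (a p) = 0" using TB.dn_zero_iff[OF apX] ap_B0 by simp
  then have "bs (a p) = a p" by (simp add: bs_def)
  then show "int (dnA (bs (a p))) = jr (w (bs (a p)))" by (simp add: jr_def bref_def)
qed

lemma upB_N: "x \<in> X \<Longrightarrow> upB x = 0 \<longleftrightarrow> x \<in> N"
  using TB.up_zero_iff B0_iff by simp

lemma upA_N': "x \<in> X \<Longrightarrow> upA x = 0 \<longleftrightarrow> x \<in> N'"
  using TA.up_zero_iff C_iff by simp

lemma F_N: "x \<in> X \<Longrightarrow> F x \<in> N \<longleftrightarrow> x \<in> N"
  using upB_N[of x] upB_N[of "F x"] lev_B(2)[OF F_facts(4)] F_facts(1) by metis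

lemma F_N': "x \<in> X \<Longrightarrow> F x \<in> N' \<longleftrightarrow> x \<in> N'"
  using upA_N'[of x] upA_N'[of "F x"] lev_up[OF F_facts(4)] F_facts(1) by metis

lemma b_step:
  assumes x: "x \<in> X" "x \<notin> N"
  shows "dnB (b x) = Suc (dnB x)" "bs (b x) = bs x"
proof -
  have "upB x \<noteq> 0" using upB_N[OF x(1)] x(2) by simp
  then have "int (dnB (zpow b 1 x)) = int (dnB x) + 1" by (intro TB.shift(1)[OF x(1)]) auto
  then show d: "dnB (b x) = Suc (dnB x)" by simp
  have "zpow b (- int (Suc (dnB x))) (zpow b 1 x) = zpow b (- int (dnB x)) x" unfolding B.zadd[symmetric] by simp
  then show "bs (b x) = bs x" by (simp add: bs_def d)
qed

lemma F_commute:
  assumes x: "x \<in> X" "x \<notin> N"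
  shows "F (b x) = b (F x)"
proof -
  have "zpow b (int (Suc (dnB x))) z = b (zpow b (int (dnB x)) z)" for z
    using zpow_Suc[OF B.bij, of "int (dnB x)" z] by (simp add: add.commute)
  then show ?thesis unfolding F_def using b_step[OF x] x(1) by simp
qed

definition a' where "a' x = F (a (inv F x))"

lemma rho_bs:
  assumes y: "y \<in> X"
  shows "rho (bs y) = rho y"
proof -
  have "int (dnA (bs y)) = int (dnA y) + \<kappa> y" "w (bs y) = w y" using bs_facts(4,5)[OF y] by (auto simp: lev_def)
  then show ?thesis unfolding rho_def kappa(1)[OF y] A.zadd[symmetric] by (simp add: kappa(1)[OF y])
qed

text \<open>Off \<open>N'\<close> the map \<open>a\<close> stays inside the tower and keeps the
  reference point. It is here that the \<open>a\<close>-part of \<open>F\<close> disappears from the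
  conjugate.\<close>

lemma rho_a:
  assumes y: "y \<in> X" "y \<notin> N'"
  shows "rho (a y) = rho y" 
proof -
  have "upA y \<noteq> 0" using upA_N'[OF y(1)] y(2) by simp
  then have s: "int (dnA (zpow a 1 y)) = int (dnA y) + 1" "w (zpow a 1 y) = w y"
    by (intro TA.shift[OF y(1)]; simp)+
  have "zpow a (jr (w y) - (int (dnA y) + 1)) (zpow a 1 y) = zpow a (jr (w y) - int (dnA y)) y"
    unfolding A.zadd[symmetric] by simp
  then show ?thesis unfolding rho_def using s by simp
qed

text \<open>Since \<open>F y = zpow b m (s (rho y))\<close> and \<open>rho\<close> does not change
  under \<open>a\<close> off \<open>N'\<close>, the part involving \<open>a\<close> cancels in
  \<open>F \<circ> a \<circ> inv F\<close>. What remains is: down by \<open>b\<close>, to the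
  reference level by \<open>inv s1\<close>, out again by \<open>s2\<close>, up by
  \<open>b\<close>.\<close>

lemma a'_inner:
  assumes x: "x \<in> X" "x \<notin> N'"
  shows "inner_at X b {p} a' x"
proof -
  define x1 where "x1 = inv F x"
  have x1: "x1 \<in> X" "F x1 = x" using F_Homeo Homeo_inv_iff[OF F_Homeo] x by (auto simp: x1_def)
  then have x1N: "x1 \<notin> N'" using F_N' x(2) by blast
  define dat where "dat y = (dnB y, lev (bs y))" for y
  have "locc X (\<lambda>x. lev (bs x))" unfolding bs_def
    by (rule B.locc_bind_z[OF locc_map[OF TB.locc_dn, where g="\<lambda>n. - int n"] locc_lev])
  from locc_map2[OF TB.locc_dn this, where g=Pair] have ld: "locc X dat" by (simp add: dat_def[abs_def])
  have "locc X (\<lambda>y. (dat (inv F y), dat (a (inv F y)), inv F y \<in> N'))"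
    by (rule locc_Homeo[OF locc_map2[OF ld locc_map2[OF locc_Homeo[OF ld A.hom] locc_N', where g=Pair], where g=Pair] Homeo_inv[OF F_Homeo]])
  then obtain e where e: "e > 0" "\<forall>y\<in>X. dist x y < e \<longrightarrow>
      (dat (inv F y), dat (a (inv F y)), inv F y \<in> N') = (dat (inv F x), dat (a (inv F x)), inv F x \<in> N')"
    using x(1) unfolding locc_def by metis
  define m1 m2 where "m1 = int (dnB x1)" and "m2 = int (dnB (a x1))"
  define s1 s2 where "s1 = sx (lev (bs x1))" and "s2 = sx (lev (bs (a x1)))"
  have H1: "s1 \<in> Homeo X" using sxD(1)[of "bs x1"] x1 by (simp add: s1_def)
  define G where "G y = zpow b m2 (s2 (inv s1 (zpow b (- m1) y)))" for y
  have G: "G y = a' y" if y: "y \<in> X" "dist x y < e" for y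
  proof -
    define y1 where "y1 = inv F y"
    have y1: "y1 \<in> X" "F y1 = y" using F_Homeo Homeo_inv_iff[OF F_Homeo] y by (auto simp: y1_def)
    have d: "dnB y1 = dnB x1" "lev (bs y1) = lev (bs x1)" "dnB (a y1) = dnB (a x1)" "lev (bs (a y1)) = lev (bs (a x1))" "y1 \<notin> N'"
      using e(2) y x1N by (auto simp: dat_def y1_def x1_def)
    have "y = zpow b m1 (s1 (rho y1))" using y1 d rho_bs[OF y1(1)] by (auto simp: F_def F0_def m1_def s1_def)
    then have "inv s1 (zpow b (- m1) y) = rho y1" using H1 by simp
    then have "G y = zpow b m2 (s2 (rho y1))" by (simp add: G_def)
    also have "\<dots> = zpow b m2 (s2 (rho (bs (a y1))))" using rho_bs[of "a y1"] rho_a[OF y1(1) d(5)] y1(1) by simp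
    also have "\<dots> = F (a y1)" using d y1(1) by (auto simp: F_def F0_def m2_def s2_def)
    finally show ?thesis by (simp add: a'_def y1_def)
  qed
  have xz: "zpow b (- m1) x = F0 (bs x1)" using x1 by (auto simp: F_def m1_def)
  \<comment> \<open>Each of the four factors avoids \<open>p\<close>: the powers of \<open>b\<close>
    because they stay in a \<open>b\<close>-tower with top in \<open>N\<close>, the other two by the
    choice of \<open>sx\<close>.\<close>
  have i1: "inner_at X b {p} (zpow b (- m1)) x"
  proof (rule inner_at_zpow)
    have "dnB x = dnB x1" using F_facts(2)[OF x1(1)] x1(2) by simp
    then have "avoid b {y. b y \<in> B0} (- m1) x" using TB.avoid_iff[OF x(1)] by (simp add: m1_def)
    then show "avoid b {p} (- m1) x" by (rule avoid_mono) (use B0_iff[OF p] N(2) in auto)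
  qed
  have q: "inv s1 (F0 (bs x1)) = rho x1" using H1 rho_bs[OF x1(1)] by (simp add: F0_def s1_def)
  have "inner_at X b {p} (inv s1) (s1 (rho x1))"
    by (rule inner_at_inverse[OF B.hom _ sxD(3)[of "bs x1", folded s1_def]]) (use x1(1) H1 in auto)
  then have i2: "inner_at X b {p} (inv s1) (zpow b (- m1) x)" using xz rho_bs[OF x1(1)] by (simp add: F0_def s1_def)
  have i3: "inner_at X b {p} s2 (inv s1 (zpow b (- m1) x))" unfolding s2_def xz q by (rule sxD(3)) (use x1(1) in auto)
  define z2 where "z2 = s2 (inv s1 (zpow b (- m1) x))"
  have z2: "z2 = F0 (bs (a x1))" unfolding z2_def xz q using rho_bs[of "a x1"] rho_a[OF x1(1) x1N] x1(1) by (simp add: F0_def s2_def)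
  have i4: "inner_at X b {p} (zpow b m2) z2"
  proof (rule inner_at_zpow)
    have ax: "a x1 \<in> X" using x1 by simp
    have z2X: "z2 \<in> X" using F0(1) ax by (simp add: z2)
    have "lev z2 = lev (bs (a x1))" using F0(2) ax by (simp add: z2)
    then have "upB z2 = dnB (a x1) + upB (a x1)" using lev_B(2) bs_facts(2)[OF ax] by metis
    then have "avoid b {y. b y \<in> B0} m2 z2" using TB.avoid_iff[OF z2X] by (simp add: m2_def)
    then show "avoid b {p} m2 z2" by (rule avoid_mono) (use B0_iff[OF p] N(2) in auto)
  qed
  have "inner_at X b {p} G x"
    unfolding G_def
    using inner_at_comp[OF B.hom x(1) inner_at_comp[OF B.hom x(1) inner_at_comp[OF B.hom x(1) i1 i2] i3] i4[unfolded z2_def]] .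
  then show ?thesis by (rule inner_at_local[OF _ e(1)]) (use G in auto)
qed

lemma zpow_a': "zpow a' k (F x) = F (zpow a k x)"
  using zpow_conj[OF A.hom F_Homeo, of k "F x"] F_Homeo by (simp add: a'_def[abs_def])

text \<open>Off \<open>N\<close> the points \<open>x\<close> and \<open>b x\<close> have the same
  bottom, so \<open>b x\<close> is reached from \<open>x\<close> by a path of \<open>a\<close>
  through that bottom, and both halves avoid \<open>N'\<close>. Conjugation by \<open>F\<close>,
  which commutes with \<open>b\<close> there and preserves \<open>N\<close> and \<open>N'\<close>,
  turns it into a path of \<open>a'\<close>.\<close>

lemma b_inner_a':
  assumes x: "x \<in> X" "x \<notin> N"
  shows "inner_at X a' N' b x"
proof -
  define x1 where "x1 = inv F x"
  have x1: "x1 \<in> X" "F x1 = x" using F_Homeo Homeo_inv_iff[OF F_Homeo] x by (auto simp: x1_def)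
  then have x1N: "x1 \<notin> N" using F_N x(2) by blast
  define kk where "kk y = \<kappa> y - \<kappa> (b y)" for y
  have bk: "b y = zpow a (kk y) y" if y: "y \<in> X" "y \<notin> N" for y
  proof -
    have "zpow a (\<kappa> (b y)) (b y) = zpow a (\<kappa> y) y" using kappa(1)[of "b y"] kappa(1)[OF y(1)] b_step(2)[OF y] y(1) by simp
    then have "b y = zpow a (- \<kappa> (b y)) (zpow a (\<kappa> y) y)" using A.zinv(1) by metis
    also have "\<dots> = zpow a (kk y) y" unfolding A.zadd[symmetric] kk_def by simp
    finally show ?thesis .
  qed
  have av: "avoid a N' (kk x1) x1"
  proof -
    have bx: "b x1 \<in> X" using x1 by simp
    have "avoid a N' (- \<kappa> (b x1)) (zpow a (\<kappa> (b x1)) (b x1))" by (rule avoid_uminus[OF A.bij avoid_N'[OF bx]])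
    also have "zpow a (\<kappa> (b x1)) (b x1) = zpow a (\<kappa> x1) x1"
      using kappa(1)[OF bx] kappa(1)[OF x1(1)] b_step(2)[OF x1(1) x1N] by simp
    finally have "avoid a N' (- \<kappa> (b x1) + \<kappa> x1) x1" by (rule avoid_add[OF A.bij avoid_N'[OF x1(1)]])
    then show ?thesis by (simp add: kk_def)
  qed
  have "locc X kk" unfolding kk_def by (rule locc_map2[OF locc_kappa locc_Homeo[OF locc_kappa B.hom], where g="(-)"])
  from locc_Homeo[OF locc_map2[OF this N(1), where g=Pair] Homeo_inv[OF F_Homeo]]
  obtain e where e: "e > 0" "\<forall>y\<in>X. dist x y < e \<longrightarrow> (kk (inv F y), inv F y \<in> N) = (kk (inv F x), inv F x \<in> N)"
    using x(1) unfolding locc_def by metis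
  have "b y = zpow a' (kk x1) y" if y: "y \<in> X" "dist x y < e" for y
  proof -
    define y1 where "y1 = inv F y"
    have y1: "y1 \<in> X" "F y1 = y" using F_Homeo Homeo_inv_iff[OF F_Homeo] y by (auto simp: y1_def)
    have d: "kk y1 = kk x1" "y1 \<notin> N" using e(2) y x1N by (auto simp: y1_def x1_def)
    have "b y = F (b y1)" using F_commute[OF y1(1) d(2)] y1(2) by simp
    also have "\<dots> = F (zpow a (kk x1) y1)" using bk[OF y1(1) d(2)] d(1) by simp
    also have "\<dots> = zpow a' (kk x1) y" using zpow_a' y1(2) by metis
    finally show ?thesis .
  qed
  moreover have "avoid a' N' (kk x1) x"
    unfolding avoid_def
  proof (intro allI impI)
    fix i assume "min 0 (kk x1) \<le> i \<and> i < max 0 (kk x1)"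
    then have "zpow a i x1 \<notin> N'" using av by (simp add: avoid_def)
    then show "zpow a' i x \<notin> N'" using zpow_a'[of i x1] x1 F_N'[of "zpow a i x1"] by simp
  qed
  ultimately show ?thesis unfolding inner_at_def using e(1) by metis
qed

lemma step:
  "\<exists>F N'. F \<in> class_pres X a \<and> F p = p \<and> F (a p) = a p \<and> (\<forall>x\<in>X. v (F x) = v x) \<and>
     locc X (\<lambda>x. x \<in> N') \<and> p \<in> N' \<and> N' \<subseteq> N \<and> N' \<subseteq> M \<and>
     (\<forall>x\<in>X. x \<notin> N \<longrightarrow> F (b x) = b (F x)) \<and>
     (\<forall>x\<in>X. x \<notin> N' \<longrightarrow> inner_at X b {p} (\<lambda>x. F (a (inv F x))) x) \<and>
     (\<forall>x\<in>X. x \<notin> N \<longrightarrow> inner_at X (\<lambda>x. F (a (inv F x))) N' b x)"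
  using F_class_pres F_p F_ap lev_B(4)[OF F_facts(4)] locc_N' p_N' N'_sub F_commute a'_inner b_inner_a'
  unfolding a'_def[abs_def] by (intro exI[of _ F] exI[of _ N']) auto

end

section \<open>Iterating the interlacing step\<close>

lemma cms_conj:
  assumes "cms X a" and F: "F \<in> Homeo X"
  shows "cms X (\<lambda>x. F (a (inv F x)))"
proof -
  interpret cms X a by fact
  show ?thesis
  proof
    show "(\<lambda>x. F (a (inv F x))) \<in> Homeo X" using Homeo_comp[OF F Homeo_comp[OF hom Homeo_inv[OF F]]] .
    fix Z assume Z: "Z \<subseteq> X" "closed Z" "(\<lambda>x. F (a (inv F x))) ` Z = Z"
    define W where "W = inv F ` Z"
    have ZW: "F ` W = Z" using F by (simp add: W_def image_image)
    have W: "W \<subseteq> X" using Z(1) Homeo_inv_iff[OF F] by (auto simp: W_def)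
    have "compact Z" using Z(1,2) compact by (metis compact_Int_closed inf.absorb_iff2)
    then have "compact W" unfolding W_def
      using HomeoD(6)[OF F] Z(1) by (metis compact_continuous_image continuous_on_subset)
    moreover have "a ` W = W"
    proof -
      have "F ` a ` W = F ` W" using Z(3) ZW by (simp add: W_def image_image)
      then show ?thesis using HomeoD(1)[OF F] by (metis bij_is_inj inj_image_eq_iff)
    qed
    ultimately have "W = {} \<or> W = X" using min W compact_imp_closed by blast
    then show "Z = {} \<or> Z = X" using ZW HomeoD(2)[OF F] by auto
  qed (fact compact zd inf)+
qed

lemma coh_locc: "a \<in> Homeo X \<Longrightarrow> coh X a f \<Longrightarrow> locc X f"
proof -
  assume a: "a \<in> Homeo X" and "coh X a f"
  then obtain h where h: "locc X h" "\<forall>x\<in>X. f x = h (a x) - h x" by (auto simp: coh_def)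
  have "locc X (\<lambda>x. h (a x) - h x)" by (rule locc_map2[OF locc_Homeo[OF h(1) a] h(1), where g="(-)"])
  then show ?thesis using h(2) locc_cong[of X f "\<lambda>x. h (a x) - h x"] by simp
qed

lemma coh_conj_iff:
  assumes F: "F \<in> Homeo X"
  shows "coh X (\<lambda>x. F (a (inv F x))) f \<longleftrightarrow> coh X a (\<lambda>x. f (F x))"
proof
  assume "coh X (\<lambda>x. F (a (inv F x))) f"
  then obtain h where h: "locc X h" "\<forall>x\<in>X. f x = h (F (a (inv F x))) - h x" by (auto simp: coh_def)
  show "coh X a (\<lambda>x. f (F x))"
    by (rule cohI[OF locc_Homeo[OF h(1) F]]) (use h(2) F HomeoD(4)[OF F] in simp)
next
  assume "coh X a (\<lambda>x. f (F x))"
  then obtain h where h: "locc X h" "\<forall>x\<in>X. f (F x) = h (a x) - h x" by (auto simp: coh_def)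
  show "coh X (\<lambda>x. F (a (inv F x))) f"
  proof (rule cohI[OF locc_Homeo[OF h(1) Homeo_inv[OF F]]])
    fix x assume "x \<in> X"
    then show "f x = h (inv F (F (a (inv F x)))) - h (inv F x)"
      using h(2)[rule_format, of "inv F x"] F Homeo_inv_iff[OF F] by simp
  qed
qed

lemma coh_conj_class_pres:
  assumes a: "a \<in> Homeo X" and F: "F \<in> class_pres X a"
  shows "coh X (\<lambda>x. F (a (inv F x))) f \<longleftrightarrow> coh X a f"
proof -
  have H: "F \<in> Homeo X" using F by (simp add: class_pres_def)
  show ?thesis unfolding coh_conj_iff[OF H]
  proof
    assume c: "coh X a (\<lambda>x. f (F x))"
    have "locc X (\<lambda>x. f (F (inv F x)))" by (rule locc_Homeo[OF coh_locc[OF a c] Homeo_inv[OF H]])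
    then have "locc X f" using H by simp
    then show "coh X a f" using c coh_comp_class_pres[OF F] by blast
  next
    assume "coh X a f"
    then show "coh X a (\<lambda>x. f (F x))" using coh_comp_class_pres[OF F coh_locc[OF a]] by blast
  qed
qed

text \<open>Only the values of \<open>a\<close> at sources of traversed edges enter, so intertwining
  is needed off \<open>N\<close> alone. With the identity for \<open>F\<close> it says that the
  power does not notice a change of the map inside \<open>N\<close>.\<close>

lemma avoid_transfer:
  assumes a: "a \<in> Homeo X" and c: "bij c" and x: "x \<in> X"
    and F: "\<And>z. z \<in> X \<Longrightarrow> z \<notin> N \<Longrightarrow> F (a z) = c (F z)" and av: "avoid a N k x"
  shows "F (zpow a k x) = zpow c k (F x)"
proof -
  have b: "bij a" using HomeoD(1)[OF a] .
  have st: "F (zpow a (i + 1) x) = c (F (zpow a i x))" if "min 0 k \<le> i" "i < max 0 k" for i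
  proof -
    have "zpow a i x \<notin> N" using av that by (simp add: avoid_def)
    then show ?thesis using F[of "zpow a i x"] x a zpow_Suc[OF b] by simp
  qed
  show ?thesis
  proof (cases "0 \<le> k")
    case True
    have "j \<le> nat k \<Longrightarrow> F (zpow a (int j) x) = zpow c (int j) (F x)" for j
    proof (induction j)
      case (Suc j)
      have "F (zpow a (int j + 1) x) = c (F (zpow a (int j) x))" by (rule st) (use Suc.prems True in auto)
      then show ?case using Suc zpow_Suc[OF c, of "int j" "F x"] by (simp add: add.commute)
    qed simp
    from this[of "nat k"] show ?thesis using True by simp
  next
    case False
    have "j \<le> nat (- k) \<Longrightarrow> F (zpow a (- int j) x) = zpow c (- int j) (F x)" for j
    proof (induction j)
      case (Suc j)
      have "F (zpow a (- int (Suc j) + 1) x) = c (F (zpow a (- int (Suc j)) x))" by (rule st) (use Suc.prems False in auto)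
      moreover have "c (zpow c (- int (Suc j)) (F x)) = zpow c (- int (Suc j) + 1) (F x)" using zpow_Suc[OF c] by (simp only:)
      moreover have "F (zpow a (- int j) x) = zpow c (- int j) (F x)" using Suc by simp
      ultimately have "c (F (zpow a (- int (Suc j)) x)) = c (zpow c (- int (Suc j)) (F x))" by simp
      then show ?case by (rule injD[OF bij_is_inj[OF c]])
    qed simp
    from this[of "nat (- k)"] show ?thesis using False by simp
  qed
qed

text \<open>Aperiodicity makes the local exponents unique, so they glue to one locally constant
  function; its value 0 on the clopen set \<open>N\<close> is a mere default.\<close>

lemma (in cms) inner_cocycle:
  assumes N: "locc X (\<lambda>x. x \<in> N)" and f: "\<And>x. x \<in> X \<Longrightarrow> x \<notin> N \<Longrightarrow> inner_at X a M f x"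
  shows "\<exists>k. locc X k \<and> (\<forall>x\<in>X. x \<notin> N \<longrightarrow> f x = zpow a (k x) x \<and> avoid a M (k x) x)"
proof -
  define k where "k x = (if x \<in> N then 0 else THE k. f x = zpow a k x)" for x
  have kI: "k x = l" if "x \<in> X" "x \<notin> N" "f x = zpow a l x" for x l
    unfolding k_def using that zpow_inj by (metis (mono_tags, lifting) the_equality)
  have loc: "\<exists>l. (\<exists>e>0. \<forall>y\<in>X. dist x y < e \<longrightarrow> k y = l \<and> y \<notin> N) \<and> f x = zpow a l x \<and> avoid a M l x"
    if x: "x \<in> X" "x \<notin> N" for x
  proof -
    obtain l e where l: "e > 0" "\<forall>y\<in>X. dist x y < e \<longrightarrow> f y = zpow a l y" "avoid a M l x"
      using f[OF x] unfolding inner_at_def by metis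
    obtain d where d: "d > 0" "\<forall>y\<in>X. dist x y < d \<longrightarrow> (y \<in> N) = (x \<in> N)" using N x(1) unfolding locc_def by metis
    have "k y = l \<and> y \<notin> N" if "y \<in> X" "dist x y < min d e" for y
      using kI[of y l] l(2) d(2) x(2) that by simp
    moreover have "min d e > 0" using d(1) l(1) by simp
    moreover have "f x = zpow a l x" using l x by simp
    ultimately show ?thesis using l(3) by metis
  qed
  have "locc X k"
  proof (rule loccI)
    fix x assume x: "x \<in> X"
    show "\<exists>e>0. \<forall>y\<in>X. dist x y < e \<longrightarrow> k y = k x"
    proof (cases "x \<in> N")
      case True
      obtain d where "d > 0" "\<forall>y\<in>X. dist x y < d \<longrightarrow> (y \<in> N) = (x \<in> N)" using N x(1) unfolding locc_def by metis
      then show ?thesis using True by (intro exI[of _ d]) (simp add: k_def)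
    next
      case False
      obtain l e where "e > 0" "\<forall>y\<in>X. dist x y < e \<longrightarrow> k y = l \<and> y \<notin> N" using loc[OF x False] by metis
      then have "\<forall>y\<in>X. dist x y < e \<longrightarrow> k y = k x" using x by simp
      then show ?thesis using \<open>e > 0\<close> by metis
    qed
  qed
  moreover have "f x = zpow a (k x) x \<and> avoid a M (k x) x" if x: "x \<in> X" "x \<notin> N" for x
    using loc[OF x] kI[OF x] by metis
  ultimately show ?thesis by metis
qed

text \<open>A map preserving a fine colouring moves points only a little. The mesh also reckons with
  the modulus of continuity of \<open>inv g\<close>, because the inverses of the accumulated
  conjugations have to converge too.\<close>

lemma fine_colouring:
  assumes X: "compact X" "zero_dim X" and g: "g \<in> Homeo X" and e: "(e::real) > 0"
  shows "\<exists>v :: 'a::metric_space \<Rightarrow> nat. locc X v \<and> (\<forall>F\<in>Homeo X. (\<forall>x\<in>X. v (F x) = v x) \<longrightarrow>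
     (\<forall>x\<in>X. dist (F (g x)) (g x) < e \<and> dist (inv (\<lambda>x. F (g x)) x) (inv g x) < e))"
proof -
  have "uniformly_continuous_on X (inv g)"
    using compact_uniformly_continuous[OF HomeoD(6)[OF g] X(1)] .
  then obtain d where d: "d > 0" "\<forall>x\<in>X. \<forall>x'\<in>X. dist x' x < d \<longrightarrow> dist (inv g x') (inv g x) < e"
    using e unfolding uniformly_continuous_on_def by metis
  obtain v :: "'a \<Rightarrow> nat" where v: "locc X v" "\<forall>x\<in>X. \<forall>y\<in>X. v x = v y \<longrightarrow> dist x y < min d e"
    using X(2) d(1) e unfolding zero_dim_def by (metis min_less_iff_conj)
  have "dist (F (g x)) (g x) < e \<and> dist (inv (\<lambda>x. F (g x)) x) (inv g x) < e"
    if F: "F \<in> Homeo X" "\<forall>x\<in>X. v (F x) = v x" and x: "x \<in> X" for F x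
  proof
    have "g x \<in> X" "F (g x) \<in> X" using x HomeoD(4)[OF g] HomeoD(4)[OF F(1)] by auto
    then show "dist (F (g x)) (g x) < e" using v(2) F(2) by simp
    define y where "y = inv F x"
    have y: "y \<in> X" "F y = x" using F(1) x Homeo_inv_iff[OF F(1)] by (auto simp: y_def)
    have "dist y x < d" using v(2) F(2) y x by (metis min_less_iff_conj)
    then have "dist (inv g y) (inv g x) < e" using d(2) y x by simp
    moreover have "inv (\<lambda>x. F (g x)) x = inv g y"
    proof (rule inv_f_eq)
      show "inj (\<lambda>x. F (g x))" using HomeoD(1)[OF Homeo_comp[OF F(1) g]] bij_is_inj by blast
      show "F (g (inv g y)) = x" using g y by simp
    qed
    ultimately show "dist (inv (\<lambda>x. F (g x)) x) (inv g x) < e" by simp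
  qed
  then show ?thesis using v(1) by metis
qed

lemma half_power_limit:
  fixes f :: "nat \<Rightarrow> 'a::metric_space \<Rightarrow> 'a"
  assumes X: "compact X" and f: "\<And>n x. x \<in> X \<Longrightarrow> f n x \<in> X"
    and d: "\<And>n x. x \<in> X \<Longrightarrow> dist (f (Suc n) x) (f n x) < (1/2) ^ n"
  shows "\<exists>F. (\<forall>x\<in>X. F x \<in> X) \<and> uniform_limit X f F sequentially"
proof -
  \<comment> \<open>The right-hand side is the exact geometric sum, kept with its remainder so that
    the induction closes.\<close>
  have bd: "dist (f (n + k) x) (f n x) \<le> 2 * (1/2) ^ n - 2 * (1/2) ^ (n + k)" if x: "x \<in> X" for n k x
  proof (induction k)
    case (Suc k)
    have "dist (f (n + Suc k) x) (f n x) \<le> dist (f (n + Suc k) x) (f (n + k) x) + dist (f (n + k) x) (f n x)"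
      by (rule dist_triangle)
    also have "\<dots> \<le> (1/2) ^ (n + k) + (2 * (1/2) ^ n - 2 * (1/2) ^ (n + k))"
      using Suc d[OF x, of "n + k"] by simp
    finally show ?case by simp
  qed simp
  have bd': "dist (f m x) (f n x) \<le> 2 * (1/2) ^ n" if x: "x \<in> X" and mn: "n \<le> m" for m n x
  proof -
    have "0 \<le> 2 * (1/2::real) ^ m" by simp
    moreover have "dist (f m x) (f n x) \<le> 2 * (1/2) ^ n - 2 * (1/2) ^ m" using bd[OF x, of n "m - n"] mn by simp
    ultimately show ?thesis by linarith
  qed
  have z: "(\<lambda>n. 2 * (1/2::real) ^ n) \<longlonglongrightarrow> 0"
    by (rule tendsto_mult_right_zero) (rule LIMSEQ_power_zero, simp)
  have "\<exists>l\<in>X. (\<lambda>n. f n x) \<longlonglongrightarrow> l" if x: "x \<in> X" for x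
  proof -
    have "Cauchy (\<lambda>n. f n x)"
    proof (rule metric_CauchyI)
      fix e :: real assume "e > 0"
      then obtain n where n: "2 * (1/2::real) ^ n < e / 2"
        using order_tendstoD(2)[OF z, of "e/2"] by (auto simp: eventually_sequentially)
      have "dist (f k x) (f m x) < e" if "n \<le> k" "n \<le> m" for k m
        using dist_triangle2[of "f k x" "f m x" "f n x"] bd'[OF x that(1)] bd'[OF x that(2)] n by simp
      then show "\<exists>M. \<forall>k\<ge>M. \<forall>m\<ge>M. dist (f k x) (f m x) < e" by blast
    qed
    then show ?thesis using compact_imp_complete[OF X] f[OF x] unfolding complete_def by metis
  qed
  then obtain F where F: "\<And>x. x \<in> X \<Longrightarrow> F x \<in> X \<and> (\<lambda>n. f n x) \<longlonglongrightarrow> F x" by metis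
  have bF: "dist (f n x) (F x) \<le> 2 * (1/2) ^ n" if x: "x \<in> X" for n x
  proof -
    have "(\<lambda>m. dist (f m x) (f n x)) \<longlonglongrightarrow> dist (F x) (f n x)"
      by (rule tendsto_dist) (use F[OF x] in auto)
    then have "dist (F x) (f n x) \<le> 2 * (1/2) ^ n"
      by (rule Lim_bounded[where M=n]) (use bd'[OF x] in auto)
    then show ?thesis by (simp add: dist_commute)
  qed
  have "uniform_limit X f F sequentially"
  proof (rule uniform_limitI)
    fix e :: real assume "e > 0"
    then have "eventually (\<lambda>n. 2 * (1/2::real) ^ n < e) sequentially" using order_tendstoD(2)[OF z] by blast
    then show "\<forall>\<^sub>F n in sequentially. \<forall>x\<in>X. dist (f n x) (F x) < e"
      by (rule eventually_mono) (auto intro: order.strict_trans1[OF bF])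
  qed
  then show ?thesis using F by metis
qed

lemma uniform_limit_comp:
  fixes f :: "nat \<Rightarrow> 'a::metric_space \<Rightarrow> 'a"
  assumes X: "compact X" and f: "uniform_limit X f F sequentially" and c: "continuous_on X F" and x: "x \<in> X"
    and u: "\<And>n. u n \<in> X" "u \<longlonglongrightarrow> x"
  shows "(\<lambda>n. f n (u n)) \<longlonglongrightarrow> F x"
proof (rule metric_LIMSEQ_I)
  fix e :: real assume e: "e > 0"
  have "(\<lambda>n. F (u n)) \<longlonglongrightarrow> F x"
    by (rule continuous_on_tendsto_compose[OF c u(2) x]) (simp add: u(1))
  then obtain M where M: "\<And>n. n \<ge> M \<Longrightarrow> dist (F (u n)) (F x) < e / 2" using e by (metis half_gt_zero metric_LIMSEQ_D)
  obtain L where L: "\<And>n. n \<ge> L \<Longrightarrow> \<forall>y\<in>X. dist (f n y) (F y) < e / 2"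
    using uniform_limitD[OF f, of "e/2"] e by (auto simp: eventually_sequentially)
  have "dist (f n (u n)) (F x) < e" if "n \<ge> max L M" for n
    using dist_triangle[of "f n (u n)" "F x" "F (u n)"] L[of n] M[of n] u(1)[of n] that by force
  then show "\<exists>n0. \<forall>n\<ge>n0. dist (f n (u n)) (F x) < e" by blast
qed

text \<open>Uniform convergence of the maps alone gives a continuous limit; convergence of the
  inverses makes the two limits mutually inverse.\<close>

lemma Homeo_limit:
  fixes g :: "nat \<Rightarrow> 'a::metric_space \<Rightarrow> 'a"
  assumes X: "compact X" and g: "\<And>n. g n \<in> Homeo X"
    and d: "\<And>n x. x \<in> X \<Longrightarrow> dist (g (Suc n) x) (g n x) < (1/2) ^ n"
    and d': "\<And>n x. x \<in> X \<Longrightarrow> dist (inv (g (Suc n)) x) (inv (g n) x) < (1/2) ^ n"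
  shows "\<exists>G\<in>Homeo X. uniform_limit X g G sequentially \<and> uniform_limit X (\<lambda>n. inv (g n)) (inv G) sequentially"
proof -
  obtain G0 where G0: "\<forall>x\<in>X. G0 x \<in> X" "uniform_limit X g G0 sequentially"
    using half_power_limit[OF X, of g] HomeoD(4)[OF g] d by auto
  obtain H0 where H0: "\<forall>x\<in>X. H0 x \<in> X" "uniform_limit X (\<lambda>n. inv (g n)) H0 sequentially"
    using half_power_limit[OF X, of "\<lambda>n. inv (g n)"] Homeo_inv_iff[OF g] d' by auto
  have cG: "continuous_on X G0"
    by (rule uniform_limit_theorem[OF _ G0(2)]) (use HomeoD(3)[OF g] in auto)
  have cH: "continuous_on X H0"
    by (rule uniform_limit_theorem[OF _ H0(2)]) (use HomeoD(6)[OF g] in auto)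
  have GH: "G0 (H0 x) = x" if x: "x \<in> X" for x
  proof -
    have "(\<lambda>n. g n (inv (g n) x)) \<longlonglongrightarrow> G0 (H0 x)"
      by (rule uniform_limit_comp[OF X G0(2) cG]) (use H0 x Homeo_inv_iff[OF g] tendsto_uniform_limitI[OF H0(2)] in auto)
    then have "(\<lambda>n. x) \<longlonglongrightarrow> G0 (H0 x)" unfolding inv_Homeo(2)[OF g] .
    then show ?thesis by (rule LIMSEQ_unique[OF _ tendsto_const])
  qed
  have HG: "H0 (G0 x) = x" if x: "x \<in> X" for x
  proof -
    have "(\<lambda>n. inv (g n) (g n x)) \<longlonglongrightarrow> H0 (G0 x)"
      by (rule uniform_limit_comp[OF X H0(2) cH]) (use G0 x HomeoD(4)[OF g] tendsto_uniform_limitI[OF G0(2)] in auto)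
    then have "(\<lambda>n. x) \<longlonglongrightarrow> H0 (G0 x)" unfolding inv_Homeo(1)[OF g] .
    then show ?thesis by (rule LIMSEQ_unique[OF _ tendsto_const])
  qed
  define G where "G = restr X G0"
  have "homeomorphism X X G0 H0"
    unfolding homeomorphism_def using cG cH GH HG G0(1) H0(1) by (auto simp: image_iff) metis+
  then have G: "G \<in> Homeo X" unfolding G_def by (rule restr_Homeo)
  have Gx: "G x = G0 x" if "x \<in> X" for x using that by (simp add: G_def restr_def)
  have Hx: "inv G x = H0 x" if "x \<in> X" for x
    by (rule inv_f_eq) (use HomeoD(1)[OF G] bij_is_inj GH[OF that] Gx[of "H0 x"] H0(1) that in auto)
  have "uniform_limit X g G sequentially" "uniform_limit X (\<lambda>n. inv (g n)) (inv G) sequentially"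
    using G0(2) H0(2) Gx Hx by (auto cong: uniform_limit_cong')
  then show ?thesis using G by blast
qed

text \<open>Orbits go into orbits everywhere, but the exponent is locally constant only away from
  \<open>P\<close>; at \<open>P\<close> its mere existence is asked.\<close>

definition cocycle_off :: "'a::metric_space set \<Rightarrow> ('a \<Rightarrow> 'a) \<Rightarrow> ('b \<Rightarrow> 'b) \<Rightarrow> ('a \<Rightarrow> 'b) \<Rightarrow> 'a \<Rightarrow> bool" where
  "cocycle_off X a b F P \<longleftrightarrow> (\<forall>x\<in>X. \<exists>k. F (a x) = zpow b k (F x)) \<and>
     (\<forall>x\<in>X. x \<noteq> P \<longrightarrow> (\<exists>k. \<exists>e>0. \<forall>y\<in>X. dist x y < e \<longrightarrow> F (a y) = zpow b k (F y)))"

lemma cocycle_off_conj: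
  assumes a: "a \<in> Homeo X" and b: "b \<in> Homeo X" and A: "A \<in> Homeo X" and B: "B \<in> Homeo X"
    and c: "cocycle_off X (\<lambda>x. A (a (inv A x))) (\<lambda>x. B (b (inv B x))) (\<lambda>x. x) p"
  shows "cocycle_off X a b (\<lambda>x. inv B (A x)) (inv A p)"
proof -
  have eq: "inv B (A (a x)) = zpow b k (inv B (A x)) \<longleftrightarrow> A (a (inv A (A x))) = zpow (\<lambda>x. B (b (inv B x))) k (A x)" for x k
    unfolding zpow_conj[OF b B] inv_Homeo(1)[OF A] using inv_Homeo[OF B] by metis
  show ?thesis unfolding cocycle_off_def
  proof (intro conjI ballI impI)
    fix x assume x: "x \<in> X"
    then have Ax: "A x \<in> X" using HomeoD(4)[OF A] by simp
    then show "\<exists>k. inv B (A (a x)) = zpow b k (inv B (A x))" using c eq unfolding cocycle_off_def by blast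
    assume "x \<noteq> inv A p"
    then have "A x \<noteq> p" using A by auto
    then obtain k e where k: "e > 0" "\<forall>y\<in>X. dist (A x) y < e \<longrightarrow> A (a (inv A y)) = zpow (\<lambda>x. B (b (inv B x))) k y"
      using c Ax unfolding cocycle_off_def by metis
    obtain d where d: "d > 0" "\<And>y. y \<in> X \<Longrightarrow> dist x y < d \<Longrightarrow> dist (A x) (A y) < e"
      using continuous_near[OF HomeoD(3)[OF A] x k(1)] by metis
    have "inv B (A (a y)) = zpow b k (inv B (A y))" if "y \<in> X" "dist x y < d" for y
      unfolding eq using k(2) d(2)[OF that] that(1) HomeoD(4)[OF A] by simp
    then show "\<exists>k. \<exists>e>0. \<forall>y\<in>X. dist x y < e \<longrightarrow> inv B (A (a y)) = zpow b k (inv B (A y))"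
      using d(1) by metis
  qed
qed

section \<open>The alternating conjugations and their limit\<close>

locale interlace_start = A: cms X \<alpha> + B: cms X \<beta>
  for X :: "'a::metric_space set" and \<alpha> \<beta> +
  fixes p :: 'a
  assumes coh_eq: "\<And>f. coh X \<alpha> f \<longleftrightarrow> coh X \<beta> f" and p: "p \<in> X" and \<alpha>p: "\<alpha> p = \<beta> p"
begin

text \<open>\<open>a\<close> and \<open>b\<close> are the current conjugates of \<alpha> and
  \<beta>. The last two clauses are deliberately asymmetric: off \<open>O'\<close> the powers of
  \<open>b\<close> that express \<open>a\<close> avoid the whole of \<open>N\<close>, and so outlive
  later changes of \<open>b\<close>, which happen inside \<open>N\<close>; the powers of
  \<open>a\<close> that express \<open>b\<close> off \<open>N\<close> so far only avoid
  \<open>p\<close>, and the next half step improves this.\<close>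

definition Inv where
  "Inv a b N O' g h \<longleftrightarrow> g \<in> Homeo X \<and> h \<in> Homeo X \<and> a = (\<lambda>x. g (\<alpha> (inv g x))) \<and> b = (\<lambda>x. h (\<beta> (inv h x))) \<and>
     (\<forall>f. coh X a f \<longleftrightarrow> coh X \<alpha> f) \<and> (\<forall>f. coh X b f \<longleftrightarrow> coh X \<alpha> f) \<and> a p = \<alpha> p \<and> b p = \<alpha> p \<and>
     locc X (\<lambda>x. x \<in> N) \<and> locc X (\<lambda>x. x \<in> O') \<and> p \<in> N \<and> N \<subseteq> O' \<and> O' \<subseteq> X \<and>
     (\<forall>x\<in>X. x \<notin> N \<longrightarrow> inner_at X a {p} b x) \<and> (\<forall>x\<in>X. x \<notin> O' \<longrightarrow> inner_at X b N a x)"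

lemma half_step:
  assumes a: "cms X a" and b: "cms X b" and c: "\<And>f. coh X a f \<longleftrightarrow> coh X b f" and ab: "a p = b p"
    and N: "locc X (\<lambda>x. x \<in> N)" "p \<in> N" "N \<subseteq> X" and O': "locc X (\<lambda>x. x \<in> O')"
    and ba: "\<forall>x\<in>X. x \<notin> N \<longrightarrow> inner_at X a {p} b x" and bO: "\<forall>x\<in>X. x \<notin> O' \<longrightarrow> inner_at X b N a x"
    and g: "g \<in> Homeo X" and e: "(e::real) > 0"
  shows "\<exists>F N'. F \<in> class_pres X a \<and> F p = p \<and> F (a p) = a p \<and>
     (\<forall>x\<in>X. dist (F (g x)) (g x) < e \<and> dist (inv (\<lambda>x. F (g x)) x) (inv g x) < e) \<and>
     locc X (\<lambda>x. x \<in> N') \<and> p \<in> N' \<and> N' \<subseteq> N \<and> (\<forall>x\<in>N'. dist p x < e) \<and>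
     (\<forall>x\<in>X. x \<notin> O' \<longrightarrow> F (a (inv F x)) = a x) \<and>
     (\<forall>x\<in>X. x \<notin> N' \<longrightarrow> inner_at X b {p} (\<lambda>x. F (a (inv F x))) x) \<and>
     (\<forall>x\<in>X. x \<notin> N \<longrightarrow> inner_at X (\<lambda>x. F (a (inv F x))) N' b x)"
proof -
  interpret A': cms X a by fact
  interpret B': cms X b by fact
  obtain k where k: "locc X k" "\<forall>x\<in>X. x \<notin> O' \<longrightarrow> a x = zpow b (k x) x \<and> avoid b N (k x) x"
    using B'.inner_cocycle[OF O', of N a] bO by metis
  obtain v0 :: "'a \<Rightarrow> nat" where v0: "locc X v0" "\<And>F. F \<in> Homeo X \<Longrightarrow> \<forall>x\<in>X. v0 (F x) = v0 x \<Longrightarrow>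
     \<forall>x\<in>X. dist (F (g x)) (g x) < e \<and> dist (inv (\<lambda>x. F (g x)) x) (inv g x) < e"
    using fine_colouring[OF A'.compact A'.zd g e] by blast
  obtain v1 :: "'a \<Rightarrow> nat" where v1: "locc X v1" "\<forall>x\<in>X. \<forall>y\<in>X. v1 x = v1 y \<longrightarrow> dist x y < e"
    using A'.zd e unfolding zero_dim_def by blast
  \<comment> \<open>Besides the fine colouring it records the exponents expressing \<open>a\<close>
    through \<open>b\<close> off \<open>O'\<close>. A conjugation that respects them and commutes
    with \<open>b\<close> off \<open>N\<close> leaves \<open>a\<close> unchanged off
    \<open>O'\<close>.\<close>
  define v where "v x = (v0 x, k x, x \<in> O')" for x
  have v: "locc X v" unfolding v_def
    by (rule locc_map2[OF v0(1) locc_map2[OF k(1) O', where g=Pair], where g=Pair])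
  define M where "M = {x. v1 x = v1 p}"
  have M: "locc X (\<lambda>x. x \<in> M)" unfolding M_def mem_Collect_eq by (rule locc_map[OF v1(1), where g="\<lambda>c. c = v1 p"])
  interpret interlace X a b p N M v
    by unfold_locales (use c p ab N ba M v in \<open>auto simp: M_def\<close>)
  obtain F N' where F: "F \<in> class_pres X a" "F p = p" "F (a p) = a p" "\<forall>x\<in>X. v (F x) = v x"
    and N': "locc X (\<lambda>x. x \<in> N')" "p \<in> N'" "N' \<subseteq> N" "N' \<subseteq> M"
    and com: "\<forall>x\<in>X. x \<notin> N \<longrightarrow> F (b x) = b (F x)"
    and i1: "\<forall>x\<in>X. x \<notin> N' \<longrightarrow> inner_at X b {p} (\<lambda>x. F (a (inv F x))) x"
    and i2: "\<forall>x\<in>X. x \<notin> N \<longrightarrow> inner_at X (\<lambda>x. F (a (inv F x))) N' b x"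
    using step by (elim exE conjE)
  have FH: "F \<in> Homeo X" using F(1) by (simp add: class_pres_def)
  have "F (a (inv F x)) = a x" if x: "x \<in> X" "x \<notin> O'" for x
  proof -
    define y where "y = inv F x"
    have y: "y \<in> X" "F y = x" using FH x(1) Homeo_inv_iff[OF FH] by (auto simp: y_def)
    have vy: "v x = v y" using F(4) y by metis
    then have yO: "y \<notin> O'" and ky: "k y = k x" using x(2) by (auto simp: v_def)
    have "F (zpow b (k y) y) = zpow b (k y) (F y)"
      by (rule avoid_transfer[OF B'.hom B'.bij y(1), where N=N]) (use com k(2) y(1) yO in auto)
    then have "F (a y) = a x" using k(2) y yO x ky by simp
    then show ?thesis by (simp add: y_def)
  qed
  moreover have "\<forall>x\<in>X. v0 (F x) = v0 x" using F(4) by (simp add: v_def)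
  then have "\<forall>x\<in>X. dist (F (g x)) (g x) < e \<and> dist (inv (\<lambda>x. F (g x)) x) (inv g x) < e" by (rule v0(2)[OF FH])
  moreover have "\<forall>x\<in>N'. dist p x < e"
  proof
    fix x assume "x \<in> N'"
    then have "x \<in> X" "v1 p = v1 x" using N' N(3) by (auto simp: M_def)
    then show "dist p x < e" using v1(2) p by blast
  qed
  ultimately show ?thesis using F(1-3) N'(1-3) i1 i2 by (intro exI[of _ F] exI[of _ N']) simp
qed

text \<open>What the limit needs from two consecutive stages. The last clause mixes the new
  \<open>a'\<close> with the old \<open>b\<close>: at this moment the path avoids
  \<open>O''\<close>, the set inside which the first map may still change.\<close>

definition Rel where
  "Rel n s s' \<longleftrightarrow> (case s of (a, b, N, O', g, h) \<Rightarrow> case s' of (a', b', N', O'', g', h') \<Rightarrow>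
     (\<forall>x\<in>X. dist (g' x) (g x) < (1/2) ^ n \<and> dist (inv g' x) (inv g x) < (1/2) ^ n) \<and>
     (\<forall>x\<in>X. dist (h' x) (h x) < (1/2) ^ n \<and> dist (inv h' x) (inv h x) < (1/2) ^ n) \<and>
     O'' \<subseteq> N \<and> (\<forall>x\<in>O''. dist p x < (1/2) ^ n) \<and>
     (\<forall>x\<in>X. x \<notin> O' \<longrightarrow> a' x = a x) \<and> (\<forall>x\<in>X. x \<notin> N \<longrightarrow> b' x = b x) \<and>
     (\<forall>x\<in>X. x \<notin> N \<longrightarrow> inner_at X a' O'' b x))"

text \<open>Two half steps with the roles exchanged: what the first yields about \<open>b\<close>
  and the new \<open>a'\<close> is exactly the input that the second requires.\<close>

lemma full_step:
  assumes I: "Inv a b N O' g h"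
  shows "\<exists>a' b' N' O'' g' h'. Inv a' b' N' O'' g' h' \<and> Rel n (a, b, N, O', g, h) (a', b', N', O'', g', h')"
proof -
  note I = I[unfolded Inv_def]
  have gh: "g \<in> Homeo X" "h \<in> Homeo X" and a: "a = (\<lambda>x. g (\<alpha> (inv g x)))" and b: "b = (\<lambda>x. h (\<beta> (inv h x)))" using I by auto
  have ca: "cms X a" unfolding a by (rule cms_conj[OF A.cms_axioms gh(1)])
  have cb: "cms X b" unfolding b by (rule cms_conj[OF B.cms_axioms gh(2)])
  have e: "(1/2::real) ^ n > 0" by simp
  have NX: "N \<subseteq> X" using I by blast
  have "\<exists>F N'. F \<in> class_pres X a \<and> F p = p \<and> F (a p) = a p \<and>
     (\<forall>x\<in>X. dist (F (g x)) (g x) < (1/2) ^ n \<and> dist (inv (\<lambda>x. F (g x)) x) (inv g x) < (1/2) ^ n) \<and>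
     locc X (\<lambda>x. x \<in> N') \<and> p \<in> N' \<and> N' \<subseteq> N \<and> (\<forall>x\<in>N'. dist p x < (1/2) ^ n) \<and>
     (\<forall>x\<in>X. x \<notin> O' \<longrightarrow> F (a (inv F x)) = a x) \<and>
     (\<forall>x\<in>X. x \<notin> N' \<longrightarrow> inner_at X b {p} (\<lambda>x. F (a (inv F x))) x) \<and>
     (\<forall>x\<in>X. x \<notin> N \<longrightarrow> inner_at X (\<lambda>x. F (a (inv F x))) N' b x)"
    by (rule half_step[OF ca cb _ _ _ _ NX _ _ _ gh(1) e]) (use I in auto)
  then obtain F O'' where F: "F \<in> class_pres X a" "F p = p" "F (a p) = a p"
    "\<forall>x\<in>X. dist (F (g x)) (g x) < (1/2) ^ n \<and> dist (inv (\<lambda>x. F (g x)) x) (inv g x) < (1/2) ^ n"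
    and O'': "locc X (\<lambda>x. x \<in> O'')" "p \<in> O''" "O'' \<subseteq> N" "\<forall>x\<in>O''. dist p x < (1/2) ^ n"
    and Fa: "\<forall>x\<in>X. x \<notin> O' \<longrightarrow> F (a (inv F x)) = a x"
    and i1: "\<forall>x\<in>X. x \<notin> O'' \<longrightarrow> inner_at X b {p} (\<lambda>x. F (a (inv F x))) x"
    and i2: "\<forall>x\<in>X. x \<notin> N \<longrightarrow> inner_at X (\<lambda>x. F (a (inv F x))) O'' b x"
    by (elim exE conjE)
  define a' where "a' = (\<lambda>x. F (a (inv F x)))"
  note fold = a'_def[symmetric]
  have FH: "F \<in> Homeo X" using F(1) by (simp add: class_pres_def)
  have ca': "cms X a'" unfolding a'_def by (rule cms_conj[OF ca FH])
  have coh': "coh X a' f \<longleftrightarrow> coh X \<alpha> f" for f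
    unfolding a'_def coh_conj_class_pres[OF cms.hom[OF ca] F(1)] using I by blast
  have a'p: "a' p = \<alpha> p" unfolding a'_def using F FH I by (metis inv_Homeo(1))
  have OX: "O'' \<subseteq> X" using O''(3) NX by blast
  have "\<exists>G N'. G \<in> class_pres X b \<and> G p = p \<and> G (b p) = b p \<and>
     (\<forall>x\<in>X. dist (G (h x)) (h x) < (1/2) ^ n \<and> dist (inv (\<lambda>x. G (h x)) x) (inv h x) < (1/2) ^ n) \<and>
     locc X (\<lambda>x. x \<in> N') \<and> p \<in> N' \<and> N' \<subseteq> O'' \<and> (\<forall>x\<in>N'. dist p x < (1/2) ^ n) \<and>
     (\<forall>x\<in>X. x \<notin> N \<longrightarrow> G (b (inv G x)) = b x) \<and>
     (\<forall>x\<in>X. x \<notin> N' \<longrightarrow> inner_at X a' {p} (\<lambda>x. G (b (inv G x))) x) \<and>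
     (\<forall>x\<in>X. x \<notin> O'' \<longrightarrow> inner_at X (\<lambda>x. G (b (inv G x))) N' a' x)"
    by (rule half_step[OF cb ca' _ _ O''(1,2) OX _ i1[unfolded fold] i2[unfolded fold] gh(2) e])
      (use I coh' a'p in auto)
  then obtain G N' where G: "G \<in> class_pres X b" "G p = p" "G (b p) = b p"
    "\<forall>x\<in>X. dist (G (h x)) (h x) < (1/2) ^ n \<and> dist (inv (\<lambda>x. G (h x)) x) (inv h x) < (1/2) ^ n"
    and N': "locc X (\<lambda>x. x \<in> N')" "p \<in> N'" "N' \<subseteq> O''"
    and Gb: "\<forall>x\<in>X. x \<notin> N \<longrightarrow> G (b (inv G x)) = b x"
    and j1: "\<forall>x\<in>X. x \<notin> N' \<longrightarrow> inner_at X a' {p} (\<lambda>x. G (b (inv G x))) x"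
    and j2: "\<forall>x\<in>X. x \<notin> O'' \<longrightarrow> inner_at X (\<lambda>x. G (b (inv G x))) N' a' x"
    by (elim exE conjE)
  define b' where "b' = (\<lambda>x. G (b (inv G x)))"
  have GH: "G \<in> Homeo X" using G(1) by (simp add: class_pres_def)
  have coh'': "coh X b' f \<longleftrightarrow> coh X \<alpha> f" for f
    unfolding b'_def coh_conj_class_pres[OF cms.hom[OF cb] G(1)] using I by blast
  have b'p: "b' p = \<alpha> p" unfolding b'_def using G GH I by (metis inv_Homeo(1))
  have invc: "inv (\<lambda>x. F (g x)) x = inv g (inv F x)" if "F \<in> Homeo X" "g \<in> Homeo X" for F g x
    by (rule inv_f_eq) (use HomeoD(1)[OF Homeo_comp[OF that]] bij_is_inj that in auto)
  have "Inv a' b' N' O'' (\<lambda>x. F (g x)) (\<lambda>x. G (h x))"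
    unfolding Inv_def
    using Homeo_comp[OF FH gh(1)] Homeo_comp[OF GH gh(2)] coh' coh'' a'p b'p N' O'' OX j1 j2
    unfolding invc[OF FH gh(1)] invc[OF GH gh(2)] b'_def a'_def a b by auto
  moreover have "Rel n (a, b, N, O', g, h) (a', b', N', O'', (\<lambda>x. F (g x)), (\<lambda>x. G (h x)))"
    unfolding Rel_def prod.case using F(4) G(4) O''(3,4) Fa Gb i2 unfolding a'_def b'_def by blast
  ultimately show ?thesis by blast
qed

lemma interlacing:
  "\<exists>A\<in>Homeo X. \<exists>B\<in>Homeo X.
     cocycle_off X (\<lambda>x. A (\<alpha> (inv A x))) (\<lambda>x. B (\<beta> (inv B x))) (\<lambda>x. x) p \<and>
     cocycle_off X (\<lambda>x. B (\<beta> (inv B x))) (\<lambda>x. A (\<alpha> (inv A x))) (\<lambda>x. x) p"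
proof -
  define P where "P s \<longleftrightarrow> (case s of (a, b, N, O', g, h) \<Rightarrow> Inv a b N O' g h)" for s
  have "\<exists>f. \<forall>n. P (f n) \<and> Rel n (f n) (f (Suc n))"
  proof (rule dependent_nat_choice)
    have i: "inv (\<lambda>x::'a. x) = (\<lambda>x. x)" using inv_id by (simp add: id_def)
    have "Inv \<alpha> \<beta> X X (\<lambda>x. x) (\<lambda>x. x)" unfolding Inv_def i
      using Homeo_id coh_eq \<alpha>p p locc_cong[of X "\<lambda>x. x \<in> X" "\<lambda>_. True"] by auto
    then show "\<exists>x. P x" unfolding P_def by (intro exI[of _ "(\<alpha>, \<beta>, X, X, (\<lambda>x. x), (\<lambda>x. x))"]) simp
  next
    fix s n assume "P s"
    obtain a b N O' g h where s: "s = (a, b, N, O', g, h)" by (cases s) auto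
    have "Inv a b N O' g h" using \<open>P s\<close> by (simp add: P_def s)
    from full_step[OF this, of n] obtain a' b' N' O'' g' h' where
      "Inv a' b' N' O'' g' h'" "Rel n s (a', b', N', O'', g', h')" unfolding s by (elim exE conjE)
    then show "\<exists>y. P y \<and> Rel n s y" unfolding P_def by (intro exI[of _ "(a', b', N', O'', g', h')"]) simp
  qed
  then obtain f where f: "\<And>n. P (f n)" "\<And>n. Rel n (f n) (f (Suc n))" by blast
  define a b N O' g h where "a n = fst (f n)" and "b n = fst (snd (f n))" and "N n = fst (snd (snd (f n)))"
    and "O' n = fst (snd (snd (snd (f n))))" and "g n = fst (snd (snd (snd (snd (f n)))))" and "h n = snd (snd (snd (snd (snd (f n)))))" for n
  have fe: "f n = (a n, b n, N n, O' n, g n, h n)" for n by (simp add: a_def b_def N_def O'_def g_def h_def)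
  have I: "Inv (a n) (b n) (N n) (O' n) (g n) (h n)" for n using f(1)[of n] by (simp add: P_def fe)
  have R: "Rel n (a n, b n, N n, O' n, g n, h n) (a (Suc n), b (Suc n), N (Suc n), O' (Suc n), g (Suc n), h (Suc n))" for n
    using f(2)[of n] by (simp add: fe)
  note I = I[unfolded Inv_def] and R = R[unfolded Rel_def prod.case]
  have gH: "g n \<in> Homeo X" "h n \<in> Homeo X" for n using I[of n] by auto
  have dg: "dist (g (Suc n) x) (g n x) < (1/2) ^ n" "dist (inv (g (Suc n)) x) (inv (g n) x) < (1/2) ^ n"
    and dh: "dist (h (Suc n) x) (h n x) < (1/2) ^ n" "dist (inv (h (Suc n)) x) (inv (h n) x) < (1/2) ^ n"
    if "x \<in> X" for n x using R[of n] that by blast+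
  obtain A where A: "A \<in> Homeo X" "uniform_limit X g A sequentially" "uniform_limit X (\<lambda>n. inv (g n)) (inv A) sequentially"
    using Homeo_limit[OF A.compact gH(1) dg] by blast
  obtain B where B: "B \<in> Homeo X" "uniform_limit X h B sequentially" "uniform_limit X (\<lambda>n. inv (h n)) (inv B) sequentially"
    using Homeo_limit[OF A.compact gH(2) dh] by blast
  define a' b' where "a' = (\<lambda>x. A (\<alpha> (inv A x)))" and "b' = (\<lambda>x. B (\<beta> (inv B x)))"
  have limc: "(\<lambda>n. g n (\<alpha> (inv (g n) x))) \<longlonglongrightarrow> A (\<alpha> (inv A x))"
    if g: "\<And>n. g n \<in> Homeo X" and \<alpha>: "\<alpha> \<in> Homeo X" and A: "A \<in> Homeo X" "uniform_limit X g A sequentially"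
      "uniform_limit X (\<lambda>n. inv (g n)) (inv A) sequentially" and x: "x \<in> X" for g A \<alpha> x
  proof (rule uniform_limit_comp[OF A.compact A(2) HomeoD(3)[OF A(1)]])
    show "\<alpha> (inv A x) \<in> X" using HomeoD(4)[OF \<alpha>] Homeo_inv_iff[OF A(1)] x by simp
    show "\<alpha> (inv (g n) x) \<in> X" for n using HomeoD(4)[OF \<alpha>] Homeo_inv_iff[OF g] x by simp
    show "(\<lambda>n. \<alpha> (inv (g n) x)) \<longlonglongrightarrow> \<alpha> (inv A x)"
      by (rule continuous_on_tendsto_compose[OF HomeoD(3)[OF \<alpha>] tendsto_uniform_limitI[OF A(3) x]])
        (use Homeo_inv_iff[OF A(1)] Homeo_inv_iff[OF g] x in auto)
  qed
  have la: "(\<lambda>n. a n x) \<longlonglongrightarrow> a' x" if x: "x \<in> X" for x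
  proof -
    have "a n x = g n (\<alpha> (inv (g n) x))" for n using I[of n] by metis
    then show ?thesis using limc[OF gH(1) A.hom A x] by (simp add: a'_def)
  qed
  have lb: "(\<lambda>n. b n x) \<longlonglongrightarrow> b' x" if x: "x \<in> X" for x
  proof -
    have "b n x = h n (\<beta> (inv (h n) x))" for n using I[of n] by metis
    then show ?thesis using limc[OF gH(2) B.hom B x] by (simp add: b'_def)
  qed
  have NO: "N n \<subseteq> O' n" "O' (Suc n) \<subseteq> N n" for n using I[of n] R[of n] by auto
  have dec: "O' (n + j) \<subseteq> O' n \<and> N (n + j) \<subseteq> N n" for n j
  proof (induction j)
    case (Suc j)
    then show ?case using NO[of "n + j"] NO[of "Suc (n + j)"] by auto
  qed simp
  have a_stab: "a' x = a n x" if x: "x \<in> X" "x \<notin> O' n" for x n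
  proof -
    have "a (n + j) x = a n x" for j
    proof (induction j)
      case (Suc j)
      have "x \<notin> O' (n + j)" using dec[of n j] x by blast
      then show ?case using Suc R[of "n + j"] x(1) by simp
    qed simp
    then have "(\<lambda>j. a (j + n) x) \<longlonglongrightarrow> a n x" by (simp add: add.commute)
    moreover have "(\<lambda>j. a (j + n) x) \<longlonglongrightarrow> a' x" using la[OF x(1)] by (rule LIMSEQ_ignore_initial_segment)
    ultimately show ?thesis using LIMSEQ_unique by blast
  qed
  have b_stab: "b' x = b n x" if x: "x \<in> X" "x \<notin> N n" for x n
  proof -
    have "b (n + j) x = b n x" for j
    proof (induction j)
      case (Suc j)
      have "x \<notin> N (n + j)" using dec[of n j] x by blast
      then show ?case using Suc R[of "n + j"] x(1) by simp
    qed simp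
    then have "(\<lambda>j. b (j + n) x) \<longlonglongrightarrow> b n x" by (simp add: add.commute)
    moreover have "(\<lambda>j. b (j + n) x) \<longlonglongrightarrow> b' x" using lb[OF x(1)] by (rule LIMSEQ_ignore_initial_segment)
    ultimately show ?thesis using LIMSEQ_unique by blast
  qed
  \<comment> \<open>The stages settle every point other than \<open>p\<close>. At \<open>p\<close>
    the two limits agree because the value there was kept throughout, so the exponent is 1.\<close>
  have "a n p = \<alpha> p" "b n p = \<alpha> p" for n using I[of n] by blast+
  then have "(\<lambda>n. a n p) \<longlonglongrightarrow> \<alpha> p" "(\<lambda>n. b n p) \<longlonglongrightarrow> \<alpha> p" by simp_all
  then have p_eq: "a' p = \<alpha> p" "b' p = \<alpha> p" using la[OF p] lb[OF p] LIMSEQ_unique by blast+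
  have a'H: "a' \<in> Homeo X" unfolding a'_def by (rule Homeo_comp[OF A(1) Homeo_comp[OF A.hom Homeo_inv[OF A(1)]]])
  have b'H: "b' \<in> Homeo X" unfolding b'_def by (rule Homeo_comp[OF B(1) Homeo_comp[OF B.hom Homeo_inv[OF B(1)]]])
  have off: "\<exists>n. x \<notin> N n \<and> x \<notin> O' n" if "x \<noteq> p" for x
  proof -
    have "0 < dist p x" using that by simp
    then obtain n where n: "(1/2::real) ^ n < dist p x" using real_arch_pow_inv[of "dist p x" "1/2"] by auto
    have "x \<notin> O' (Suc n)" using R[of n] n by force
    then show ?thesis using NO by blast
  qed
  have nbr: "\<exists>e>0. \<forall>y\<in>X. dist x y < e \<longrightarrow> y \<notin> M" if "locc X (\<lambda>x. x \<in> M)" "x \<in> X" "x \<notin> M" for x M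
    using that unfolding locc_def by metis
  \<comment> \<open>An expression of \<open>s\<close> by a power of \<open>t\<close> whose path
    avoids \<open>M\<close> remains valid if \<open>s\<close> changes only inside \<open>L\<close>
    and \<open>t\<close> only inside \<open>M\<close>. It carries the expressions of a finite stage
    over to the limit maps.\<close>
  have transfer: "\<exists>k. \<exists>e>0. \<forall>y\<in>X. dist x y < e \<longrightarrow> s' y = zpow t' k y"
    if x: "x \<in> X" "x \<notin> L" and L: "locc X (\<lambda>x. x \<in> L)" and s: "\<And>y. y \<in> X \<Longrightarrow> y \<notin> L \<Longrightarrow> s' y = s y"
      and M: "locc X (\<lambda>x. x \<in> M)" and t: "t \<in> Homeo X" "t' \<in> Homeo X" "\<And>y. y \<in> X \<Longrightarrow> y \<notin> M \<Longrightarrow> t' y = t y"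
      and inn: "inner_at X t M s x" for x L s s' t t' M
  proof -
    obtain k e where k: "e > 0" "\<forall>y\<in>X. dist x y < e \<longrightarrow> s y = zpow t k y" "avoid t M k x"
      using inn unfolding inner_at_def by metis
    have "locc X (\<lambda>y. \<forall>i\<in>{min 0 k..<max 0 k}. zpow t i y \<notin> M)"
      by (rule locc_ball, simp) (rule locc_map[OF locc_Homeo[OF M Homeo_zpow[OF t(1)]], where g=Not])
    moreover have "(\<forall>i\<in>{min 0 k..<max 0 k}. zpow t i y \<notin> M) \<longleftrightarrow> avoid t M k y" for y by (auto simp: avoid_def)
    ultimately obtain d where d: "d > 0" "\<forall>y\<in>X. dist x y < d \<longrightarrow> avoid t M k y"
      using x(1) k(3) unfolding locc_def by metis
    obtain d' where d': "d' > 0" "\<forall>y\<in>X. dist x y < d' \<longrightarrow> y \<notin> L" using nbr[OF L x] by metis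
    have "s' y = zpow t' k y" if y: "y \<in> X" "dist x y < min e (min d d')" for y
    proof -
      have "zpow t k y = zpow t' k y"
        by (rule avoid_transfer[OF t(1) HomeoD(1)[OF t(2)] y(1), where F="\<lambda>x. x" and N=M]) (use t(3) d(2) y in auto)
      then show ?thesis using s[OF y(1)] d'(2) k(2) y by simp
    qed
    moreover have "min e (min d d') > 0" using k(1) d(1) d'(1) by simp
    ultimately show ?thesis by metis
  qed
  have ab: "\<exists>k. \<exists>e>0. \<forall>y\<in>X. dist x y < e \<longrightarrow> a' y = zpow b' k y" if x: "x \<in> X" "x \<noteq> p" for x
  proof -
    obtain n where n: "x \<notin> O' n" using off[OF x(2)] by blast
    have bn: "b n \<in> Homeo X" using I[of n] Homeo_comp[OF _ Homeo_comp[OF B.hom Homeo_inv]] by metis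
    show ?thesis
      by (rule transfer[OF x(1) n _ a_stab _ bn b'H b_stab]) (use I[of n] x(1) n in auto)
  qed
  have ba: "\<exists>k. \<exists>e>0. \<forall>y\<in>X. dist x y < e \<longrightarrow> b' y = zpow a' k y" if x: "x \<in> X" "x \<noteq> p" for x
  proof -
    obtain n where n: "x \<notin> N n" using off[OF x(2)] by blast
    \<comment> \<open>The stages are offset by one: \<open>b n\<close> is expressed off
      \<open>N n\<close> by the next map \<open>a (Suc n)\<close>, with paths avoiding
      \<open>O' (Suc n)\<close>.\<close>
    have an: "a (Suc n) \<in> Homeo X" using I[of "Suc n"] Homeo_comp[OF _ Homeo_comp[OF A.hom Homeo_inv]] by metis
    show ?thesis
      by (rule transfer[OF x(1) n _ b_stab _ an a'H a_stab]) (use I[of n] I[of "Suc n"] R[of n] x(1) n in auto)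
  qed
  have fin: "cocycle_off X s t (\<lambda>x. x) p" if st: "\<And>x. x \<in> X \<Longrightarrow> x \<noteq> p \<Longrightarrow> \<exists>k. \<exists>e>0. \<forall>y\<in>X. dist x y < e \<longrightarrow> s y = zpow t k y"
    "s p = t p" for s t
    unfolding cocycle_off_def
  proof (intro conjI ballI impI)
    fix x assume x: "x \<in> X"
    show "\<exists>k. s x = zpow t k x"
    proof (cases "x = p")
      case True
      then show ?thesis using that(2) by (intro exI[of _ 1]) simp
    next
      case False
      then obtain k e where "e > 0" "\<forall>y\<in>X. dist x y < e \<longrightarrow> s y = zpow t k y" using st(1)[OF x] by metis
      then have "s x = zpow t k x" using x by simp
      then show ?thesis by blast
    qed
  qed (use that(1) in blast)
  show ?thesis using fin[OF ab] fin[OF ba] p_eq A(1) B(1) unfolding a'_def b'_def by metis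
qed

end

section \<open>Splitting colourings along classes\<close>

lemma list_of_colours:
  assumes "image_mset pr M = mset ds"
  shows "\<exists>xs. mset xs = M \<and> map pr xs = ds"
proof -
  obtain ys where ys: "mset ys = M" using ex_mset by blast
  have "mset ds = mset (map pr ys)" using assms ys by simp
  then obtain \<pi> where \<pi>: "\<pi> permutes {..<length (map pr ys)}" "permute_list \<pi> (map pr ys) = ds"
    by (rule mset_eq_permutation)
  then have \<pi>': "\<pi> permutes {..<length ys}" by simp
  have "map pr (permute_list \<pi> ys) = ds" using permute_list_map[OF \<pi>', of pr] \<pi>(2) by simp
  moreover have "mset (permute_list \<pi> ys) = M" using mset_permute_list[OF \<pi>'] ys by simp
  ultimately show ?thesis by blast
qed

lemma list_of_colours_at:
  assumes M: "image_mset pr M = mset ds" and j: "j < length ds" and c: "c \<in># M" "pr c = ds ! j"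
  shows "\<exists>xs. mset xs = M \<and> map pr xs = ds \<and> xs ! j = c"
proof -
  define ds' where "ds' = take j ds @ drop (Suc j) ds"
  have ds: "ds = take j ds @ ds ! j # drop (Suc j) ds" using id_take_nth_drop[OF j] .
  then have "mset ds = add_mset (ds ! j) (mset ds')"
    unfolding ds'_def by (metis mset_append mset.simps(2) union_mset_add_mset_right)
  moreover have "image_mset pr M = add_mset (pr c) (image_mset pr (M - {#c#}))"
    using c(1) by (metis image_mset_add_mset insert_DiffM)
  ultimately have "image_mset pr (M - {#c#}) = mset ds'" using M c(2) by simp
  from list_of_colours[OF this] obtain xs where xs: "mset xs = M - {#c#}" "map pr xs = ds'" by blast
  define zs where "zs = take j xs @ c # drop j xs"
  have l: "length xs = length ds'" using xs(2) by (metis length_map)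
  then have lj: "j \<le> length xs" using j by (simp add: ds'_def)
  have "mset zs = add_mset c (mset xs)"
    unfolding zs_def by (metis append_take_drop_id mset.simps(2) mset_append union_mset_add_mset_right)
  then have "mset zs = M" using xs(1) c(1) by simp
  moreover have "map pr zs = ds"
  proof -
    have "map pr zs = take j ds' @ pr c # drop j ds'" unfolding zs_def xs(2)[symmetric] by (simp add: take_map drop_map)
    also have "take j ds' = take j ds" using j by (simp add: ds'_def)
    also have "drop j ds' = drop (Suc j) ds" using j by (simp add: ds'_def)
    finally show ?thesis using ds c(2) by simp
  qed
  moreover have "zs ! j = c" using lj by (simp add: zs_def nth_append)
  ultimately show ?thesis by blast
qed

lemma count_image_replicates:
  assumes "finite S"
  shows "count (image_mset pr (\<Sum>c\<in>S. replicate_mset (f c) c)) i = (\<Sum>c\<in>{c\<in>S. pr c = i}. f c)"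
  using assms
proof (induction S rule: finite_induct)
  case (insert c S)
  have "{x \<in> insert c S. pr x = i} = (if pr c = i then insert c {x\<in>S. pr x = i} else {x\<in>S. pr x = i})" by auto
  then show ?case using insert by simp
qed simp

lemma count_replicates:
  assumes "finite S"
  shows "count (\<Sum>c\<in>S. replicate_mset (f c) c) i = (if i \<in> S then f i else 0)"
  using assms by (induction S rule: finite_induct) auto

lemma sum_list_swap: "sum_list (map (\<lambda>q. \<Sum>c\<in>A. g c q) w) = (\<Sum>c\<in>A. sum_list (map (g c) w))"
  for g :: "'c \<Rightarrow> 'q \<Rightarrow> int"
  by (induction w) (auto simp: sum.distrib)

text \<open>Realises prescribed nonnegative classes by an actual clopen partition refining
  \<open>d\<close>. Over a small base, the sum of the function for \<open>c\<close> along a tower is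
  the number of levels to be coloured \<open>c\<close>, and the hypothesis on sums says that these
  numbers exhaust the levels of each colour of \<open>d\<close>. The points \<open>p\<close> and
  \<open>a p\<close> lie in towers with different words, so both new colours can be
  prescribed.\<close>

lemma (in cms) split_colour:
  fixes d :: "'a \<Rightarrow> 'd" and pr :: "'c \<Rightarrow> 'd" and \<phi> :: "'c \<Rightarrow> 'a \<Rightarrow> int"
  assumes d: "locc X d" and S: "finite S" and \<phi>: "\<And>c. c \<in> S \<Longrightarrow> locc X (\<phi> c)"
    and pos: "\<And>c x. c \<in> S \<Longrightarrow> x \<in> X \<Longrightarrow> 0 \<le> \<phi> c x"
    and sum: "\<And>i. coh X a (\<lambda>x. of_bool (d x = i) - (\<Sum>c\<in>{c\<in>S. pr c = i}. \<phi> c x))" and p: "p \<in> X"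
    and c1: "c1 \<in> S" "pr c1 = d p" "\<exists>x\<in>X. \<phi> c1 x \<noteq> 0" and c2: "c2 \<in> S" "pr c2 = d (a p)" "\<exists>x\<in>X. \<phi> c2 x \<noteq> 0"
  shows "\<exists>d'. locc X d' \<and> (\<forall>x\<in>X. d' x \<in> S \<and> pr (d' x) = d x) \<and>
     (\<forall>c\<in>S. coh X a (\<lambda>x. of_bool (d' x = c) - \<phi> c x)) \<and> d' p = c1 \<and> d' (a p) = c2"
proof -
  have ap: "a p \<in> X" using p by simp
  have "\<exists>k. (\<exists>x\<in>X. \<phi> c x \<noteq> 0) \<longrightarrow> \<phi> c (zpow a k (a p)) \<noteq> 0" if c: "c \<in> S" for c
  proof (cases "\<exists>x\<in>X. \<phi> c x \<noteq> 0")
    case True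
    then obtain x where x: "x \<in> X" "\<phi> c x \<noteq> 0" by blast
    have "locc X (\<lambda>x. \<phi> c x \<noteq> 0)" by (rule locc_map[OF \<phi>[OF c], where g="\<lambda>v. v \<noteq> 0"])
    from hit_up[OF this x ap] show ?thesis by blast
  qed blast
  then obtain k where k: "\<And>c. c \<in> S \<Longrightarrow> \<exists>x\<in>X. \<phi> c x \<noteq> 0 \<Longrightarrow> \<phi> c (zpow a (k c) (a p)) \<noteq> 0" by metis
  \<comment> \<open>A shift by a power of \<open>a\<close> keeps the class and makes the function
    nonzero at \<open>a p\<close>, hence on the whole base. Every tower then has room for every
    colour whose function is not identically zero, in particular for \<open>c1\<close> and
    \<open>c2\<close> at the chosen positions.\<close>
  define \<psi> where "\<psi> c x = (if c \<in> S then \<phi> c (zpow a (k c) x) else 0)" for c x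
  have \<psi>: "locc X (\<psi> c)" for c
    unfolding \<psi>_def by (cases "c \<in> S") (simp_all add: locc_z \<phi>)
  have \<psi>pos: "0 \<le> \<psi> c x" if "x \<in> X" for c x unfolding \<psi>_def using pos that by simp
  have \<psi>\<phi>: "coh X a (\<lambda>x. \<psi> c x - \<phi> c x)" if "c \<in> S" for c
    unfolding \<psi>_def using that coh_zpow[OF hom \<phi>[OF that]] by simp
  have sum\<psi>: "coh X a (\<lambda>x. of_bool (d x = i) - (\<Sum>c\<in>{c\<in>S. pr c = i}. \<psi> c x))" for i
  proof -
    have "coh X a (\<lambda>x. (\<Sum>c\<in>{c\<in>S. pr c = i}. \<psi> c x - \<phi> c x))" by (rule coh_sum) (use \<psi>\<phi> in auto)
    from coh_diff[OF sum[of i] this] show ?thesis by (simp add: sum_subtractf)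
  qed
  define I where "I = d ` X \<union> pr ` S"
  have I: "finite I" unfolding I_def using locc_finite_range[OF compact d] S by simp
  have "\<forall>i. \<exists>h::'a \<Rightarrow> int. locc X h \<and> (\<forall>x\<in>X. of_bool (d x = i) - (\<Sum>c\<in>{c\<in>S. pr c = i}. \<psi> c x) = h (a x) - h x)"
    using sum\<psi> unfolding coh_def by (rule allI)
  from choice[OF this] obtain h :: "'d \<Rightarrow> 'a \<Rightarrow> int" where h: "\<forall>i. locc X (h i) \<and>
    (\<forall>x\<in>X. of_bool (d x = i) - (\<Sum>c\<in>{c\<in>S. pr c = i}. \<psi> c x) = h i (a x) - h i x)" ..
  \<comment> \<open>The transfer functions \<open>h\<close> and the functions \<psi> are merged into
    one family so that a single base makes all of them constant.\<close>
  have lh: "locc X (case_sum h \<psi> c)" for c using h \<psi> by (cases c) simp_all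
  have "\<exists>D. a p \<in> D \<and> D \<subseteq> X \<inter> UNIV \<and> (\<forall>c\<in>Inl ` I \<union> Inr ` S. \<forall>x\<in>D. \<forall>y\<in>D. case_sum h \<psi> c x = case_sum h \<psi> c y) \<and> tower X a D"
    by (rule small_base[OF _ lh _ ap]) (use I S in simp_all)
  then obtain D where D: "a p \<in> D" "\<forall>c\<in>Inl ` I \<union> Inr ` S. \<forall>x\<in>D. \<forall>y\<in>D. case_sum h \<psi> c x = case_sum h \<psi> c y" "tower X a D"
    by (elim exE conjE)
  have hD: "h i x = h i y" if "i \<in> I" "x \<in> D" "y \<in> D" for i x y
  proof -
    have "case_sum h \<psi> (Inl i) x = case_sum h \<psi> (Inl i) y" using D(2) that by blast
    then show ?thesis unfolding sum.case .
  qed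
  have \<psi>D: "\<psi> c x = \<psi> c y" if "c \<in> S" "x \<in> D" "y \<in> D" for c x y
  proof -
    have "case_sum h \<psi> (Inr c) x = case_sum h \<psi> (Inr c) y" using D(2) that by blast
    then show ?thesis unfolding sum.case .
  qed
  interpret tower X a D by fact
  \<comment> \<open>The bottom of the tower of \<open>p\<close>, distinct from \<open>a p\<close> by
    aperiodicity; a colour separating the two makes the words of \<open>p\<close> and
    \<open>a p\<close> different.\<close>
  define yp where "yp = zpow a (- int (dnD p)) p"
  have "yp \<noteq> a p"
  proof
    assume "yp = a p"
    then have "zpow a (- int (dnD p)) p = zpow a 1 p" by (simp add: yp_def)
    then have "- int (dnD p) = 1" using zpow_inj[OF p] by blast
    then show False by simp
  qed
  then obtain sep :: "'a \<Rightarrow> nat" where sep: "locc X sep" "sep yp \<noteq> sep (a p)"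
    using separate[of yp "a p"] p by (auto simp: yp_def)
  define u where "u x = (d x, (\<lambda>c. if c \<in> S then \<psi> c x else 0), sep x)" for x
  have u: "locc X u" unfolding u_def
    by (rule locc_map2[OF d locc_map2[OF locc_fun[OF S \<psi>] sep(1), where g=Pair], where g=Pair])
  define w where "w = wdD u"
  have wne: "w p \<noteq> w (a p)"
  proof
    assume e: "w p = w (a p)"
    have "dnD (a p) = 0" using dn_zero_iff[OF ap] D(1) by simp
    then have "w (a p) ! 0 = u (a p)" unfolding w_def using wd_at[of u "a p"] by simp
    moreover have "w p ! 0 = u yp" unfolding w_def using wd_nth[of 0 p u] by (simp add: yp_def)
    ultimately show False using e sep(2) by (simp add: u_def)
  qed
  define n where "n \<omega> c = sum_list (map (\<lambda>q. fst (snd q) c) \<omega>)" for \<omega> :: "('d \<times> ('c \<Rightarrow> int) \<times> nat) list" and c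
  have n_eq: "n (w x) c = (\<Sum>i<dnD x + upD x + 1. \<psi> c (zpow a (int i - int (dnD x)) x))" if "c \<in> S" for x c
    unfolding n_def w_def sum_wd using that by (simp add: u_def)
  have n_pos: "0 \<le> n (w x) c" if "x \<in> X" "c \<in> S" for x c
    unfolding n_eq[OF that(2)] by (rule sum_nonneg) (use \<psi>pos that in auto)
  have n_gt: "0 < n (w x) c" if x: "x \<in> X" and c: "c \<in> S" "\<exists>x\<in>X. \<phi> c x \<noteq> 0" for x c
  proof -
    have "\<psi> c (a p) \<noteq> 0" using k[OF c] c(1) by (simp add: \<psi>_def)
    then have "\<psi> c (zpow a (- int (dnD x)) x) \<noteq> 0" using \<psi>D[OF c(1) D(1) dn_D[OF x]] by simp
    then have "0 < \<psi> c (zpow a (- int (dnD x)) x)" using \<psi>pos[of "zpow a (- int (dnD x)) x" c] x by simp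
    also have "\<dots> = \<psi> c (zpow a (int 0 - int (dnD x)) x)" by simp
    also have "\<dots> \<le> n (w x) c" unfolding n_eq[OF c(1)]
      by (rule member_le_sum) (use \<psi>pos x in auto)
    finally show ?thesis .
  qed
  \<comment> \<open>The stock of new colours for a tower with this word; it remains to distribute
    them over levels of the right old colour.\<close>
  define M where "M \<omega> = (\<Sum>c\<in>S. replicate_mset (nat (n \<omega> c)) c)" for \<omega>
  have M: "image_mset pr (M (w x)) = mset (map fst (w x))" if x: "x \<in> X" for x
  proof (rule multiset_eqI)
    fix i
    define \<Phi> :: "'d \<times> ('c \<Rightarrow> int) \<times> nat \<Rightarrow> int" where "\<Phi> q = of_bool (fst q = i) - (\<Sum>c\<in>{c\<in>S. pr c = i}. fst (snd q) c)" for q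
    define f :: "'a \<Rightarrow> int" where "f x = of_bool (d x = i) - (\<Sum>c\<in>{c\<in>S. pr c = i}. \<psi> c x)" for x
    have \<Phi>u: "\<Phi> (u x) = f x" for x unfolding \<Phi>_def f_def u_def by simp
    have "sum_list (map \<Phi> (w x)) = 0"
    proof (cases "i \<in> I")
      case True
      show ?thesis unfolding w_def
      proof (rule coh_sum_wd[where f=f and h="h i" and \<phi>=\<Phi> and u=u, OF _ hD[OF True] \<Phi>u x])
        show "f y = h i (a y) - h i y" if "y \<in> X" for y using h that unfolding f_def by blast
      qed
    next
      case False
      have "f y = 0" if "y \<in> X" for y using False that unfolding f_def I_def by (auto intro!: sum.neutral)
      then show ?thesis unfolding w_def
        by (intro coh_sum_wd[where f=f and h="\<lambda>_. 0"]) (use \<Phi>u x in auto)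
    qed
    also have "sum_list (map \<Phi> (w x)) = sum_list (map (\<lambda>q. of_bool (fst q = i)) (w x)) - (\<Sum>c\<in>{c\<in>S. pr c = i}. n (w x) c)"
      unfolding \<Phi>_def n_def sum_list_swap[symmetric] by (simp add: sum_list_subtractf)
    also have "sum_list (map (\<lambda>q. of_bool (fst q = i)) (w x)) = int (count (mset (map fst (w x))) i)"
      unfolding count_list_sum by (simp add: o_def)
    finally have "int (count (mset (map fst (w x))) i) = (\<Sum>c\<in>{c\<in>S. pr c = i}. n (w x) c)" by simp
    also have "\<dots> = int (\<Sum>c\<in>{c\<in>S. pr c = i}. nat (n (w x) c))"
      unfolding of_nat_sum by (rule sum.cong) (use n_pos[OF x] in auto)
    finally have "count (mset (map fst (w x))) i = (\<Sum>c\<in>{c\<in>S. pr c = i}. nat (n (w x) c))" by linarith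
    then show "count (image_mset pr (M (w x))) i = count (mset (map fst (w x))) i"
      unfolding M_def count_image_replicates[OF S] by simp
  qed
  have inM: "c \<in># M (w x)" if "x \<in> X" "c \<in> S" "\<exists>x\<in>X. \<phi> c x \<noteq> 0" for x c
    using n_gt[OF that] that(2) unfolding M_def by (simp add: count_replicates[OF S] flip: count_greater_zero_iff)
  have fst_w: "map fst (w x) ! dnD x = d x" "dnD x < length (map fst (w x))" for x unfolding w_def by (simp_all add: u_def)
  have "\<exists>\<delta>. mset \<delta> = M (w x) \<and> map pr \<delta> = map fst (w x) \<and> (w x = w p \<longrightarrow> \<delta> ! dnD p = c1) \<and> (w x = w (a p) \<longrightarrow> \<delta> ! dnD (a p) = c2)"
    if x: "x \<in> X" for x
  proof -
    consider "w x = w p" | "w x = w (a p)" | "w x \<noteq> w p" "w x \<noteq> w (a p)" by blast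
    then show ?thesis
    proof cases
      case 1
      have "\<exists>\<delta>. mset \<delta> = M (w p) \<and> map pr \<delta> = map fst (w p) \<and> \<delta> ! dnD p = c1"
        by (rule list_of_colours_at[OF M[OF p] fst_w(2) inM[OF p c1(1,3)]]) (use c1(2) fst_w(1) in simp)
      then show ?thesis using 1 wne by auto
    next
      case 2
      have "\<exists>\<delta>. mset \<delta> = M (w (a p)) \<and> map pr \<delta> = map fst (w (a p)) \<and> \<delta> ! dnD (a p) = c2"
        by (rule list_of_colours_at[OF M[OF ap] fst_w(2) inM[OF ap c2(1,3)]]) (use c2(2) fst_w(1) in simp)
      then show ?thesis using 2 wne by auto
    next
      case 3
      then show ?thesis using list_of_colours[OF M[OF x]] by auto
    qed
  qed
  then have "\<forall>\<omega>\<in>w ` X. \<exists>\<delta>. mset \<delta> = M \<omega> \<and> map pr \<delta> = map fst \<omega> \<and> (\<omega> = w p \<longrightarrow> \<delta> ! dnD p = c1) \<and> (\<omega> = w (a p) \<longrightarrow> \<delta> ! dnD (a p) = c2)"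
    by blast
  from bchoice[OF this] obtain \<delta> where \<delta>0: "\<forall>\<omega>\<in>w ` X. mset (\<delta> \<omega>) = M \<omega> \<and> map pr (\<delta> \<omega>) = map fst \<omega> \<and> (\<omega> = w p \<longrightarrow> \<delta> \<omega> ! dnD p = c1) \<and> (\<omega> = w (a p) \<longrightarrow> \<delta> \<omega> ! dnD (a p) = c2)" ..
  have \<delta>: "mset (\<delta> (w x)) = M (w x)" "map pr (\<delta> (w x)) = map fst (w x)" if "x \<in> X" for x using \<delta>0 that by auto
  have len: "length (\<delta> (w x)) = dnD x + upD x + 1" if "x \<in> X" for x
    using arg_cong[OF \<delta>(2)[OF that], of length] by (simp add: w_def)
  define d' where "d' x = \<delta> (w x) ! dnD x" for x
  have ld': "locc X d'" unfolding d'_def w_def by (rule locc_map2[OF locc_wd[OF u] locc_dn, where g="\<lambda>w j. \<delta> w ! j"])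
  have "d' x \<in> S \<and> pr (d' x) = d x" if x: "x \<in> X" for x
  proof
    have l: "dnD x < length (\<delta> (w x))" using len[OF x] by simp
    then have "d' x \<in># M (w x)" unfolding d'_def using \<delta>(1)[OF x] nth_mem_mset by metis
    then show "d' x \<in> S" unfolding M_def using count_replicates[OF S] by (metis count_eq_zero_iff)
    show "pr (d' x) = d x" using arg_cong[OF \<delta>(2)[OF x], of "\<lambda>l. l ! dnD x"] fst_w(1)[of x] l by (simp add: d'_def)
  qed
  moreover have "coh X a (\<lambda>x. of_bool (d' x = c) - \<phi> c x)" if c: "c \<in> S" for c
  proof -
    have lf: "locc X (\<lambda>x. of_bool (d' x = c) - \<psi> c x)" by (rule locc_map2[OF ld' \<psi>, where g="\<lambda>v f. of_bool (v = c) - f"])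
    have "coh X a (\<lambda>x. of_bool (d' x = c) - \<psi> c x)"
    proof (rule sum_wd_coh[OF lf])
      fix x assume x: "x \<in> X"
      have d'z: "d' (zpow a (int i - int (dnD x)) x) = \<delta> (w x) ! i" if i: "i < dnD x + upD x + 1" for i
      proof -
        have "- int (dnD x) \<le> int i - int (dnD x)" "int i - int (dnD x) \<le> int (upD x)" using i by auto
        then have "int (dnD (zpow a (int i - int (dnD x)) x)) = int i" "w (zpow a (int i - int (dnD x)) x) = w x"
          using shift(1)[OF x] shift(3)[OF x, of _ u] unfolding w_def by simp_all
        then show ?thesis unfolding d'_def by simp
      qed
      have "sum_list (wdD (\<lambda>x. of_bool (d' x = c) - \<psi> c x) x) =
        (\<Sum>i<dnD x + upD x + 1. of_bool (d' (zpow a (int i - int (dnD x)) x) = c)) - n (w x) c"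
        using sum_wd[of "\<lambda>c. c"] unfolding n_eq[OF c] by (simp add: sum_subtractf)
      also have "(\<Sum>i<dnD x + upD x + 1. of_bool (d' (zpow a (int i - int (dnD x)) x) = c)) = (\<Sum>i<dnD x + upD x + 1. of_bool (\<delta> (w x) ! i = c) :: int)"
        by (rule sum.cong) (use d'z in auto)
      also have "\<dots> = int (count (mset (\<delta> (w x))) c)"
        unfolding count_list_sum using len[OF x] by (simp add: sum_list_sum_nth atLeast0LessThan)
      also have "\<dots> = n (w x) c" using \<delta>(1)[OF x] c n_pos[OF x c] unfolding M_def by (simp add: count_replicates[OF S])
      finally show "sum_list (wdD (\<lambda>x. of_bool (d' x = c) - \<psi> c x) x) = 0" by simp
    qed
    from coh_add[OF this \<psi>\<phi>[OF c]] show ?thesis by simp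
  qed
  moreover have "d' p = c1" "d' (a p) = c2" unfolding d'_def using \<delta>0 p ap by auto
  ultimately show ?thesis using ld' by blast
qed

section \<open>Realising an isomorphism of dimension groups by a homeomorphism\<close>

text \<open>\<open>\<rho> f g\<close> says that the isomorphism maps the class of \<open>f\<close> to the class of \<open>g\<close>.\<close>

locale krel = A: cms X a + B: cms Y b
  for X :: "'a::metric_space set" and a and Y :: "'b::metric_space set" and b +
  fixes \<rho> :: "('a \<Rightarrow> int) \<Rightarrow> ('b \<Rightarrow> int) \<Rightarrow> bool"
  assumes loccs: "\<rho> f g \<Longrightarrow> locc X f \<and> locc Y g" and coh: "\<rho> f g \<Longrightarrow> coh X a f \<longleftrightarrow> coh Y b g"
    and diff: "\<rho> f g \<Longrightarrow> \<rho> f' g' \<Longrightarrow> \<rho> (\<lambda>x. f x - f' x) (\<lambda>y. g y - g' y)"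
    and pos: "locc X f \<Longrightarrow> \<forall>x\<in>X. 0 \<le> f x \<Longrightarrow> \<exists>g. \<rho> f g \<and> (\<forall>y\<in>Y. 0 \<le> g y)"
    and pos': "locc Y g \<Longrightarrow> \<forall>y\<in>Y. 0 \<le> g y \<Longrightarrow> \<exists>f. \<rho> f g \<and> (\<forall>x\<in>X. 0 \<le> f x)"
    and one: "\<rho> (\<lambda>_. 1) (\<lambda>_. 1)"
    and cong: "\<rho> f g \<Longrightarrow> locc X f' \<Longrightarrow> locc Y g' \<Longrightarrow> coh X a (\<lambda>x. f' x - f x) \<Longrightarrow> coh Y b (\<lambda>y. g' y - g y) \<Longrightarrow> \<rho> f' g'"
begin

text \<open>The axioms are symmetric, so the refinement step serves both directions of the
  back-and-forth.\<close>

lemma sym: "krel Y b X a (\<lambda>g f. \<rho> f g)"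
proof
  show "\<rho> g f \<Longrightarrow> locc Y f \<and> locc X g" for f g using loccs by blast
  show "\<rho> g f \<Longrightarrow> coh Y b f \<longleftrightarrow> coh X a g" for f g using coh by blast
  show "\<rho> g' f' \<Longrightarrow> \<rho> g'' f'' \<Longrightarrow> \<rho> (\<lambda>x. g' x - g'' x) (\<lambda>x. f' x - f'' x)" for f' f'' g' g'' by (rule diff)
  show "locc Y g \<Longrightarrow> \<forall>y\<in>Y. 0 \<le> g y \<Longrightarrow> \<exists>f. \<rho> f g \<and> (\<forall>x\<in>X. 0 \<le> f x)" for g by (rule pos')
  show "locc X f \<Longrightarrow> \<forall>x\<in>X. 0 \<le> f x \<Longrightarrow> \<exists>g. \<rho> f g \<and> (\<forall>y\<in>Y. 0 \<le> g y)" for f by (rule pos)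
  show "\<rho> (\<lambda>_. 1) (\<lambda>_. 1)" by (rule one)
  show "\<rho> g f \<Longrightarrow> locc Y f' \<Longrightarrow> locc X g' \<Longrightarrow> coh Y b (\<lambda>x. f' x - f x) \<Longrightarrow> coh X a (\<lambda>y. g' y - g y) \<Longrightarrow> \<rho> g' f'"
    for f g f' g' by (rule cong)
qed

lemma zero: "\<rho> (\<lambda>_. 0) (\<lambda>_. 0)"
  using diff[OF one one] by simp

lemma add: "\<rho> f g \<Longrightarrow> \<rho> f' g' \<Longrightarrow> \<rho> (\<lambda>x. f x + f' x) (\<lambda>y. g y + g' y)"
  using diff[OF _ diff[OF zero], of f g f' g'] by simp

lemma sum: "(\<And>i. i \<in> S \<Longrightarrow> \<rho> (f i) (g i)) \<Longrightarrow> \<rho> (\<lambda>x. \<Sum>i\<in>S. f i x) (\<lambda>y. \<Sum>i\<in>S. g i y)"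
  by (induction S rule: infinite_finite_induct) (auto intro: zero add)

lemma mult: "\<rho> f g \<Longrightarrow> \<rho> (\<lambda>x. k * f x) (\<lambda>y. k * g y)"
proof (induction k rule: int_induct[where k=0])
  case base
  then show ?case using zero by simp
next
  case (step1 i)
  then show ?case using add[of "\<lambda>x. i * f x" "\<lambda>y. i * g y" f g] by (simp add: algebra_simps)
next
  case (step2 i)
  then show ?case using diff[of "\<lambda>x. i * f x" "\<lambda>y. i * g y" f g] by (simp add: algebra_simps)
qed

definition matched where
  "matched c d \<longleftrightarrow> locc X c \<and> locc Y d \<and> (\<forall>i::nat. \<rho> (\<lambda>x. of_bool (c x = i)) (\<lambda>y. of_bool (d y = i)))"

lemma matched_ex:
  assumes m: "matched c d" and x: "x \<in> X"
  shows "\<exists>y\<in>Y. d y = c x"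
proof (rule ccontr)
  assume n: "\<not> (\<exists>y\<in>Y. d y = c x)"
  have "coh Y b (\<lambda>y. of_bool (d y = c x))"
    by (rule iffD1[OF coh_cong coh_0]) (use n in auto)
  then have "coh X a (\<lambda>z. of_bool (c z = c x))" using m coh unfolding matched_def by blast
  from A.coh_nonneg[OF this _ x] show False by simp
qed

text \<open>Positivity lifts the indicators of the finer partition to nonnegative functions on the
  other side, and \<open>split_colour\<close> turns these into a partition. Encoded pairs keep the
  colours natural numbers, with the old colour recoverable as first component.\<close>

lemma refine:
  assumes m: "matched c d" and e: "locc X e" and p: "p \<in> X" and q: "q \<in> Y" and pq: "c p = d q" "c (a p) = d (b q)"
  shows "\<exists>d'. matched (\<lambda>x. prod_encode (c x, e x)) d' \<and> prod_encode (c p, e p) = d' q \<and>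
     prod_encode (c (a p), e (a p)) = d' (b q) \<and> (\<forall>y\<in>Y. fst (prod_decode (d' y)) = d y)"
proof -
  define c' where "c' x = prod_encode (c x, e x)" for x
  define pr where "pr k = fst (prod_decode k)" for k
  have lc: "locc X c" and ld: "locc Y d" and \<rho>: "\<And>i. \<rho> (\<lambda>x. of_bool (c x = i)) (\<lambda>y. of_bool (d y = i))"
    using m by (auto simp: matched_def)
  have lc': "locc X c'" unfolding c'_def by (rule locc_map2[OF lc e, where g="\<lambda>u v. prod_encode (u, v)"])
  define S where "S = c' ` X"
  have S: "finite S" unfolding S_def by (rule locc_finite_range[OF A.compact lc'])
  have l1: "locc X (\<lambda>x. of_bool (c' x = k) :: int)" for k by (rule locc_map[OF lc', where g="\<lambda>v. of_bool (v = k)"])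
  have "\<exists>\<phi>. \<rho> (\<lambda>x. of_bool (c' x = k)) \<phi> \<and> (\<forall>y\<in>Y. 0 \<le> \<phi> y)" for k by (rule pos[OF l1]) simp
  then obtain \<phi> where \<phi>: "\<And>k. \<rho> (\<lambda>x. of_bool (c' x = k)) (\<phi> k)" "\<And>k y. y \<in> Y \<Longrightarrow> 0 \<le> \<phi> k y" by metis
  have sum: "coh Y b (\<lambda>y. of_bool (d y = i) - (\<Sum>k\<in>{k\<in>S. pr k = i}. \<phi> k y))" for i
  proof -
    have "\<rho> (\<lambda>x. of_bool (c x = i) - (\<Sum>k\<in>{k\<in>S. pr k = i}. of_bool (c' x = k))) (\<lambda>y. of_bool (d y = i) - (\<Sum>k\<in>{k\<in>S. pr k = i}. \<phi> k y))"
      by (rule diff[OF \<rho> sum]) (rule \<phi>(1))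
    moreover have "coh X a (\<lambda>x. of_bool (c x = i) - (\<Sum>k\<in>{k\<in>S. pr k = i}. of_bool (c' x = k)))"
    proof (rule iffD1[OF coh_cong coh_0])
      fix x assume x: "x \<in> X"
      have "(\<Sum>k\<in>{k\<in>S. pr k = i}. of_bool (c' x = k)) = (\<Sum>k\<in>{k\<in>S. pr k = i}. if c' x = k then 1 else 0 :: int)"
        by (rule sum.cong) auto
      also have "\<dots> = of_bool (c x = i)" using S x by (simp add: S_def c'_def pr_def)
      finally show "0 = of_bool (c x = i) - (\<Sum>k\<in>{k\<in>S. pr k = i}. of_bool (c' x = k) :: int)" by simp
    qed
    ultimately show ?thesis using coh by blast
  qed
  have nz: "\<exists>y\<in>Y. \<phi> (c' x) y \<noteq> 0" if x: "x \<in> X" for x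
  proof (rule ccontr)
    assume "\<not> (\<exists>y\<in>Y. \<phi> (c' x) y \<noteq> 0)"
    then have "coh Y b (\<phi> (c' x))" by (intro iffD1[OF coh_cong coh_0]) auto
    then have "coh X a (\<lambda>z. of_bool (c' z = c' x))" using coh[OF \<phi>(1)] by blast
    from A.coh_nonneg[OF this _ x] show False by simp
  qed
  have ap: "a p \<in> X" using p by simp
  have "\<exists>d'. locc Y d' \<and> (\<forall>y\<in>Y. d' y \<in> S \<and> pr (d' y) = d y) \<and>
     (\<forall>k\<in>S. coh Y b (\<lambda>y. of_bool (d' y = k) - \<phi> k y)) \<and> d' q = c' p \<and> d' (b q) = c' (a p)"
  proof (rule B.split_colour[OF ld S _ _ sum q _ _ nz[OF p] _ _ nz[OF ap]])
    show "c' p \<in> S" "c' (a p) \<in> S" using p ap unfolding S_def by blast+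
  qed (use loccs[OF \<phi>(1)] \<phi>(2) pq in \<open>simp_all add: c'_def pr_def\<close>)
  then obtain d' where d': "locc Y d'" "\<forall>y\<in>Y. d' y \<in> S \<and> pr (d' y) = d y"
     "\<forall>k\<in>S. coh Y b (\<lambda>y. of_bool (d' y = k) - \<phi> k y)" "d' q = c' p" "d' (b q) = c' (a p)" by (elim exE conjE)
  have l2: "locc Y (\<lambda>y. of_bool (d' y = k) :: int)" for k by (rule locc_map[OF d'(1), where g="\<lambda>v. of_bool (v = k)"])
  have "\<rho> (\<lambda>x. of_bool (c' x = k)) (\<lambda>y. of_bool (d' y = k))" for k
  proof (cases "k \<in> S")
    case True
    show ?thesis by (rule cong[OF \<phi>(1)[of k] l1 l2]) (use d'(3) True in simp_all)
  next
    case False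
    show ?thesis
    proof (rule cong[OF zero l1 l2])
      show "coh X a (\<lambda>x. of_bool (c' x = k) - 0)" by (rule iffD1[OF coh_cong coh_0]) (use False in \<open>auto simp: S_def\<close>)
      show "coh Y b (\<lambda>y. of_bool (d' y = k) - 0)" by (rule iffD1[OF coh_cong coh_0]) (use False d'(2) in auto)
    qed
  qed
  then have "matched c' d'" unfolding matched_def using lc' d'(1) by blast
  then show ?thesis using d'(2,4,5) unfolding c'_def pr_def by (intro exI[of _ d']) simp
qed

end

text \<open>The cells with the colours of \<open>x\<close> are nested, nonempty, clopen and of
  diameter tending to 0, so they meet in one point of the compact space.\<close>

lemma colour_limit:
  fixes c :: "nat \<Rightarrow> 'a::metric_space \<Rightarrow> nat" and d :: "nat \<Rightarrow> 'b::metric_space \<Rightarrow> nat"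
  assumes Y: "compact Y" and d: "\<And>n. locc Y (d n)" and ex: "\<And>n x. x \<in> X \<Longrightarrow> \<exists>y\<in>Y. d n y = c n x"
    and dn: "\<And>n x y. x \<in> X \<Longrightarrow> y \<in> Y \<Longrightarrow> c (Suc n) x = d (Suc n) y \<Longrightarrow> c n x = d n y"
    and small: "\<And>n y y'. y \<in> Y \<Longrightarrow> y' \<in> Y \<Longrightarrow> d (Suc n) y = d (Suc n) y' \<Longrightarrow> dist y y' < (1/2) ^ n"
    and x: "x \<in> X"
  shows "\<exists>y\<in>Y. \<forall>n. d n y = c n x"
proof -
  obtain y where y: "\<And>n. y n \<in> Y" "\<And>n. d n (y n) = c n x" using ex[OF x] by metis
  have down: "d n (y (n + k)) = c n x" for n k
  proof -
    have "d n z = c n x" if "z \<in> Y" "d (n + k) z = c (n + k) x" for z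
      using that
    proof (induction k)
      case (Suc k)
      then show ?case using dn[OF x, of z "n + k"] by simp
    qed simp
    then show ?thesis using y by blast
  qed
  have down': "d n (y m) = c n x" if "n \<le> m" for n m using down[of n "m - n"] that by simp
  have "Cauchy y"
  proof (rule metric_CauchyI)
    fix e :: real assume "e > 0"
    then obtain n where n: "(1/2::real) ^ n < e" using real_arch_pow_inv[of e "1/2"] by auto
    have "dist (y k) (y m) < e" if "Suc n \<le> k" "Suc n \<le> m" for k m
      using small[of "y k" "y m" n] y(1) down'[OF that(1)] down'[OF that(2)] n by simp
    then show "\<exists>M. \<forall>k\<ge>M. \<forall>m\<ge>M. dist (y k) (y m) < e" by blast
  qed
  then obtain z where z: "z \<in> Y" "y \<longlonglongrightarrow> z" using compact_imp_complete[OF Y] y(1) unfolding complete_def by metis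
  have "d n z = c n x" for n
  proof -
    obtain e where e: "e > 0" "\<forall>w\<in>Y. dist z w < e \<longrightarrow> d n w = d n z" using d z(1) unfolding locc_def by metis
    obtain M where "\<forall>m\<ge>M. dist (y m) z < e" using z(2) e(1) metric_LIMSEQ_D by blast
    then have "dist z (y (max M n)) < e" by (simp add: dist_commute)
    then have "d n (y (max M n)) = d n z" using e(2) y(1) by blast
    then show ?thesis using down'[of n "max M n"] by simp
  qed
  then show ?thesis using z(1) by blast
qed

context krel
begin

text \<open>Each round refines both partitions to mesh below a power of 1/2, first using a fine
  colouring of \<open>X\<close> and then one of \<open>Y\<close>; points correspond when all their
  colours agree. The pairs \<open>p\<close>, \<open>q\<close> and \<open>a p\<close>,
  \<open>b q\<close> keep equal colours in every round and hence correspond in the limit.\<close>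

lemma realisation:
  assumes p: "p \<in> X" and q: "q \<in> Y"
  shows "\<exists>F G. homeomorphism X Y F G \<and> F p = q \<and> F (a p) = b q \<and>
     (\<forall>f. locc Y f \<longrightarrow> (coh Y b f \<longleftrightarrow> coh X a (\<lambda>x. f (F x))))"
proof -
  interpret S: krel Y b X a "\<lambda>g f. \<rho> f g" by (rule sym)
  have Smatched: "S.matched d c \<longleftrightarrow> matched c d" for c d unfolding matched_def S.matched_def by blast
  define P where "P s \<longleftrightarrow> matched (fst s) (snd s) \<and> fst s p = snd s q \<and> fst s (a p) = snd s (b q)" for s
  define Q where "Q n s s' \<longleftrightarrow> (\<forall>x\<in>X. \<forall>y\<in>Y. fst s' x = snd s' y \<longrightarrow> fst s x = snd s y) \<and>
      (\<forall>x\<in>X. \<forall>x'\<in>X. fst s' x = fst s' x' \<longrightarrow> dist x x' < (1/2) ^ n) \<and>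
      (\<forall>y\<in>Y. \<forall>y'\<in>Y. snd s' y = snd s' y' \<longrightarrow> dist y y' < (1/2) ^ n)" for n :: nat and s s' :: "('a \<Rightarrow> nat) \<times> ('b \<Rightarrow> nat)"
  have "\<exists>f. \<forall>n. P (f n) \<and> Q n (f n) (f (Suc n))"
  proof (rule dependent_nat_choice)
    have "\<rho> (\<lambda>x. of_bool ((0::nat) = i)) (\<lambda>y. of_bool ((0::nat) = i))" for i by (cases "i = 0") (simp_all add: one zero)
    then have "P ((\<lambda>_. 0), (\<lambda>_. 0))" unfolding P_def matched_def by simp
    then show "\<exists>s. P s" by blast
  next
    fix s and n :: nat assume "P s"
    obtain c d where s: "s = (c, d)" by (cases s)
    have m: "matched c d" "c p = d q" "c (a p) = d (b q)" using \<open>P s\<close> by (auto simp: P_def s)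
    have h: "(1/2::real) ^ n > 0" by simp
    obtain e :: "'a \<Rightarrow> nat" where e: "locc X e" "\<forall>x\<in>X. \<forall>x'\<in>X. e x = e x' \<longrightarrow> dist x x' < (1/2) ^ n"
      using A.zd h unfolding zero_dim_def by blast
    obtain e' :: "'b \<Rightarrow> nat" where e': "locc Y e'" "\<forall>x\<in>Y. \<forall>x'\<in>Y. e' x = e' x' \<longrightarrow> dist x x' < (1/2) ^ n"
      using B.zd h unfolding zero_dim_def by blast
    define c1 where "c1 x = prod_encode (c x, e x)" for x
    obtain d1 where d1: "matched c1 d1" "c1 p = d1 q" "c1 (a p) = d1 (b q)" "\<forall>y\<in>Y. fst (prod_decode (d1 y)) = d y"
      using refine[OF m(1) e(1) p q m(2,3)] unfolding c1_def by blast
    define d2 where "d2 y = prod_encode (d1 y, e' y)" for y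
    have "S.matched d1 c1" using d1(1) Smatched by blast
    from S.refine[OF this e'(1) q p d1(2,3)[symmetric]] obtain c2 where
      c2: "S.matched d2 c2" "d2 q = c2 p" "d2 (b q) = c2 (a p)" "\<forall>x\<in>X. fst (prod_decode (c2 x)) = c1 x"
      unfolding d2_def by blast
    have "P (c2, d2)" using c2 Smatched by (simp add: P_def)
    moreover have "Q n s (c2, d2)" unfolding Q_def s fst_conv snd_conv
    proof (intro conjI ballI impI)
      fix x y assume xy: "x \<in> X" "y \<in> Y" "c2 x = d2 y"
      then have "c1 x = d1 y" using c2(4) by (metis d2_def fst_conv prod_encode_inverse)
      then show "c x = d y" using d1(4) xy(2) by (metis c1_def fst_conv prod_encode_inverse)
    next
      fix x x' assume x: "x \<in> X" "x' \<in> X" "c2 x = c2 x'"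
      then have "c1 x = c1 x'" using c2(4) by metis
      then show "dist x x' < (1/2) ^ n" using e(2) x by (simp add: c1_def)
    next
      fix y y' assume y: "y \<in> Y" "y' \<in> Y" "d2 y = d2 y'"
      then show "dist y y' < (1/2) ^ n" using e'(2) by (simp add: d2_def)
    qed
    ultimately show "\<exists>s'. P s' \<and> Q n s s'" by blast
  qed
  then obtain f where f: "\<And>n. P (f n)" "\<And>n. Q n (f n) (f (Suc n))" by blast
  define c d where "c n = fst (f n)" and "d n = snd (f n)" for n
  have m: "matched (c n) (d n)" and pq: "c n p = d n q" "c n (a p) = d n (b q)" for n
    using f(1)[of n] by (auto simp: P_def c_def d_def)
  have loc: "locc X (c n)" "locc Y (d n)" for n using m[of n] by (auto simp: matched_def)
  have dn: "c n x = d n y" if "x \<in> X" "y \<in> Y" "c (Suc n) x = d (Suc n) y" for n x y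
    using f(2)[of n] that unfolding Q_def c_def d_def by blast
  have sx: "dist x x' < (1/2) ^ n" if "x \<in> X" "x' \<in> X" "c (Suc n) x = c (Suc n) x'" for n x x'
    using f(2)[of n] that unfolding Q_def c_def d_def by blast
  have sy: "dist x x' < (1/2) ^ n" if "x \<in> Y" "x' \<in> Y" "d (Suc n) x = d (Suc n) x'" for n x x'
    using f(2)[of n] that unfolding Q_def c_def d_def by blast
  have "\<exists>y\<in>Y. \<forall>n. d n y = c n x" if "x \<in> X" for x
    by (rule colour_limit[OF B.compact loc(2) matched_ex[OF m] dn sy that])
  then obtain F where F: "\<And>x. x \<in> X \<Longrightarrow> F x \<in> Y" "\<And>x n. x \<in> X \<Longrightarrow> d n (F x) = c n x" by metis
  have "\<exists>x\<in>X. \<forall>n. c n x = d n y" if "y \<in> Y" for y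
  proof (rule colour_limit[OF A.compact loc(1) _ _ sx that])
    show "\<exists>y\<in>X. c n y = d n x" if "x \<in> Y" for n x using S.matched_ex[of "d n" "c n"] m Smatched that by blast
    show "d n x = c n y" if "x \<in> Y" "y \<in> X" "d (Suc n) x = c (Suc n) y" for n x y using dn[of y x n] that by simp
  qed
  then obtain G where G: "\<And>y. y \<in> Y \<Longrightarrow> G y \<in> X" "\<And>y n. y \<in> Y \<Longrightarrow> c n (G y) = d n y" by metis
  have eq0: "r = 0" if r: "\<And>n. r < (1/2::real) ^ n" "0 \<le> r" for r :: real
  proof (rule ccontr)
    assume "r \<noteq> 0"
    then obtain n where "(1/2) ^ n < r" using r(2) real_arch_pow_inv[of r "1/2"] by auto
    then show False using r(1)[of n] by simp
  qed
  have eqX: "x = x'" if "x \<in> X" "x' \<in> X" "\<And>n. c n x = c n x'" for x x'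
    using eq0[of "dist x x'"] sx[OF that(1,2)] that(3) by simp
  have eqY: "x = x'" if "x \<in> Y" "x' \<in> Y" "\<And>n. d n x = d n x'" for x x'
    using eq0[of "dist x x'"] sy[OF that(1,2)] that(3) by simp
  have GF: "G (F x) = x" if "x \<in> X" for x by (rule eqX) (use F G that in auto)
  have FG: "F (G y) = y" if "y \<in> Y" for y by (rule eqY) (use F G that in auto)
  have cF: "continuous_on X F" unfolding continuous_on_iff
  proof (intro ballI allI impI)
    fix x and e :: real assume x: "x \<in> X" and "e > 0"
    then obtain n where n: "(1/2::real) ^ n < e" using real_arch_pow_inv[of e "1/2"] by auto
    obtain r where r: "r > 0" "\<forall>y\<in>X. dist x y < r \<longrightarrow> c (Suc n) y = c (Suc n) x" using loc(1) x unfolding locc_def by metis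
    have "dist (F y) (F x) < e" if "y \<in> X" "dist y x < r" for y
    proof -
      have "d (Suc n) (F y) = d (Suc n) (F x)" using F(2) r(2) that x by (simp add: dist_commute)
      then show ?thesis using sy[OF F(1)[OF that(1)] F(1)[OF x]] n by fastforce
    qed
    then show "\<exists>r>0. \<forall>y\<in>X. dist y x < r \<longrightarrow> dist (F y) (F x) < e" using r(1) by blast
  qed
  have cG: "continuous_on Y G" unfolding continuous_on_iff
  proof (intro ballI allI impI)
    fix x and e :: real assume x: "x \<in> Y" and "e > 0"
    then obtain n where n: "(1/2::real) ^ n < e" using real_arch_pow_inv[of e "1/2"] by auto
    obtain r where r: "r > 0" "\<forall>y\<in>Y. dist x y < r \<longrightarrow> d (Suc n) y = d (Suc n) x" using loc(2) x unfolding locc_def by metis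
    have "dist (G y) (G x) < e" if "y \<in> Y" "dist y x < r" for y
    proof -
      have "c (Suc n) (G y) = c (Suc n) (G x)" using G(2) r(2) that x by (simp add: dist_commute)
      then show ?thesis using sx[OF G(1)[OF that(1)] G(1)[OF x]] n by fastforce
    qed
    then show "\<exists>r>0. \<forall>y\<in>Y. dist y x < r \<longrightarrow> dist (G y) (G x) < e" using r(1) by blast
  qed
  have hom: "homeomorphism X Y F G"
    unfolding homeomorphism_def using cF cG GF FG F(1) G(1) by (auto simp: image_iff) metis+
  have "F p = q" "F (a p) = b q" by (rule eqY; use F p q pq in simp)+
  moreover have "coh Y b f \<longleftrightarrow> coh X a (\<lambda>x. f (F x))" if f: "locc Y f" for f
  proof -
    obtain r where r: "r > 0" "\<forall>x\<in>Y. \<forall>y\<in>Y. dist x y < r \<longrightarrow> f x = f y" using locc_uniform[OF B.compact f] by blast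
    obtain n where n: "(1/2::real) ^ n < r" using real_arch_pow_inv[of r "1/2"] r(1) by auto
    have fd: "f y = f y'" if "y \<in> Y" "y' \<in> Y" "d (Suc n) y = d (Suc n) y'" for y y'
      using r(2) sy[OF that] n that(1,2) by (metis order.strict_trans)
    \<comment> \<open>By uniform continuity \<open>f\<close> factors through some colouring, so it
      is an integer combination of indicators; the relation takes it to the same combination on the
      other side, which is \<open>f \<circ> F\<close>.\<close>
    define val where "val i = f (SOME y. y \<in> Y \<and> d (Suc n) y = i)" for i
    have val: "val (d (Suc n) y) = f y" if y: "y \<in> Y" for y
    proof -
      have "\<exists>y'. y' \<in> Y \<and> d (Suc n) y' = d (Suc n) y" using y by blast
      from someI_ex[OF this] show ?thesis unfolding val_def using fd y by blast
    qed
    define T where "T = d (Suc n) ` Y"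
    have T: "finite T" unfolding T_def by (rule locc_finite_range[OF B.compact loc(2)])
    have r1: "\<rho> (\<lambda>x. \<Sum>i\<in>T. val i * of_bool (c (Suc n) x = i)) (\<lambda>y. \<Sum>i\<in>T. val i * of_bool (d (Suc n) y = i))"
      by (rule sum, rule mult) (use m[of "Suc n"] in \<open>auto simp: matched_def\<close>)
    have sT: "(\<Sum>i\<in>T. val i * of_bool (j = i)) = val j" if "j \<in> T" for j
    proof -
      have "(\<Sum>i\<in>T. val i * of_bool (j = i)) = (\<Sum>i\<in>T. if j = i then val i else 0)" by (rule sum.cong) auto
      then show ?thesis using T that by simp
    qed
    have 1: "(\<Sum>i\<in>T. val i * of_bool (d (Suc n) y = i)) = f y" if "y \<in> Y" for y
      using sT[of "d (Suc n) y"] val[OF that] that by (simp add: T_def)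
    have 2: "(\<Sum>i\<in>T. val i * of_bool (c (Suc n) x = i)) = f (F x)" if "x \<in> X" for x
      using 1[OF F(1)[OF that]] F(2)[OF that] by simp
    have "coh X a (\<lambda>x. \<Sum>i\<in>T. val i * of_bool (c (Suc n) x = i)) \<longleftrightarrow> coh X a (\<lambda>x. f (F x))" by (rule coh_cong[OF 2])
    moreover have "coh Y b (\<lambda>y. \<Sum>i\<in>T. val i * of_bool (d (Suc n) y = i)) \<longleftrightarrow> coh Y b f" by (rule coh_cong[OF 1])
    ultimately show ?thesis using coh[OF r1] by blast
  qed
  ultimately show ?thesis using hom by blast
qed

end

section \<open>Approximate conjugacy\<close>

text \<open>Tower types laid end to end: each word is expanded into its slots, a slot being the word
  together with a height in it.\<close>

definition blocks :: "'c list list \<Rightarrow> ('c list \<times> nat) list" where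
  "blocks ws = concat (map (\<lambda>w. map (Pair w) [0..<length w]) ws)"

lemma blocks_simps [simp]: "blocks [] = []" "blocks (w # ws) = map (Pair w) [0..<length w] @ blocks ws"
  by (simp_all add: blocks_def)

lemma length_blocks: "length (blocks ws) = sum_list (map length ws)"
  by (induction ws) auto

lemma blocks_0: "ws \<noteq> [] \<Longrightarrow> [] \<notin> set ws \<Longrightarrow> snd (blocks ws ! 0) = 0"
  by (cases ws) (auto simp: nth_append)

lemma blocks_nth:
  assumes "[] \<notin> set ws" "i < length (blocks ws)" "blocks ws ! i = (w, j)"
  shows "j < length w"
    and "Suc j < length w \<Longrightarrow> Suc i < length (blocks ws) \<and> blocks ws ! Suc i = (w, Suc j)"
    and "Suc j = length w \<Longrightarrow> Suc i < length (blocks ws) \<Longrightarrow> snd (blocks ws ! Suc i) = 0"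
  using assms
proof (induction ws arbitrary: i)
  case (Cons v ws)
  { case 1
    show ?case
    proof (cases "i < length v")
      case True
      then show ?thesis using 1 by (simp add: nth_append)
    next
      case False
      then show ?thesis using Cons.IH(1)[of "i - length v"] 1 by (simp add: nth_append)
    qed }
  { case 2
    show ?case
    proof (cases "i < length v")
      case True
      then have "w = v" "j = i" using 2 by (simp_all add: nth_append)
      then show ?thesis using 2 by (simp add: nth_append)
    next
      case False
      then have "Suc (i - length v) < length (blocks ws) \<and> blocks ws ! Suc (i - length v) = (w, Suc j)"
        using Cons.IH(2)[of "i - length v"] 2 by (simp add: nth_append)
      moreover have "Suc i - length v = Suc (i - length v)" using False by simp
      ultimately show ?thesis using False by (auto simp: nth_append)
    qed }
  { case 3
    show ?case
    proof (cases "i < length v")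
      case True
      then have "w = v" "j = i" using 3 by (simp_all add: nth_append)
      then have l: "Suc i = length v" using 3 by simp
      then have "blocks ws \<noteq> []" using 3 by auto
      then have "ws \<noteq> []" by auto
      then show ?thesis using blocks_0[of ws] 3 l by (simp add: nth_append)
    next
      case False
      then show ?thesis using Cons.IH(3)[of "i - length v"] 3 by (simp add: nth_append Suc_diff_le)
    qed }
qed simp_all

lemma blocks_last:
  assumes "[] \<notin> set ws" "Suc i = length (blocks ws)" "blocks ws ! i = (w, j)"
  shows "Suc j = length w"
proof (rule ccontr)
  assume "Suc j \<noteq> length w"
  then have "Suc j < length w" using blocks_nth(1)[OF assms(1) _ assms(3)] assms(2) by simp
  then show False using blocks_nth(2)[OF assms(1) _ assms(3)] assms(2) by simp
qed

text \<open>Every block has exactly one bottom slot; nonempty words are needed for it to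
  exist.\<close>

lemma count_blocks:
  assumes "[] \<notin> set ws"
  shows "count (mset (blocks ws)) (w, 0) = count (mset ws) w"
  using assms
proof (induction ws)
  case (Cons v ws)
  have "count (mset (map (Pair v) [0..<length v])) (w, 0) = (if v = w then 1 else 0)"
  proof -
    have "distinct (map (Pair v) [0..<length v])" by (simp add: distinct_map inj_on_def)
    then show ?thesis using Cons.prems by (simp add: distinct_count_atmost_1 image_iff) auto
  qed
  then show ?case using Cons by simp
qed simp

text \<open>The towers of \<open>b\<close> over a small base are rebuilt from levels of the towers of \<open>a\<close>: each \<open>a\<close>-tower is cut
  into consecutive blocks whose lengths are the heights of the \<open>b\<close>-towers.\<close>

lemma approximate_conjugacy:
  fixes X :: "'a::metric_space set"
  assumes "cms X a" "cms X b" and coh_eq: "\<And>f. coh X a f \<longleftrightarrow> coh X b f" and \<epsilon>: "(\<epsilon>::real) > 0"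
  shows "\<exists>\<sigma>\<in>Homeo X. (\<forall>x\<in>X. inner_at X a {} \<sigma> x) \<and> (\<forall>x\<in>X. dist (\<sigma> (a (inv \<sigma> x))) (b x) < \<epsilon>)"
proof -
  interpret A: cms X a by fact
  interpret B: cms X b by fact
  obtain x0 where x0: "x0 \<in> X" using A.inf by fastforce
  obtain v :: "'a \<Rightarrow> nat" where v: "locc X v" "\<forall>x\<in>X. \<forall>y\<in>X. v x = v y \<longrightarrow> dist x y < \<epsilon>"
    using A.zd \<epsilon> unfolding zero_dim_def by blast
  \<comment> \<open>The base is a single cell of the fine partition, so all bottoms are close to
    each other: at the top of a tower it does not matter to which bottom one goes next.\<close>
  define B0 where "B0 = {x. v x = v x0}"
  have lB0: "locc X (\<lambda>x. x \<in> B0)" unfolding B0_def mem_Collect_eq by (rule locc_map[OF v(1), where g="\<lambda>c. c = v x0"])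
  interpret TB: tower X b B0
    by unfold_locales (use lB0 x0 in \<open>auto simp: B0_def\<close>)
  define w where "w = wd b B0 v"
  have lw: "locc X w" unfolding w_def by (rule TB.locc_wd[OF v(1)])
  have wlen: "length (w x) = dn b B0 x + up b B0 x + 1" for x by (simp add: w_def)
  define E' where "E' x = (w x, dn b B0 x)" for x
  have lE': "locc X E'" unfolding E'_def by (rule locc_map2[OF lw TB.locc_dn, where g=Pair])
  have E'_step: "Suc (dn b B0 x) < length (w x) \<Longrightarrow> E' (b x) = (w x, Suc (dn b B0 x))"
    "\<not> Suc (dn b B0 x) < length (w x) \<Longrightarrow> b x \<in> B0 \<and> snd (E' (b x)) = 0" if x: "x \<in> X" for x
  proof -
    assume "Suc (dn b B0 x) < length (w x)"
    then have "up b B0 x \<noteq> 0" by (simp add: wlen)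
    then have "int (dn b B0 (zpow b 1 x)) = int (dn b B0 x) + 1" "w (zpow b 1 x) = w x"
      unfolding w_def by (intro TB.shift[OF x]; simp)+
    then show "E' (b x) = (w x, Suc (dn b B0 x))" by (simp add: E'_def)
  next
    assume "\<not> Suc (dn b B0 x) < length (w x)"
    then have "b x \<in> B0" using TB.up_zero_iff[OF x] by (simp add: wlen)
    then show "b x \<in> B0 \<and> snd (E' (b x)) = 0" using TB.dn_zero_iff x by (simp add: E'_def)
  qed
  \<comment> \<open>Its sum over each \<open>b\<close>-tower is height minus height, so it is a
    coboundary for \<open>b\<close> and hence for \<open>a\<close>. Summed over an
    \<open>a\<close>-tower with small base it shows that the heights belonging to the
    \<open>b\<close>-bottoms met there add up to the height of that \<open>a\<close>-tower.\<close>
  define f :: "'a \<Rightarrow> int" where "f x = (if dn b B0 x = 0 then int (length (w x)) else 0) - 1" for x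
  have lf: "locc X f" unfolding f_def by (rule locc_map2[OF TB.locc_dn lw, where g="\<lambda>d w. (if d = 0 then int (length w) else 0) - 1"])
  have "coh X b f"
  proof (rule TB.sum_wd_coh[OF lf])
    fix x assume x: "x \<in> X"
    have fz: "f (zpow b (int i - int (dn b B0 x)) x) = (if i = 0 then int (length (w x)) else 0) - 1"
      if "i < dn b B0 x + up b B0 x + 1" for i
    proof -
      have r: "- int (dn b B0 x) \<le> int i - int (dn b B0 x)" "int i - int (dn b B0 x) \<le> int (up b B0 x)" using that by auto
      define z where "z = zpow b (int i - int (dn b B0 x)) x"
      have "int (dn b B0 z) = int i" using TB.shift(1)[OF x r] by (simp add: z_def)
      moreover have "w z = w x" using TB.shift(3)[OF x r, of v] by (simp add: w_def z_def)
      ultimately have "f z = (if i = 0 then int (length (w x)) else 0) - 1" by (simp add: f_def)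
      then show ?thesis by (simp only: z_def)
    qed
    have "sum_list (wd b B0 f x) = (\<Sum>i<dn b B0 x + up b B0 x + 1. f (zpow b (int i - int (dn b B0 x)) x))"
      using TB.sum_wd[of "\<lambda>c. c"] by simp
    also have "\<dots> = (\<Sum>i<dn b B0 x + up b B0 x + 1. (if i = 0 then int (length (w x)) else 0) - 1)"
      by (rule sum.cong) (use fz in auto)
    also have "\<dots> = 0" by (simp add: sum_subtractf wlen sum.delta)
    finally show "sum_list (wd b B0 f x) = 0" .
  qed
  then have "coh X a f" using coh_eq by blast
  then obtain h where h: "locc X h" "\<forall>x\<in>X. f x = h (a x) - h x" by (auto simp: coh_def)
  have "\<exists>D. x0 \<in> D \<and> D \<subseteq> X \<inter> UNIV \<and> (\<forall>c\<in>{()}. \<forall>x\<in>D. \<forall>y\<in>D. h x = h y) \<and> tower X a D"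
    by (rule A.small_base) (use h(1) x0 in auto)
  then obtain D where D: "\<forall>x\<in>D. \<forall>y\<in>D. h x = h y" "tower X a D" by blast
  interpret TA: tower X a D by fact
  define u where "u x = (if dn b B0 x = 0 then [w x] else [])" for x
  have lu: "locc X u" unfolding u_def by (rule locc_map2[OF TB.locc_dn lw, where g="\<lambda>d w. if d = 0 then [w] else []"])
  \<comment> \<open>The types of those \<open>b\<close>-towers whose bottoms are met in the
    \<open>a\<close>-tower of \<open>x\<close>. The actual \<open>b\<close>-towers may leave the
    \<open>a\<close>-tower, but blocks of these types fill it exactly (\<open>lenW\<close>).\<close>
  define W where "W x = concat (wd a D u x)" for x
  have lW: "locc X W" unfolding W_def by (rule locc_map[OF TA.locc_wd[OF lu], where g=concat])
  have Wne: "[] \<notin> set (W x)" for x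
  proof
    assume "[] \<in> set (W x)"
    then obtain q where q: "q \<in> set (wd a D u x)" "[] \<in> set q" by (auto simp: W_def)
    then obtain y where "q = u y" unfolding wd_def by auto
    then have "w y = []" using q(2) by (auto simp: u_def split: if_splits)
    then show False using wlen[of y] by simp
  qed
  have lenW: "length (blocks (W x)) = dn a D x + up a D x + 1" if x: "x \<in> X" for x
  proof -
    define \<phi> :: "nat list list \<Rightarrow> int" where "\<phi> q = int (sum_list (map length q)) - 1" for q
    have "sum_list (map \<phi> (wd a D u x)) = 0"
    proof (rule TA.coh_sum_wd[where f=f and h=h, OF _ _ _ x])
      show "f y = h (a y) - h y" if "y \<in> X" for y using h(2) that by blast
      show "h y = h z" if "y \<in> D" "z \<in> D" for y z using D(1) that by blast
      show "\<phi> (u y) = f y" for y by (simp add: \<phi>_def u_def f_def)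
    qed
    moreover have "sum_list (map \<phi> qs) = int (sum_list (map length (concat qs))) - int (length qs)" for qs
      by (induction qs) (auto simp: \<phi>_def)
    ultimately have "int (sum_list (map length (W x))) = int (length (wd a D u x))" by (simp add: W_def)
    then show ?thesis by (simp add: length_blocks)
  qed
  have W_ne: "W x \<noteq> []" if "x \<in> X" for x using lenW[OF that] by auto
  \<comment> \<open>Virtual \<open>b\<close>-coordinates for the points of \<open>a\<close>-towers,
    as opposed to the true ones \<open>E'\<close>. Below the top of a block \<open>a\<close> raises
    \<open>E\<close> exactly as \<open>b\<close> raises \<open>E'\<close>, so a map \<sigma> with
    \<open>E' \<circ> \<sigma> = E\<close> almost conjugates \<open>a\<close> to
    \<open>b\<close>.\<close>
  define E where "E x = blocks (W x) ! dn a D x" for x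
  have lE: "locc X E" unfolding E_def by (rule locc_map2[OF lW TA.locc_dn, where g="\<lambda>w j. blocks w ! j"])
  have shiftW: "W (zpow a k x) = W x" if "x \<in> X" "- int (dn a D x) \<le> k" "k \<le> int (up a D x)" for k x
    unfolding W_def using TA.shift(3)[OF that, of u] by simp
  have E_step: "j < length \<omega> \<and> (Suc j < length \<omega> \<longrightarrow> E (a x) = (\<omega>, Suc j)) \<and> (\<not> Suc j < length \<omega> \<longrightarrow> snd (E (a x)) = 0)"
    if x: "x \<in> X" and E: "E x = (\<omega>, j)" for x \<omega> j
  proof -
    have lt: "dn a D x < length (blocks (W x))" using lenW[OF x] by simp
    have e: "blocks (W x) ! dn a D x = (\<omega>, j)" using E by (simp add: E_def)
    note bn = blocks_nth[OF Wne lt e]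
    show ?thesis
    proof (cases "up a D x = 0")
      case True
      then have "Suc (dn a D x) = length (blocks (W x))" using lenW[OF x] by simp
      then have j: "Suc j = length \<omega>" using blocks_last[OF Wne _ e] by simp
      have "a x \<in> D" using TA.up_zero_iff[OF x] True by simp
      then have "dn a D (a x) = 0" using TA.dn_zero_iff x by simp
      then have "snd (E (a x)) = 0" unfolding E_def using blocks_0[OF W_ne Wne, of "a x"] x by simp
      then show ?thesis using j by simp
    next
      case False
      then have "int (dn a D (zpow a 1 x)) = int (dn a D x) + 1" by (intro TA.shift(1)[OF x]) auto
      then have "dn a D (a x) = Suc (dn a D x)" by simp
      moreover have "W (zpow a 1 x) = W x" by (rule shiftW[OF x]) (use False in auto)
      ultimately have "E (a x) = blocks (W x) ! Suc (dn a D x)" by (simp add: E_def)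
      moreover have "Suc (dn a D x) < length (blocks (W x))" using lenW[OF x] False by simp
      ultimately show ?thesis using bn by (metis Suc_lessI)
    qed
  qed
  have pred: "T (s x) = (\<omega>, Suc j) \<longleftrightarrow> T x = (\<omega>, j) \<and> Suc j < length \<omega>"
    if x: "x \<in> X" and st: "\<And>\<omega> j. T x = (\<omega>, j) \<Longrightarrow> (Suc j < length \<omega> \<longrightarrow> T (s x) = (\<omega>, Suc j)) \<and> (\<not> Suc j < length \<omega> \<longrightarrow> snd (T (s x)) = 0)"
    for x \<omega> j T and s :: "'a \<Rightarrow> 'a"
  proof
    assume *: "T (s x) = (\<omega>, Suc j)"
    obtain \<omega>' j' where "T x = (\<omega>', j')" by fastforce
    then show "T x = (\<omega>, j) \<and> Suc j < length \<omega>" using st[of \<omega>' j'] * by (cases "Suc j' < length \<omega>'") auto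
  qed (use st in blast)
  have Eb: "E (a x) = (\<omega>, Suc j) \<longleftrightarrow> E x = (\<omega>, j) \<and> Suc j < length \<omega>" if "x \<in> X" for x \<omega> j
    by (rule pred[OF that]) (use E_step[OF that] in blast)
  have E'b: "E' (b x) = (\<omega>, Suc j) \<longleftrightarrow> E' x = (\<omega>, j) \<and> Suc j < length \<omega>" if "x \<in> X" for x \<omega> j
    by (rule pred[OF that]) (use E'_step[OF that] in \<open>auto simp: E'_def\<close>)
  have l1: "locc X (\<lambda>x. of_bool (E x = c) :: int)" for c by (rule locc_map[OF lE, where g="\<lambda>v. of_bool (v = c)"])
  have l2: "locc X (\<lambda>x. of_bool (E' x = c) :: int)" for c by (rule locc_map[OF lE', where g="\<lambda>v. of_bool (v = c)"])
  \<comment> \<open>For bottom slots the two counts agree in every \<open>a\<close>-tower by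
    construction. Higher slots are translates of lower ones, under \<open>a\<close> for
    \<open>E\<close> and under \<open>b\<close> for \<open>E'\<close>, and neither translation
    changes classes because the coboundaries coincide.\<close>
  have cc: "coh X a (\<lambda>x. of_bool (E x = (\<omega>, j)) - of_bool (E' x = (\<omega>, j)))" for \<omega> j
  proof (induction j)
    case 0
    have lg: "locc X (\<lambda>x. of_bool (E x = (\<omega>, 0)) - of_bool (E' x = (\<omega>, 0)) :: int)" by (rule locc_map2[OF l1 l2, where g="(-)"])
    show ?case
    proof (rule TA.sum_wd_coh[OF lg])
      fix x assume x: "x \<in> X"
      let ?L = "dn a D x + up a D x + 1"
      let ?z = "\<lambda>i. zpow a (int i - int (dn a D x)) x"
      have Ez: "E (?z i) = blocks (W x) ! i" if "i < ?L" for i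
      proof -
        have r: "- int (dn a D x) \<le> int i - int (dn a D x)" "int i - int (dn a D x) \<le> int (up a D x)" using that by auto
        have "int (dn a D (?z i)) = int i" using TA.shift(1)[OF x r] by simp
        then show ?thesis unfolding E_def using shiftW[OF x r] by simp
      qed
      have "(\<Sum>i<?L. of_bool (E (?z i) = (\<omega>, 0))) = (\<Sum>i<?L. of_bool (blocks (W x) ! i = (\<omega>, 0)) :: int)"
        by (rule sum.cong) (use Ez in auto)
      also have "\<dots> = int (count (mset (blocks (W x))) (\<omega>, 0))"
        unfolding A.count_list_sum using lenW[OF x] by (simp add: sum_list_sum_nth atLeast0LessThan)
      also have "\<dots> = int (count (mset (W x)) \<omega>)" using count_blocks[OF Wne] by simp
      finally have 1: "(\<Sum>i<?L. of_bool (E (?z i) = (\<omega>, 0))) = int (count (mset (W x)) \<omega>)" .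
      have "int (count (mset (concat qs)) \<omega>) = sum_list (map (\<lambda>q. int (count (mset q) \<omega>)) qs)" for qs
        by (induction qs) auto
      then have "int (count (mset (W x)) \<omega>) = sum_list (map (\<lambda>q. int (count (mset q) \<omega>)) (wd a D u x))"
        unfolding W_def .
      also have "\<dots> = (\<Sum>i<?L. int (count (mset (u (?z i))) \<omega>))" by (rule TA.sum_wd)
      also have "\<dots> = (\<Sum>i<?L. of_bool (E' (?z i) = (\<omega>, 0)))" by (rule sum.cong) (auto simp: u_def E'_def)
      finally have 2: "int (count (mset (W x)) \<omega>) = (\<Sum>i<?L. of_bool (E' (?z i) = (\<omega>, 0)))" .
      show "sum_list (wd a D (\<lambda>x. of_bool (E x = (\<omega>, 0)) - of_bool (E' x = (\<omega>, 0)) :: int) x) = 0"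
        using TA.sum_wd[of "\<lambda>c. c :: int"] 1 2 by (simp add: sum_subtractf)
    qed
  next
    case (Suc j)
    have lt: "Suc j < length \<omega>" if y: "y \<in> X" "E y = (\<omega>, Suc j) \<or> E' y = (\<omega>, Suc j)" for y
    proof -
      have "E y = (\<omega>, Suc j) \<Longrightarrow> Suc j < length \<omega>" using E_step[OF y(1)] by blast
      moreover have "E' y = (\<omega>, Suc j) \<Longrightarrow> Suc j < length \<omega>" using wlen[of y] by (auto simp: E'_def)
      ultimately show ?thesis using y(2) by blast
    qed
    show ?case
    proof (cases "Suc j < length \<omega>")
      case False
      show ?thesis by (rule iffD1[OF coh_cong coh_0]) (use lt False in auto)
    next
      case True
      have c1: "coh X a (\<lambda>x. of_bool (E (zpow a 1 x) = (\<omega>, Suc j)) - of_bool (E x = (\<omega>, Suc j)))" by (rule coh_zpow[OF A.hom l1])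
      have "coh X b (\<lambda>x. of_bool (E' (zpow b 1 x) = (\<omega>, Suc j)) - of_bool (E' x = (\<omega>, Suc j)))" by (rule coh_zpow[OF B.hom l2])
      then have c2: "coh X a (\<lambda>x. of_bool (E' (zpow b 1 x) = (\<omega>, Suc j)) - of_bool (E' x = (\<omega>, Suc j)))" using coh_eq by blast
      show ?thesis
        by (rule iffD1[OF coh_cong coh_add[OF Suc coh_diff[OF c2 c1]]]) (use Eb E'b True in simp)
    qed
  qed
  have "coh X a (\<lambda>x. of_bool (E x = c) - of_bool (E' x = c))" for c using cc[of "fst c" "snd c"] by simp
  then obtain \<sigma> where \<sigma>: "\<sigma> \<in> Homeo X" "\<forall>x\<in>X. E' (\<sigma> x) = E x" "\<forall>x\<in>X. inner_at X a {x0} \<sigma> x"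
    by (rule A.permute_colours[OF lE lE' _ x0]) blast
  have "dist (\<sigma> (a (inv \<sigma> y))) (b y) < \<epsilon>" if y: "y \<in> X" for y
  proof -
    define x where "x = inv \<sigma> y"
    have x: "x \<in> X" "\<sigma> x = y" using \<sigma>(1) y Homeo_inv_iff[OF \<sigma>(1)] by (auto simp: x_def)
    have in1: "\<sigma> (a x) \<in> X" "b y \<in> X" using x y HomeoD(4)[OF \<sigma>(1)] by auto
    have Ex: "E x = (w y, dn b B0 y)" using \<sigma>(2) x by (metis E'_def)
    have s: "E' (\<sigma> (a x)) = E (a x)" using \<sigma>(2) x(1) by simp
    have vE: "v z = fst (E' z) ! snd (E' z)" for z by (simp add: E'_def w_def)
    have "v (\<sigma> (a x)) = v (b y)"
    proof (cases "Suc (dn b B0 y) < length (w y)")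
      case True
      then have "E' (\<sigma> (a x)) = E' (b y)" using E_step[OF x(1) Ex] E'_step(1)[OF y] s by simp
      then show ?thesis using vE by simp
    next
      case False
      then have "snd (E' (\<sigma> (a x))) = 0" using E_step[OF x(1) Ex] s by simp
      then have "\<sigma> (a x) \<in> B0" using TB.dn_zero_iff[OF in1(1)] by (simp add: E'_def)
      then show ?thesis using E'_step(2)[OF y False] by (simp add: B0_def)
    qed
    then show ?thesis using v(2) in1 by (simp add: x_def)
  qed
  moreover have "inner_at X a {} \<sigma> x" if "x \<in> X" for x using \<sigma>(3) that inner_at_mono by blast
  ultimately show ?thesis using \<sigma>(1) by blast
qed

section \<open>Topological full groups and dimension groups\<close>

lemma cantor_minimal_homeo:
  assumes "cantor_minimal X \<alpha>"
  obtains g where "homeomorphism X X \<alpha> g"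
  using assms by (auto simp: cantor_minimal_def)

lemma cms_restr:
  assumes "cantor_minimal X \<alpha>"
  shows "cms X (restr X \<alpha>)"
proof
  have C: "cantor_set X" using assms by (simp add: cantor_minimal_def)
  show "compact X" "zero_dim X" using C cantor_set_zero_dim by (auto simp: cantor_set_def)
  obtain x where "x islimpt X" using C by (auto simp: cantor_set_def)
  then show "infinite X" using islimpt_finite by blast
  obtain g where "homeomorphism X X \<alpha> g" using assms by (rule cantor_minimal_homeo)
  then show "restr X \<alpha> \<in> Homeo X" by (rule restr_Homeo)
  fix Z assume Z: "Z \<subseteq> X" "closed Z" "restr X \<alpha> ` Z = Z"
  have "\<alpha> ` Z = restr X \<alpha> ` Z" by (rule image_cong) (use Z(1) in \<open>auto simp: restr_def\<close>)
  then show "Z = {} \<or> Z = X" using assms Z by (simp add: cantor_minimal_def)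
qed

lemma TFG_iff:
  assumes "cantor_minimal X \<alpha>"
  shows "g \<in> TFG X \<alpha> \<longleftrightarrow> g \<in> Homeo X \<and> (\<forall>x\<in>X. inner_at X (restr X \<alpha>) {} g x)"
proof -
  interpret cms X "restr X \<alpha>" using cms_restr[OF assms] .
  obtain k where k: "homeomorphism X X \<alpha> k" using assms by (rule cantor_minimal_homeo)
  have av: "avoid (restr X \<alpha>) {} n x" for n x by (simp add: avoid_def)
  show ?thesis
  proof
    assume "g \<in> TFG X \<alpha>"
    then obtain n where g: "g \<in> Homeo X" and n: "locc X n" "\<forall>x\<in>X. g x = zpow (restr X \<alpha>) (n x) x"
      unfolding TFG_def locc_iff_continuous[symmetric] using hpow_restr[OF k] by auto
    have "inner_at X (restr X \<alpha>) {} g x" if x: "x \<in> X" for x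
    proof -
      obtain e where e: "e > 0" "\<forall>y\<in>X. dist x y < e \<longrightarrow> n y = n x" using n(1) x unfolding locc_def by metis
      then have "\<forall>y\<in>X. dist x y < e \<longrightarrow> g y = zpow (restr X \<alpha>) (n x) y" using n(2) by simp
      then show ?thesis unfolding inner_at_def using e(1) av by blast
    qed
    then show "g \<in> Homeo X \<and> (\<forall>x\<in>X. inner_at X (restr X \<alpha>) {} g x)" using g by blast
  next
    assume R: "g \<in> Homeo X \<and> (\<forall>x\<in>X. inner_at X (restr X \<alpha>) {} g x)"
    then obtain n where n: "locc X n" "\<forall>x\<in>X. g x = zpow (restr X \<alpha>) (n x) x"
      using inner_cocycle[of "{}" "{}" g] by auto
    then have "continuous_on X n" "\<forall>x\<in>X. g x = hpow X \<alpha> (n x) x"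
      using hpow_restr[OF k] by (auto simp: locc_iff_continuous)
    then show "g \<in> TFG X \<alpha>" unfolding TFG_def using R by blast
  qed
qed

lemma TFG_class_pres:
  assumes "cantor_minimal X \<alpha>"
  shows "TFG X \<alpha> \<subseteq> class_pres X (restr X \<alpha>)"
proof -
  interpret cms X "restr X \<alpha>" using cms_restr[OF assms] .
  show ?thesis using TFG_iff[OF assms] inner_class_pres[of _ "{}"] by blast
qed

lemma locc_uniform_limit:
  assumes Y: "compact Y" and f: "locc Y f" and lim: "uniform_limit X s g sequentially"
    and s: "\<And>k x. x \<in> X \<Longrightarrow> s k x \<in> Y" and g: "\<And>x. x \<in> X \<Longrightarrow> g x \<in> Y"
  shows "\<exists>k. \<forall>x\<in>X. f (s k x) = f (g x)"
proof -
  obtain e where e: "e > 0" "\<forall>x\<in>Y. \<forall>y\<in>Y. dist x y < e \<longrightarrow> f x = f y" using locc_uniform[OF Y f] by blast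
  have "\<forall>\<^sub>F k in sequentially. \<forall>x\<in>X. dist (s k x) (g x) < e" using lim e(1) by (rule uniform_limitD)
  then obtain k where "\<forall>x\<in>X. dist (s k x) (g x) < e" by (auto simp: eventually_sequentially)
  then have "\<forall>x\<in>X. f (s k x) = f (g x)" using e(2) s g by blast
  then show ?thesis by blast
qed

text \<open>A locally constant function on a compact set does not notice a small perturbation of the
  map, so class preservation passes to limits. Conversely a class-preserving map is matched, up to
  any fine colouring, by permutations inside towers.\<close>

lemma TFG_closure_eq:
  assumes "cantor_minimal X \<alpha>"
  shows "TFG_closure X \<alpha> = class_pres X (restr X \<alpha>)"
proof
  interpret cms X "restr X \<alpha>" using cms_restr[OF assms] .
  show "TFG_closure X \<alpha> \<subseteq> class_pres X (restr X \<alpha>)"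
  proof
    fix g assume "g \<in> TFG_closure X \<alpha>"
    then obtain s where g: "g \<in> Homeo X" and s: "\<And>k. s k \<in> TFG X \<alpha>" "uniform_limit X s g sequentially"
      by (auto simp: TFG_closure_def)
    have sG: "s k \<in> class_pres X (restr X \<alpha>)" for k using TFG_class_pres[OF assms] s(1) by blast
    then have "s k \<in> Homeo X" for k by (simp add: class_pres_def)
    then have sX: "s k x \<in> X \<longleftrightarrow> x \<in> X" for k x using HomeoD(4) by blast
    have "coh X (restr X \<alpha>) (\<lambda>x. f (g x) - f x)" if f: "locc X f" for f
    proof -
      obtain k where k: "\<forall>x\<in>X. f (s k x) = f (g x)"
        using locc_uniform_limit[OF compact f s(2)] sX HomeoD(4)[OF g] by blast
      have "coh X (restr X \<alpha>) (\<lambda>x. f (s k x) - f x)" using sG f by (simp add: class_pres_def)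
      then show ?thesis by (rule iffD1[OF coh_cong, rotated]) (use k in simp)
    qed
    then show "g \<in> class_pres X (restr X \<alpha>)" using g by (simp add: class_pres_def)
  qed
  show "class_pres X (restr X \<alpha>) \<subseteq> TFG_closure X \<alpha>"
  proof
    fix g assume g: "g \<in> class_pres X (restr X \<alpha>)"
    obtain p where p: "p \<in> X" using inf by fastforce
    have "\<exists>s\<in>TFG X \<alpha>. \<forall>x\<in>X. dist (s x) (g x) < (1/2) ^ n" for n
    proof -
      have "(1/2::real) ^ n > 0" by simp
      then obtain v :: "'a \<Rightarrow> nat" where v: "locc X v" "\<forall>x\<in>X. \<forall>y\<in>X. v x = v y \<longrightarrow> dist x y < (1/2) ^ n"
        using zd unfolding zero_dim_def by blast
      obtain s where s: "s \<in> Homeo X" "\<forall>x\<in>X. v (s x) = v (g x)" "\<forall>x\<in>X. inner_at X (restr X \<alpha>) {p} s x"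
        by (rule approx_class_pres[OF g v(1) p]) blast
      have gH: "g \<in> Homeo X" using g by (simp add: class_pres_def)
      have "\<forall>x\<in>X. dist (s x) (g x) < (1/2) ^ n" using s(2) v(2) HomeoD(4)[OF s(1)] HomeoD(4)[OF gH] by blast
      moreover have "s \<in> TFG X \<alpha>" unfolding TFG_iff[OF assms] using s inner_at_mono by blast
      ultimately show ?thesis by blast
    qed
    then obtain s where s: "\<And>n. s n \<in> TFG X \<alpha>" "\<And>n x. x \<in> X \<Longrightarrow> dist (s n x) (g x) < (1/2) ^ n" by metis
    have "uniform_limit X s g sequentially"
    proof (rule uniform_limitI)
      fix e :: real assume "e > 0"
      moreover have "(\<lambda>n. (1/2::real) ^ n) \<longlonglongrightarrow> 0" by (rule LIMSEQ_power_zero) simp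
      ultimately have "\<forall>\<^sub>F n in sequentially. (1/2::real) ^ n < e" by (rule order_tendstoD(2)[rotated])
      then show "\<forall>\<^sub>F n in sequentially. \<forall>x\<in>X. dist (s n x) (g x) < e"
        by (rule eventually_mono) (auto intro: order.strict_trans[OF s(2)])
    qed
    then show "g \<in> TFG_closure X \<alpha>" unfolding TFG_closure_def using s(1) g by (auto simp: class_pres_def)
  qed
qed

subsection \<open>Homeomorphisms matching coboundaries\<close>

definition coh_homeo ::
  "'a::metric_space set \<Rightarrow> ('a \<Rightarrow> 'a) \<Rightarrow> 'b::metric_space set \<Rightarrow> ('b \<Rightarrow> 'b) \<Rightarrow> ('a \<Rightarrow> 'b) \<Rightarrow> ('b \<Rightarrow> 'a) \<Rightarrow> bool" where
  "coh_homeo X a Y b F G \<longleftrightarrow> homeomorphism X Y F G \<and> (\<forall>f. locc Y f \<longrightarrow> (coh Y b f \<longleftrightarrow> coh X a (\<lambda>x. f (F x))))"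

lemma homeomorphismD:
  assumes "homeomorphism X Y F G"
  shows "\<And>x. x \<in> X \<Longrightarrow> F x \<in> Y" "\<And>y. y \<in> Y \<Longrightarrow> G y \<in> X" "\<And>x. x \<in> X \<Longrightarrow> G (F x) = x" "\<And>y. y \<in> Y \<Longrightarrow> F (G y) = y"
    "continuous_on X F" "continuous_on Y G" "\<And>f. locc Y f \<Longrightarrow> locc X (\<lambda>x. f (F x))" "\<And>f. locc X f \<Longrightarrow> locc Y (\<lambda>y. f (G y))"
proof -
  show "\<And>x. x \<in> X \<Longrightarrow> F x \<in> Y" "\<And>y. y \<in> Y \<Longrightarrow> G y \<in> X" "\<And>x. x \<in> X \<Longrightarrow> G (F x) = x" "\<And>y. y \<in> Y \<Longrightarrow> F (G y) = y"
    and c: "continuous_on X F" "continuous_on Y G"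
    using assms by (auto simp: homeomorphism_def)
  have "F ` X \<subseteq> Y" "G ` Y \<subseteq> X" using assms by (auto simp: homeomorphism_def)
  then show "\<And>f. locc Y f \<Longrightarrow> locc X (\<lambda>x. f (F x))" "\<And>f. locc X f \<Longrightarrow> locc Y (\<lambda>y. f (G y))"
    using locc_compose c by blast+
qed

lemma coh_homeo_sym:
  assumes "coh_homeo X a Y b F G"
  shows "coh_homeo Y b X a G F"
proof -
  have h: "homeomorphism X Y F G" and c: "\<And>f. locc Y f \<Longrightarrow> coh Y b f \<longleftrightarrow> coh X a (\<lambda>x. f (F x))"
    using assms by (auto simp: coh_homeo_def)
  have "coh X a f \<longleftrightarrow> coh Y b (\<lambda>y. f (G y))" if f: "locc X f" for f
  proof -
    have "coh Y b (\<lambda>y. f (G y)) \<longleftrightarrow> coh X a (\<lambda>x. f (G (F x)))" by (rule c[OF homeomorphismD(8)[OF h f]])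
    also have "\<dots> \<longleftrightarrow> coh X a f" by (rule coh_cong) (use homeomorphismD(3)[OF h] in simp)
    finally show ?thesis by simp
  qed
  then show ?thesis unfolding coh_homeo_def using homeomorphism_symD[OF h] by blast
qed

lemma conjh_Homeo:
  assumes h: "homeomorphism X Y F G" and t: "t \<in> Homeo Y"
  shows "conjh X F G t \<in> Homeo X"
proof -
  obtain k where k: "homeomorphism Y Y t k" using t by (auto simp: Homeo_def)
  have "homeomorphism X X (G \<circ> (t \<circ> F)) ((G \<circ> k) \<circ> F)"
    using homeomorphism_compose[OF homeomorphism_compose[OF h k] homeomorphism_symD[OF h]] by (simp add: o_assoc)
  then have "restr X (G \<circ> (t \<circ> F)) \<in> Homeo X" by (rule restr_Homeo)
  moreover have "restr X (G \<circ> (t \<circ> F)) = conjh X F G t" by (auto simp: restr_def conjh_def)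
  ultimately show ?thesis by simp
qed

lemma conjh_conjh:
  fixes X :: "'a::metric_space set" and Y :: "'b::metric_space set"
  assumes h: "homeomorphism X Y F G" and s: "s \<in> Homeo X"
  shows "conjh X F G (conjh Y G F s) = s"
proof
  fix x
  show "conjh X F G (conjh Y G F s) x = s x"
    using homeomorphismD(1-4)[OF h] HomeoD(4,5)[OF s] by (auto simp: conjh_def)
qed

lemma zpow_conjh:
  fixes X :: "'a::metric_space set" and Y :: "'b::metric_space set"
  assumes h: "homeomorphism X Y F G" and t: "t \<in> Homeo Y" and x: "x \<in> X"
  shows "F (zpow (conjh X F G t) k x) = zpow t k (F x)"
proof (rule avoid_transfer[OF conjh_Homeo[OF h t] HomeoD(1)[OF t] x, where N="{}"])
  show "F (conjh X F G t z) = t (F z)" if "z \<in> X" for z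
    using homeomorphismD[OF h] HomeoD(4)[OF t] that by (simp add: conjh_def)
qed (simp add: avoid_def)

lemma conjh_class_pres:
  assumes c: "coh_homeo X a Y b F G" and t: "t \<in> class_pres Y b"
  shows "conjh X F G t \<in> class_pres X a"
proof -
  have h: "homeomorphism X Y F G" and ch: "\<And>f. locc Y f \<Longrightarrow> coh Y b f \<longleftrightarrow> coh X a (\<lambda>x. f (F x))"
    using c by (auto simp: coh_homeo_def)
  have tH: "t \<in> Homeo Y" using t by (simp add: class_pres_def)
  have "coh X a (\<lambda>x. f (conjh X F G t x) - f x)" if f: "locc X f" for f
  proof -
    have k: "locc Y (\<lambda>y. f (G y))" by (rule homeomorphismD(8)[OF h f])
    then have "coh Y b (\<lambda>y. f (G (t y)) - f (G y))" using t by (auto simp: class_pres_def)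
    moreover have "locc Y (\<lambda>y. f (G (t y)) - f (G y))" by (rule locc_map2[OF locc_Homeo[OF k tH] k, where g="(-)"])
    ultimately have "coh X a (\<lambda>x. f (G (t (F x))) - f (G (F x)))" using ch by blast
    then show ?thesis by (rule iffD1[OF coh_cong, rotated]) (use homeomorphismD(3)[OF h] in \<open>simp add: conjh_def\<close>)
  qed
  then show ?thesis using conjh_Homeo[OF h tH] by (simp add: class_pres_def)
qed

text \<open>From equality of the groups only the membership of the two generators is used:
  conjugated to the other side, \<beta> and \<alpha> preserve classes there, so that the differences
  \<open>k \<circ> \<beta> - k\<close> and \<open>k \<circ> \<alpha> - k\<close> remain
  coboundaries. The converse holds since the groups are defined by coboundaries.\<close>

lemma closure_conj_iff:
  assumes X: "cantor_minimal X \<alpha>" and Y: "cantor_minimal Y \<beta>" and h: "homeomorphism X Y F G"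
  shows "TFG_closure X \<alpha> = conjh X F G ` TFG_closure Y \<beta> \<longleftrightarrow> coh_homeo X (restr X \<alpha>) Y (restr Y \<beta>) F G"
proof -
  interpret A: cms X "restr X \<alpha>" using cms_restr[OF X] .
  interpret B: cms Y "restr Y \<beta>" using cms_restr[OF Y] .
  let ?a = "restr X \<alpha>" and ?b = "restr Y \<beta>"
  show ?thesis unfolding TFG_closure_eq[OF X] TFG_closure_eq[OF Y]
  proof
    assume eq: "class_pres X ?a = conjh X F G ` class_pres Y ?b"
    have "coh Y ?b f \<longleftrightarrow> coh X ?a (\<lambda>x. f (F x))" if f: "locc Y f" for f
    proof
      assume "coh Y ?b f"
      then obtain k where k: "locc Y k" "\<forall>y\<in>Y. f y = k (?b y) - k y" by (auto simp: coh_def)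
      have "?b \<in> class_pres Y ?b" using class_pres_zpow[OF B.hom, of 1] by simp
      then have "conjh X F G ?b \<in> class_pres X ?a" using eq by blast
      then have "coh X ?a (\<lambda>x. k (F (conjh X F G ?b x)) - k (F x))"
        using homeomorphismD(7)[OF h k(1)] by (auto simp: class_pres_def)
      then show "coh X ?a (\<lambda>x. f (F x))"
        by (rule iffD1[OF coh_cong, rotated]) (use homeomorphismD(1-4)[OF h] k(2) in \<open>simp add: conjh_def\<close>)
    next
      assume "coh X ?a (\<lambda>x. f (F x))"
      then obtain k where k: "locc X k" "\<forall>x\<in>X. f (F x) = k (?a x) - k x" by (auto simp: coh_def)
      have "?a \<in> class_pres X ?a" using class_pres_zpow[OF A.hom, of 1] by simp
      then obtain t where t: "t \<in> class_pres Y ?b" "?a = conjh X F G t" using eq by blast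
      then have "coh Y ?b (\<lambda>y. k (G (t y)) - k (G y))" using homeomorphismD(8)[OF h k(1)] by (auto simp: class_pres_def)
      moreover have "k (G (t y)) - k (G y) = f y" if "y \<in> Y" for y
      proof -
        have "f (F (G y)) = k (?a (G y)) - k (G y)" using k(2) homeomorphismD(2)[OF h that] by blast
        moreover have "?a (G y) = G (t y)" unfolding t(2) using homeomorphismD(2,4)[OF h that] by (simp add: conjh_def)
        ultimately show ?thesis using homeomorphismD(4)[OF h that] by simp
      qed
      ultimately show "coh Y ?b f" by (rule iffD1[OF coh_cong, rotated])
    qed
    then show "coh_homeo X ?a Y ?b F G" using h by (simp add: coh_homeo_def)
  next
    assume c: "coh_homeo X ?a Y ?b F G"
    show "class_pres X ?a = conjh X F G ` class_pres Y ?b"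
    proof
      show "conjh X F G ` class_pres Y ?b \<subseteq> class_pres X ?a" using conjh_class_pres[OF c] by blast
      show "class_pres X ?a \<subseteq> conjh X F G ` class_pres Y ?b"
      proof
        fix s assume s: "s \<in> class_pres X ?a"
        then have "conjh X F G (conjh Y G F s) = s" using conjh_conjh[OF h] by (simp add: class_pres_def)
        moreover have "conjh Y G F s \<in> class_pres Y ?b" by (rule conjh_class_pres[OF coh_homeo_sym[OF c] s])
        ultimately show "s \<in> conjh X F G ` class_pres Y ?b" by (metis image_eqI)
      qed
    qed
  qed
qed

lemma cms_conjh:
  assumes "cms X a" "cms Y b" and h: "homeomorphism X Y F G"
  shows "cms X (conjh X F G b)"
proof -
  interpret A: cms X a by fact
  interpret B: cms Y b by fact
  show ?thesis
  proof
    show "conjh X F G b \<in> Homeo X" by (rule conjh_Homeo[OF h B.hom])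
    fix Z assume Z: "Z \<subseteq> X" "closed Z" "conjh X F G b ` Z = Z"
    have "compact Z" using Z(1,2) A.compact by (metis compact_Int_closed inf.absorb_iff2)
    then have "compact (F ` Z)" using homeomorphismD(5)[OF h] Z(1) by (metis compact_continuous_image continuous_on_subset)
    moreover have "F ` Z \<subseteq> Y" using homeomorphismD(1)[OF h] Z(1) by blast
    moreover have "b ` F ` Z = F ` Z"
    proof -
      have "F ` conjh X F G b ` Z = b ` F ` Z" unfolding image_image
        by (rule image_cong) (use homeomorphismD(1-4)[OF h] Z(1) in \<open>auto simp: conjh_def\<close>)
      then show ?thesis using Z(3) by simp
    qed
    ultimately have "F ` Z = {} \<or> F ` Z = Y" using B.min compact_imp_closed by blast
    then show "Z = {} \<or> Z = X"
    proof
      assume "F ` Z = Y"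
      have "X \<subseteq> Z"
      proof
        fix x assume x: "x \<in> X"
        then have "F x \<in> F ` Z" using homeomorphismD(1)[OF h] \<open>F ` Z = Y\<close> by simp
        then obtain z where "z \<in> Z" "F x = F z" by blast
        then show "x \<in> Z" using homeomorphismD(3)[OF h] x Z(1) by (metis subsetD)
      qed
      then show ?thesis using Z(1) by blast
    qed simp
  qed (fact A.compact A.zd A.inf)+
qed

lemma coh_conjh_eq:
  assumes c: "coh_homeo X a Y b F G" and a: "a \<in> Homeo X" and b: "b \<in> Homeo Y"
  shows "coh X a f \<longleftrightarrow> coh X (conjh X F G b) f"
proof -
  have h: "homeomorphism X Y F G" using c by (simp add: coh_homeo_def)
  have *: "coh X a f \<longleftrightarrow> coh Y b (\<lambda>y. f (G y))" if "locc X f"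
    using coh_homeo_sym[OF c] that by (simp add: coh_homeo_def)
  have **: "coh X (conjh X F G b) f \<longleftrightarrow> coh Y b (\<lambda>y. f (G y))"
  proof
    assume "coh X (conjh X F G b) f"
    then obtain k where k: "locc X k" "\<forall>x\<in>X. f x = k (conjh X F G b x) - k x" by (auto simp: coh_def)
    show "coh Y b (\<lambda>y. f (G y))"
      by (rule cohI[OF homeomorphismD(8)[OF h k(1)]]) (use k(2) homeomorphismD(2,4)[OF h] in \<open>simp add: conjh_def\<close>)
  next
    assume "coh Y b (\<lambda>y. f (G y))"
    then obtain k where k: "locc Y k" "\<forall>y\<in>Y. f (G y) = k (b y) - k y" by (auto simp: coh_def)
    show "coh X (conjh X F G b) f"
    proof (rule cohI[OF homeomorphismD(7)[OF h k(1)]])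
      fix x assume x: "x \<in> X"
      have "f (G (F x)) = k (b (F x)) - k (F x)" using k(2) homeomorphismD(1)[OF h x] by blast
      then show "f x = k (F (conjh X F G b x)) - k (F x)"
        using x homeomorphismD(1,3,4)[OF h] HomeoD(4)[OF b] by (simp add: conjh_def)
    qed
  qed
  show ?thesis
  proof (cases "locc X f")
    case True
    then show ?thesis using * ** by blast
  next
    case False
    then show ?thesis using coh_locc[OF a] coh_locc[OF conjh_Homeo[OF h b]] by blast
  qed
qed

lemma inv_into_Homeo:
  assumes "s \<in> Homeo X" "x \<in> X"
  shows "inv_into X s x = inv s x"
proof -
  have "restr X s = s" using HomeoD(5)[OF assms(1)] by (auto simp: restr_def)
  moreover obtain k where "homeomorphism X X s k" using assms(1) by (auto simp: Homeo_def)
  ultimately show ?thesis using inv_into_restr[OF _ assms(2)] by metis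
qed

text \<open>Approximation is carried out on \<open>X\<close> against the conjugate of \<beta>;
  uniform continuity of \<open>F\<close> brings the estimate back to \<open>Y\<close>.\<close>

lemma coh_homeo_approx:
  assumes X: "cantor_minimal X \<alpha>" and Y: "cantor_minimal Y \<beta>" and c: "coh_homeo X (restr X \<alpha>) Y (restr Y \<beta>) F G"
  shows "\<exists>\<sigma>. (\<forall>k::nat. \<sigma> k \<in> TFG X \<alpha>) \<and>
     uniform_limit Y (\<lambda>k y. F (\<sigma> k (\<alpha> (inv_into X (\<sigma> k) (G y))))) \<beta> sequentially"
proof -
  interpret A: cms X "restr X \<alpha>" using cms_restr[OF X] .
  interpret B: cms Y "restr Y \<beta>" using cms_restr[OF Y] .
  let ?a = "restr X \<alpha>" and ?b = "restr Y \<beta>"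
  have h: "homeomorphism X Y F G" using c by (simp add: coh_homeo_def)
  have u: "uniformly_continuous_on X F" using compact_uniformly_continuous[OF homeomorphismD(5)[OF h] A.compact] .
  have "\<exists>\<sigma>\<in>TFG X \<alpha>. \<forall>y\<in>Y. dist (F (\<sigma> (\<alpha> (inv_into X \<sigma> (G y))))) (\<beta> y) < (1/2) ^ k" for k
  proof -
    have "(1/2::real) ^ k > 0" by simp
    then obtain d where d: "d > 0" "\<forall>x\<in>X. \<forall>x'\<in>X. dist x' x < d \<longrightarrow> dist (F x') (F x) < (1/2) ^ k"
      using u unfolding uniformly_continuous_on_def by metis
    obtain \<sigma> where \<sigma>: "\<sigma> \<in> Homeo X" "\<forall>x\<in>X. inner_at X ?a {} \<sigma> x" "\<forall>x\<in>X. dist (\<sigma> (?a (inv \<sigma> x))) (conjh X F G ?b x) < d"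
      using approximate_conjugacy[OF A.cms_axioms cms_conjh[OF A.cms_axioms B.cms_axioms h] coh_conjh_eq[OF c A.hom B.hom] d(1)] by blast
    have "dist (F (\<sigma> (\<alpha> (inv_into X \<sigma> (G y))))) (\<beta> y) < (1/2) ^ k" if y: "y \<in> Y" for y
    proof -
      have Gy: "G y \<in> X" using homeomorphismD(2)[OF h y] .
      then have iG: "inv \<sigma> (G y) \<in> X" using Homeo_inv_iff[OF \<sigma>(1)] by simp
      have "\<alpha> (inv_into X \<sigma> (G y)) = ?a (inv \<sigma> (G y))" using inv_into_Homeo[OF \<sigma>(1) Gy] iG by (simp add: restr_def)
      moreover have "\<sigma> (?a (inv \<sigma> (G y))) \<in> X" using iG HomeoD(4)[OF \<sigma>(1)] by simp
      moreover have "conjh X F G ?b (G y) \<in> X" using HomeoD(4)[OF conjh_Homeo[OF h B.hom]] Gy by simp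
      moreover have "F (conjh X F G ?b (G y)) = \<beta> y"
        using Gy y homeomorphismD(4)[OF h] B.ain[of y] by (simp add: conjh_def restr_def)
      ultimately show ?thesis using \<sigma>(3) d(2) Gy by metis
    qed
    moreover have "\<sigma> \<in> TFG X \<alpha>" using TFG_iff[OF X] \<sigma> by blast
    ultimately show ?thesis by blast
  qed
  then obtain \<sigma> where \<sigma>: "\<And>k. \<sigma> k \<in> TFG X \<alpha>"
    "\<And>k y. y \<in> Y \<Longrightarrow> dist (F (\<sigma> k (\<alpha> (inv_into X (\<sigma> k) (G y))))) (\<beta> y) < (1/2) ^ k" by metis
  have "uniform_limit Y (\<lambda>k y. F (\<sigma> k (\<alpha> (inv_into X (\<sigma> k) (G y))))) \<beta> sequentially"
  proof (rule uniform_limitI)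
    fix e :: real assume "e > 0"
    moreover have "(\<lambda>n. (1/2::real) ^ n) \<longlonglongrightarrow> 0" by (rule LIMSEQ_power_zero) simp
    ultimately have "\<forall>\<^sub>F n in sequentially. (1/2::real) ^ n < e" by (rule order_tendstoD(2)[rotated])
    then show "\<forall>\<^sub>F k in sequentially. \<forall>y\<in>Y. dist (F (\<sigma> k (\<alpha> (inv_into X (\<sigma> k) (G y))))) (\<beta> y) < e"
      by (rule eventually_mono) (auto intro: order.strict_trans[OF \<sigma>(2)])
  qed
  then show ?thesis using \<sigma>(1) by blast
qed

text \<open>Up to the resolution of a transfer function \<open>k\<close> the map \<beta> equals some
  \<sigma>-conjugate of \<alpha> carried to \<open>Y\<close> by \<open>F\<close>. That conjugate of
  \<alpha> on \<open>X\<close> is a product of class-preserving maps.\<close>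

lemma approx_coh:
  assumes X: "cantor_minimal X \<alpha>" and Y: "cantor_minimal Y \<beta>" and h: "homeomorphism X Y F G"
    and \<sigma>: "\<And>k::nat. \<sigma> k \<in> TFG X \<alpha>"
    and lim: "uniform_limit Y (\<lambda>k y. F (\<sigma> k (\<alpha> (inv_into X (\<sigma> k) (G y))))) \<beta> sequentially"
    and f: "coh Y (restr Y \<beta>) f"
  shows "coh X (restr X \<alpha>) (\<lambda>x. f (F x))"
proof -
  interpret A: cms X "restr X \<alpha>" using cms_restr[OF X] .
  interpret B: cms Y "restr Y \<beta>" using cms_restr[OF Y] .
  let ?a = "restr X \<alpha>" and ?b = "restr Y \<beta>"
  obtain k where k: "locc Y k" "\<forall>y\<in>Y. f y = k (?b y) - k y" using f by (auto simp: coh_def)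
  have sG: "\<sigma> n \<in> class_pres X ?a" and sH: "\<sigma> n \<in> Homeo X" for n using TFG_class_pres[OF X] \<sigma> by (auto simp: class_pres_def)
  have eq: "\<sigma> n (\<alpha> (inv_into X (\<sigma> n) (G y))) = \<sigma> n (?a (inv (\<sigma> n) (G y)))" if "y \<in> Y" for n y
    using inv_into_Homeo[OF sH homeomorphismD(2)[OF h that]] Homeo_inv_iff[OF sH] homeomorphismD(2)[OF h that] by (simp add: restr_def)
  have "\<exists>n. \<forall>y\<in>Y. k (F (\<sigma> n (\<alpha> (inv_into X (\<sigma> n) (G y))))) = k (\<beta> y)"
  proof (rule locc_uniform_limit[OF B.compact k(1) lim])
    fix n y assume y: "y \<in> Y"
    show "F (\<sigma> n (\<alpha> (inv_into X (\<sigma> n) (G y)))) \<in> Y"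
      unfolding eq[OF y] using homeomorphismD(1,2)[OF h] y HomeoD(4)[OF sH] Homeo_inv_iff[OF sH] by simp
    show "\<beta> y \<in> Y" using B.ain[of y] y by (simp add: restr_def)
  qed
  then obtain n where n: "\<forall>y\<in>Y. k (F (\<sigma> n (\<alpha> (inv_into X (\<sigma> n) (G y))))) = k (\<beta> y)" by blast
  have "(\<lambda>x. \<sigma> n (?a (inv (\<sigma> n) x))) \<in> class_pres X ?a"
    using class_pres_comp[OF sG class_pres_comp[OF class_pres_zpow[OF A.hom, of 1] class_pres_inv[OF sG]]] by simp
  then have "coh X ?a (\<lambda>x. k (F (\<sigma> n (?a (inv (\<sigma> n) x)))) - k (F x))"
    using homeomorphismD(7)[OF h k(1)] by (auto simp: class_pres_def)
  then show ?thesis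
  proof (rule iffD1[OF coh_cong, rotated])
    fix x assume x: "x \<in> X"
    have Fx: "F x \<in> Y" using homeomorphismD(1)[OF h x] .
    have "k (F (\<sigma> n (?a (inv (\<sigma> n) x)))) = k (\<beta> (F x))"
      using n Fx eq[OF Fx, of n] homeomorphismD(3)[OF h x] by metis
    then show "k (F (\<sigma> n (?a (inv (\<sigma> n) x)))) - k (F x) = f (F x)" using k(2) Fx by (simp add: restr_def)
  qed
qed

lemma coh_homeoI:
  assumes h: "homeomorphism X Y F G" and 1: "\<And>f. coh Y b f \<Longrightarrow> coh X a (\<lambda>x. f (F x))"
    and 2: "\<And>f. coh X a f \<Longrightarrow> coh Y b (\<lambda>y. f (G y))"
  shows "coh_homeo X a Y b F G"
  unfolding coh_homeo_def
proof (intro conjI h allI impI iffI)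
  fix f assume "coh X a (\<lambda>x. f (F x))"
  then have "coh Y b (\<lambda>y. f (F (G y)))" by (rule 2)
  then show "coh Y b f" by (rule iffD1[OF coh_cong, rotated]) (use homeomorphismD(4)[OF h] in simp)
qed (rule 1)

subsection \<open>Strong orbit equivalence\<close>

lemma orbit_restr:
  fixes X :: "'a::metric_space set"
  assumes "homeomorphism X X \<alpha> k" "x \<in> X"
  shows "orbit X \<alpha> x = range (\<lambda>n. zpow (restr X \<alpha>) n x)"
  unfolding orbit_def using hpow_restr[OF assms] by auto

lemma cocycle_off_orbit:
  assumes c: "cocycle_off X a b F P" and a: "a \<in> Homeo X" and b: "bij b" and x: "x \<in> X"
  shows "\<exists>k. F (zpow a n x) = zpow b k (F x)"
proof -
  have bij: "bij a" using HomeoD(1)[OF a] .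
  have st: "\<exists>k. F (a z) = zpow b k (F z)" if "z \<in> X" for z using c that unfolding cocycle_off_def by blast
  show ?thesis
  proof (induction n rule: int_induct[where k=0])
    case base
    show ?case by (rule exI[of _ 0]) simp
  next
    case (step1 i)
    then obtain k where k: "F (zpow a i x) = zpow b k (F x)" by blast
    obtain l where "F (a (zpow a i x)) = zpow b l (F (zpow a i x))" using st[of "zpow a i x"] x a by auto
    then have "F (zpow a (i + 1) x) = zpow b (l + k) (F x)" using zpow_Suc[OF bij] zpow_add[OF b] k by simp
    then show ?case by blast
  next
    case (step2 i)
    then obtain k where k: "F (zpow a i x) = zpow b k (F x)" by blast
    obtain l where "F (a (zpow a (i - 1) x)) = zpow b l (F (zpow a (i - 1) x))" using st[of "zpow a (i - 1) x"] x a by auto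
    then have "zpow b k (F x) = zpow b l (F (zpow a (i - 1) x))" using zpow_Suc[OF bij, of "i - 1" x] k by simp
    then have "F (zpow a (i - 1) x) = zpow b (- l) (zpow b k (F x))" using zpow_inverse(1)[OF b] by metis
    then have "F (zpow a (i - 1) x) = zpow b (- l + k) (F x)" by (simp only: zpow_add[OF b])
    then show ?case by blast
  qed
qed

lemma strong_orbit_equivI:
  assumes X: "cantor_minimal X \<alpha>" and Y: "cantor_minimal Y \<beta>" and h: "homeomorphism X Y F G"
    and 1: "cocycle_off X (restr X \<alpha>) (restr Y \<beta>) F P" and 2: "cocycle_off Y (restr Y \<beta>) (restr X \<alpha>) G Q"
  shows "strong_orbit_equiv X \<alpha> Y \<beta>"
proof -
  have cocycle: "\<exists>n. (\<forall>x\<in>X. F (\<alpha> x) = hpow Y \<beta> (n x) (F x)) \<and> at_most_one_discont X n"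
    if X: "cantor_minimal X \<alpha>" and Y: "cantor_minimal Y \<beta>" and h: "homeomorphism X Y F G"
      and c: "cocycle_off X (restr X \<alpha>) (restr Y \<beta>) F P"
    for X :: "'c::metric_space set" and \<alpha> and Y :: "'d::metric_space set" and \<beta> F G P
  proof -
    interpret B: cms Y "restr Y \<beta>" using cms_restr[OF Y] .
    obtain k where k: "homeomorphism Y Y \<beta> k" using Y by (rule cantor_minimal_homeo)
    obtain n where n: "\<And>x. x \<in> X \<Longrightarrow> F (restr X \<alpha> x) = zpow (restr Y \<beta>) (n x) (F x)"
      using c unfolding cocycle_off_def by metis
    have "continuous (at x within X) n" if x: "x \<in> X" "x \<noteq> P" for x
    proof -
      obtain l e where l: "e > 0" "\<forall>y\<in>X. dist x y < e \<longrightarrow> F (restr X \<alpha> y) = zpow (restr Y \<beta>) l (F y)"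
        using c x unfolding cocycle_off_def by metis
      have "n y = l" if "y \<in> X" "dist x y < e" for y
        using B.zpow_inj[OF homeomorphismD(1)[OF h that(1)]] l(2) n[OF that(1)] that by metis
      then have "\<forall>y\<in>X. dist x y < e \<longrightarrow> n y = n x" using x(1) l(1) by simp
      then show ?thesis unfolding continuous_within_int_iff using l(1) by blast
    qed
    then have "at_most_one_discont X n" unfolding at_most_one_discont_def by blast
    moreover have "F (\<alpha> x) = hpow Y \<beta> (n x) (F x)" if "x \<in> X" for x
      using n[OF that] hpow_restr[OF k homeomorphismD(1)[OF h that]] that by (simp add: restr_def)
    ultimately show ?thesis by blast
  qed
  obtain n where n: "\<forall>x\<in>X. F (\<alpha> x) = hpow Y \<beta> (n x) (F x)" "at_most_one_discont X n" using cocycle[OF X Y h 1] by blast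
  obtain m where m: "\<forall>y\<in>Y. G (\<beta> y) = hpow X \<alpha> (m y) (G y)" "at_most_one_discont Y m"
    using cocycle[OF Y X homeomorphism_symD[OF h] 2] by blast
  interpret A: cms X "restr X \<alpha>" using cms_restr[OF X] .
  interpret B: cms Y "restr Y \<beta>" using cms_restr[OF Y] .
  obtain k where k: "homeomorphism X X \<alpha> k" using X by (rule cantor_minimal_homeo)
  obtain l where l: "homeomorphism Y Y \<beta> l" using Y by (rule cantor_minimal_homeo)
  have "F ` orbit X \<alpha> x = orbit Y \<beta> (F x)" if x: "x \<in> X" for x
  proof -
    have Fx: "F x \<in> Y" using homeomorphismD(1)[OF h x] .
    show ?thesis unfolding orbit_restr[OF k x] orbit_restr[OF l Fx]
    proof
      show "F ` range (\<lambda>n. zpow (restr X \<alpha>) n x) \<subseteq> range (\<lambda>n. zpow (restr Y \<beta>) n (F x))"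
        using cocycle_off_orbit[OF 1 A.hom B.bij x] by blast
      show "range (\<lambda>n. zpow (restr Y \<beta>) n (F x)) \<subseteq> F ` range (\<lambda>n. zpow (restr X \<alpha>) n x)"
      proof
        fix y assume "y \<in> range (\<lambda>n. zpow (restr Y \<beta>) n (F x))"
        then obtain n where y: "y = zpow (restr Y \<beta>) n (F x)" by blast
        obtain j where "G y = zpow (restr X \<alpha>) j (G (F x))" using cocycle_off_orbit[OF 2 B.hom A.bij Fx] y by blast
        then have "G y = zpow (restr X \<alpha>) j x" using homeomorphismD(3)[OF h x] by simp
        moreover have "y = F (G y)" using homeomorphismD(4)[OF h, of y] Fx y by simp
        ultimately show "y \<in> F ` range (\<lambda>n. zpow (restr X \<alpha>) n x)" by (metis rangeI image_eqI)
      qed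
    qed
  qed
  then show ?thesis unfolding strong_orbit_equiv_def using h n m by blast
qed

lemma orbit_equiv_coh:
  assumes X: "cantor_minimal X \<alpha>" and Y: "cantor_minimal Y \<beta>" and h: "homeomorphism X Y F G"
    and n: "\<forall>x\<in>X. F (\<alpha> x) = hpow Y \<beta> (n x) (F x)" "at_most_one_discont X n"
    and f: "coh X (restr X \<alpha>) f"
  shows "coh Y (restr Y \<beta>) (\<lambda>y. f (G y))"
proof -
  interpret A: cms X "restr X \<alpha>" using cms_restr[OF X] .
  interpret B: cms Y "restr Y \<beta>" using cms_restr[OF Y] .
  let ?a = "restr X \<alpha>" and ?b = "restr Y \<beta>"
  obtain l where l: "homeomorphism Y Y \<beta> l" using Y by (rule cantor_minimal_homeo)
  obtain p where p: "\<And>x. x \<in> X \<Longrightarrow> x \<noteq> p \<Longrightarrow> continuous (at x within X) n" using n(2) unfolding at_most_one_discont_def by blast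
  obtain k where k: "locc X k" "\<forall>x\<in>X. f x = k (?a x) - k x" using f by (auto simp: coh_def)
  define t where "t = conjh Y G F ?a"
  have hs: "homeomorphism Y X G F" using homeomorphism_symD[OF h] .
  have t: "t \<in> Homeo Y" unfolding t_def by (rule conjh_Homeo[OF hs A.hom])
  have ty: "t y = F (?a (G y))" if "y \<in> Y" for y using that by (simp add: t_def conjh_def)
  \<comment> \<open>The constant makes \<open>H (t y)\<close> vanish at the point where
    \<open>G y = p\<close>; the coboundary \<open>H \<circ> t - H\<close> does not depend on
    it.\<close>
  define H where "H y = k (G y) - k (?a p)" for y
  have lH: "locc Y H" unfolding H_def by (rule locc_map[OF homeomorphismD(8)[OF h k(1)], where g="\<lambda>v. v - k (?a p)"])
  have Ht: "H (t y) = k (?a (G y)) - k (?a p)" if "y \<in> Y" for y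
    using ty[OF that] homeomorphismD(2,3)[OF h] that by (simp add: H_def)
  have "coh Y ?b (\<lambda>y. H (t y) - H y)"
  proof (rule coh_piecewise[OF B.compact B.zd B.hom t lH])
    fix y assume y: "y \<in> Y" "H (t y) \<noteq> 0"
    have Gy: "G y \<in> X" using homeomorphismD(2)[OF h y(1)] .
    have "G y \<noteq> p" using Ht[OF y(1)] y(2) by auto
    then obtain e where e: "e > 0" "\<forall>x\<in>X. dist (G y) x < e \<longrightarrow> n x = n (G y)"
      using p[OF Gy] unfolding continuous_within_int_iff by blast
    obtain d where d: "d > 0" "\<And>z. z \<in> Y \<Longrightarrow> dist y z < d \<Longrightarrow> dist (G y) (G z) < e"
      using continuous_near[OF homeomorphismD(6)[OF h] y(1) e(1)] by metis
    have "t z = zpow ?b (n (G y)) z" if z: "z \<in> Y" "dist y z < d" for z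
    proof -
      have Gz: "G z \<in> X" using homeomorphismD(2)[OF h z(1)] .
      have "n (G z) = n (G y)" using e(2) d(2)[OF z] Gz by blast
      moreover have "F (\<alpha> (G z)) = hpow Y \<beta> (n (G z)) (F (G z))" using n(1) Gz by blast
      ultimately show ?thesis using ty[OF z(1)] Gz homeomorphismD(4)[OF h z(1)] hpow_restr[OF l z(1)] by (simp add: restr_def)
    qed
    then show "\<exists>g\<in>class_pres Y ?b. \<exists>e>0. \<forall>z\<in>Y. dist y z < e \<longrightarrow> t z = g z"
      using class_pres_zpow[OF B.hom] d(1) by blast
  qed
  then show ?thesis
  proof (rule iffD1[OF coh_cong, rotated])
    fix y assume y: "y \<in> Y"
    show "H (t y) - H y = f (G y)" using Ht[OF y] k(2) homeomorphismD(2)[OF h y] by (simp add: H_def)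
  qed
qed

lemma strong_orbit_equiv_coh_homeo:
  assumes X: "cantor_minimal X \<alpha>" and Y: "cantor_minimal Y \<beta>" and s: "strong_orbit_equiv X \<alpha> Y \<beta>"
  shows "\<exists>F G. coh_homeo X (restr X \<alpha>) Y (restr Y \<beta>) F G"
proof -
  obtain F G n m where h: "homeomorphism X Y F G" and n: "\<forall>x\<in>X. F (\<alpha> x) = hpow Y \<beta> (n x) (F x)" "at_most_one_discont X n"
    and m: "\<forall>y\<in>Y. G (\<beta> y) = hpow X \<alpha> (m y) (G y)" "at_most_one_discont Y m"
    using s unfolding strong_orbit_equiv_def by blast
  have "coh_homeo X (restr X \<alpha>) Y (restr Y \<beta>) F G"
    by (rule coh_homeoI[OF h orbit_equiv_coh[OF Y X homeomorphism_symD[OF h] m] orbit_equiv_coh[OF X Y h n]])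
  then show ?thesis by blast
qed

text \<open>After transporting \<beta> to \<open>X\<close>, interlacing makes conjugates of both
  maps orbit equivalent through the identity; undoing the two conjugations gives
  \<open>inv B \<circ> A\<close>, which is followed by \<open>F0\<close>.\<close>

lemma pointed_coh_homeo_strong_orbit_equiv:
  assumes X: "cantor_minimal X \<alpha>" and Y: "cantor_minimal Y \<beta>" and c: "coh_homeo X (restr X \<alpha>) Y (restr Y \<beta>) F0 G0"
    and p: "p \<in> X" and Fp: "F0 (restr X \<alpha> p) = restr Y \<beta> (F0 p)"
  shows "strong_orbit_equiv X \<alpha> Y \<beta>"
proof -
  interpret A: cms X "restr X \<alpha>" using cms_restr[OF X] .
  interpret B: cms Y "restr Y \<beta>" using cms_restr[OF Y] .
  let ?a = "restr X \<alpha>" and ?b = "restr Y \<beta>"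
  have h: "homeomorphism X Y F0 G0" using c by (simp add: coh_homeo_def)
  define b' where "b' = conjh X F0 G0 ?b"
  have cb': "cms X b'" unfolding b'_def by (rule cms_conjh[OF A.cms_axioms B.cms_axioms h])
  have "?a p = b' p"
    using p Fp homeomorphismD(3)[OF h, of "?a p"] A.ain[of p] by (simp add: b'_def conjh_def)
  then have I: "interlace_start X ?a b' p"
    unfolding interlace_start_def interlace_start_axioms_def
    using A.cms_axioms cb' coh_conjh_eq[OF c A.hom B.hom] p by (simp add: b'_def)
  obtain A B where AB: "A \<in> Homeo X" "B \<in> Homeo X"
    and c1: "cocycle_off X (\<lambda>x. A (?a (inv A x))) (\<lambda>x. B (b' (inv B x))) (\<lambda>x. x) p"
    and c2: "cocycle_off X (\<lambda>x. B (b' (inv B x))) (\<lambda>x. A (?a (inv A x))) (\<lambda>x. x) p"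
    using interlace_start.interlacing[OF I] by blast
  have b'H: "b' \<in> Homeo X" using cms.hom[OF cb'] .
  define F1 G1 where "F1 x = inv B (A x)" and "G1 x = inv A (B x)" for x
  have k1: "cocycle_off X ?a b' F1 (inv A p)" unfolding F1_def by (rule cocycle_off_conj[OF A.hom b'H AB c1])
  have k2: "cocycle_off X b' ?a G1 (inv B p)" unfolding G1_def by (rule cocycle_off_conj[OF b'H A.hom AB(2,1) c2])
  have F1H: "F1 \<in> Homeo X" "G1 \<in> Homeo X"
    unfolding F1_def G1_def by (rule Homeo_comp[OF Homeo_inv[OF AB(2)] AB(1)], rule Homeo_comp[OF Homeo_inv[OF AB(1)] AB(2)])
  have FG1: "F1 (G1 x) = x" "G1 (F1 x) = x" for x unfolding F1_def G1_def using AB by simp_all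
  have FX: "F1 x \<in> X \<longleftrightarrow> x \<in> X" "G1 x \<in> X \<longleftrightarrow> x \<in> X" for x using HomeoD(4) F1H by blast+
  have h1: "homeomorphism X X F1 G1"
    unfolding homeomorphism_def using HomeoD(2,3)[OF F1H(1)] HomeoD(2,3)[OF F1H(2)] FG1 by auto
  have hom: "homeomorphism X Y (\<lambda>x. F0 (F1 x)) (\<lambda>y. G1 (G0 y))"
    using homeomorphism_compose[OF h1 h] by (simp add: o_def)
  have z: "F0 (zpow b' k x) = zpow ?b k (F0 x)" if "x \<in> X" for k x
    unfolding b'_def by (rule zpow_conjh[OF h B.hom that])
  have "cocycle_off X ?a ?b (\<lambda>x. F0 (F1 x)) (inv A p)"
    unfolding cocycle_off_def
  proof (intro conjI ballI impI)
    fix x assume x: "x \<in> X"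
    obtain k where "F1 (?a x) = zpow b' k (F1 x)" using k1 x unfolding cocycle_off_def by blast
    then show "\<exists>k. F0 (F1 (?a x)) = zpow ?b k (F0 (F1 x))" using z[of "F1 x"] x FX by metis
    assume "x \<noteq> inv A p"
    then obtain k e where e: "e > 0" "\<forall>y\<in>X. dist x y < e \<longrightarrow> F1 (?a y) = zpow b' k (F1 y)"
      using k1 x unfolding cocycle_off_def by metis
    have "\<forall>y\<in>X. dist x y < e \<longrightarrow> F0 (F1 (?a y)) = zpow ?b k (F0 (F1 y))" using e(2) z FX by simp
    then show "\<exists>k. \<exists>e>0. \<forall>y\<in>X. dist x y < e \<longrightarrow> F0 (F1 (?a y)) = zpow ?b k (F0 (F1 y))" using e(1) by blast
  qed
  moreover have "cocycle_off Y ?b ?a (\<lambda>y. G1 (G0 y)) (F0 (inv B p))"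
    unfolding cocycle_off_def
  proof (intro conjI ballI impI)
    have Gb: "G0 (?b y) = b' (G0 y)" if "y \<in> Y" for y
      using that homeomorphismD(2,4)[OF h] by (simp add: b'_def conjh_def)
    fix y assume y: "y \<in> Y"
    have Gy: "G0 y \<in> X" using homeomorphismD(2)[OF h y] .
    obtain k where "G1 (b' (G0 y)) = zpow ?a k (G1 (G0 y))" using k2 Gy unfolding cocycle_off_def by blast
    then show "\<exists>k. G1 (G0 (?b y)) = zpow ?a k (G1 (G0 y))" using Gb[OF y] by auto
    assume "y \<noteq> F0 (inv B p)"
    then have "G0 y \<noteq> inv B p" using homeomorphismD(4)[OF h y] by metis
    then obtain k e where e: "e > 0" "\<forall>x\<in>X. dist (G0 y) x < e \<longrightarrow> G1 (b' x) = zpow ?a k (G1 x)"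
      using k2 Gy unfolding cocycle_off_def by metis
    obtain d where d: "d > 0" "\<And>z. z \<in> Y \<Longrightarrow> dist y z < d \<Longrightarrow> dist (G0 y) (G0 z) < e"
      using continuous_near[OF homeomorphismD(6)[OF h] y e(1)] by metis
    have "G1 (G0 (?b z)) = zpow ?a k (G1 (G0 z))" if "z \<in> Y" "dist y z < d" for z
      using e(2) d(2)[OF that] Gb[OF that(1)] homeomorphismD(2)[OF h that(1)] by simp
    then show "\<exists>k. \<exists>e>0. \<forall>z\<in>Y. dist y z < e \<longrightarrow> G1 (G0 (?b z)) = zpow ?a k (G1 (G0 z))" using d(1) by blast
  qed
  ultimately show ?thesis by (rule strong_orbit_equivI[OF X Y hom])
qed

subsection \<open>The ordered group\<close>

text \<open>Representatives in \<open>CZ\<close> vanish off \<open>X\<close>, while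
  \<open>locc\<close> leaves values there free; this selects the representative.\<close>

definition ext0 :: "'a set \<Rightarrow> ('a \<Rightarrow> int) \<Rightarrow> 'a \<Rightarrow> int" where
  "ext0 X f = (\<lambda>x. if x \<in> X then f x else 0)"

lemma CZ_iff: "f \<in> CZ X \<longleftrightarrow> locc X f \<and> (\<forall>x. x \<notin> X \<longrightarrow> f x = 0)"
  for X :: "'a::metric_space set"
  by (simp add: CZ_def locc_iff_continuous)

lemma ext0_CZ: "locc X f \<Longrightarrow> ext0 X f \<in> CZ X"
  using locc_cong[of X "ext0 X f" f] by (simp add: CZ_iff ext0_def)

lemma ext0_id: "f \<in> CZ X \<Longrightarrow> ext0 X f = f"
  for X :: "'a::metric_space set"
  by (auto simp: CZ_iff ext0_def)

lemma CZ_add: "f \<in> CZ X \<Longrightarrow> g \<in> CZ X \<Longrightarrow> (\<lambda>x. f x + g x) \<in> CZ X"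
  for X :: "'a::metric_space set"
  by (auto simp: CZ_iff intro: locc_map2[where g="(+)"])

lemma CZ_diff: "f \<in> CZ X \<Longrightarrow> g \<in> CZ X \<Longrightarrow> (\<lambda>x. f x - g x) \<in> CZ X"
  for X :: "'a::metric_space set"
  by (auto simp: CZ_iff intro: locc_map2[where g="(-)"])

lemma cob_iff:
  assumes X: "cantor_minimal X \<alpha>"
  shows "f \<in> cob X \<alpha> \<longleftrightarrow> coh X (restr X \<alpha>) f \<and> (\<forall>x. x \<notin> X \<longrightarrow> f x = 0)"
proof -
  interpret cms X "restr X \<alpha>" using cms_restr[OF X] .
  let ?a = "restr X \<alpha>"
  obtain k where k: "homeomorphism X X \<alpha> k" using X by (rule cantor_minimal_homeo)
  have iv: "inv_into X \<alpha> x = inv ?a x" if "x \<in> X" for x using inv_into_restr[OF k that] .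
  show ?thesis
  proof
    assume "f \<in> cob X \<alpha>"
    then obtain h where h: "h \<in> CZ X" "f = (\<lambda>x. if x \<in> X then h x - h (inv_into X \<alpha> x) else 0)" by (auto simp: cob_def)
    have "locc X h" using h(1) by (simp add: CZ_iff)
    then have "locc X (\<lambda>x. h (inv ?a x))" by (rule locc_Homeo[OF _ Homeo_inv[OF hom]])
    then have "coh X ?a f" by (rule cohI) (use h(2) iv hom in simp)
    then show "coh X ?a f \<and> (\<forall>x. x \<notin> X \<longrightarrow> f x = 0)" using h(2) by simp
  next
    assume R: "coh X ?a f \<and> (\<forall>x. x \<notin> X \<longrightarrow> f x = 0)"
    then obtain h where h: "locc X h" "\<forall>x\<in>X. f x = h (?a x) - h x" by (auto simp: coh_def)
    \<comment> \<open>Shift by one step: coboundaries are \<open>g - g \<circ> inv a\<close> on one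
      side and \<open>h \<circ> a - h\<close> on the other.\<close>
    define g where "g = ext0 X (\<lambda>x. h (?a x))"
    have "g \<in> CZ X" unfolding g_def by (rule ext0_CZ[OF locc_Homeo[OF h(1) hom]])
    moreover have "f = (\<lambda>x. if x \<in> X then g x - g (inv_into X \<alpha> x) else 0)"
    proof
      fix x
      show "f x = (if x \<in> X then g x - g (inv_into X \<alpha> x) else 0)"
        using R h(2) iv[of x] Homeo_inv_iff[OF hom, of x] hom by (simp add: g_def ext0_def)
    qed
    ultimately show "f \<in> cob X \<alpha>" unfolding cob_def by blast
  qed
qed

lemma k0cls_eq:
  assumes X: "cantor_minimal X \<alpha>" and f: "f \<in> CZ X"
  shows "k0cls X \<alpha> f = {g \<in> CZ X. coh X (restr X \<alpha>) (\<lambda>x. g x - f x)}"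
  unfolding k0cls_def cob_iff[OF X] using f by (auto simp: CZ_iff)

lemma k0cls_eq_iff:
  assumes X: "cantor_minimal X \<alpha>" and f: "f \<in> CZ X" and g: "g \<in> CZ X"
  shows "k0cls X \<alpha> f = k0cls X \<alpha> g \<longleftrightarrow> coh X (restr X \<alpha>) (\<lambda>x. f x - g x)"
proof
  assume "k0cls X \<alpha> f = k0cls X \<alpha> g"
  moreover have "f \<in> k0cls X \<alpha> f" using f by (simp add: k0cls_eq[OF X f])
  ultimately show "coh X (restr X \<alpha>) (\<lambda>x. f x - g x)" by (simp add: k0cls_eq[OF X g])
next
  assume c: "coh X (restr X \<alpha>) (\<lambda>x. f x - g x)"
  have "coh X (restr X \<alpha>) (\<lambda>x. h x - f x) \<longleftrightarrow> coh X (restr X \<alpha>) (\<lambda>x. h x - g x)" for h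
    using coh_add[OF _ c, of "\<lambda>x. h x - f x"] coh_diff[OF _ c, of "\<lambda>x. h x - g x"] by auto
  then show "k0cls X \<alpha> f = k0cls X \<alpha> g" unfolding k0cls_eq[OF X f] k0cls_eq[OF X g] by simp
qed

lemma kplus_k0cls:
  assumes X: "cantor_minimal X \<alpha>" and f: "f \<in> CZ X" and g: "g \<in> CZ X"
  shows "kplus (k0cls X \<alpha> f) (k0cls X \<alpha> g) = k0cls X \<alpha> (\<lambda>x. f x + g x)"
proof
  show "kplus (k0cls X \<alpha> f) (k0cls X \<alpha> g) \<subseteq> k0cls X \<alpha> (\<lambda>x. f x + g x)"
  proof
    fix w assume "w \<in> kplus (k0cls X \<alpha> f) (k0cls X \<alpha> g)"
    then obtain u v where w: "w = (\<lambda>x. u x + v x)" and u: "u \<in> k0cls X \<alpha> f" and v: "v \<in> k0cls X \<alpha> g"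
      by (auto simp: kplus_def)
    have "coh X (restr X \<alpha>) (\<lambda>x. (u x - f x) + (v x - g x))"
      by (rule coh_add) (use u v in \<open>simp_all add: k0cls_eq[OF X f] k0cls_eq[OF X g]\<close>)
    then have "coh X (restr X \<alpha>) (\<lambda>x. w x - (f x + g x))" by (simp add: w algebra_simps)
    moreover have "w \<in> CZ X" unfolding w by (rule CZ_add) (use u v in \<open>simp_all add: k0cls_eq[OF X f] k0cls_eq[OF X g]\<close>)
    ultimately show "w \<in> k0cls X \<alpha> (\<lambda>x. f x + g x)" by (simp add: k0cls_eq[OF X CZ_add[OF f g]])
  qed
  show "k0cls X \<alpha> (\<lambda>x. f x + g x) \<subseteq> kplus (k0cls X \<alpha> f) (k0cls X \<alpha> g)"
  proof
    fix w assume "w \<in> k0cls X \<alpha> (\<lambda>x. f x + g x)"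
    then have w: "w \<in> CZ X" "coh X (restr X \<alpha>) (\<lambda>x. w x - (f x + g x))" by (simp_all add: k0cls_eq[OF X CZ_add[OF f g]])
    have "(\<lambda>x. w x - f x) \<in> k0cls X \<alpha> g" using CZ_diff[OF w(1) f] w(2) by (simp add: k0cls_eq[OF X g] algebra_simps)
    moreover have "f \<in> k0cls X \<alpha> f" using f by (simp add: k0cls_eq[OF X f])
    ultimately show "w \<in> kplus (k0cls X \<alpha> f) (k0cls X \<alpha> g)"
      unfolding kplus_def mem_Collect_eq by (intro exI[of _ f] exI[of _ "\<lambda>x. w x - f x"]) simp
  qed
qed

lemma coh_homeo_unital_order_iso:
  assumes X: "cantor_minimal X \<alpha>" and Y: "cantor_minimal Y \<beta>" and c: "coh_homeo X (restr X \<alpha>) Y (restr Y \<beta>) F G"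
  shows "\<exists>\<Phi>. unital_order_iso X \<alpha> Y \<beta> \<Phi>"
proof -
  let ?a = "restr X \<alpha>" and ?b = "restr Y \<beta>"
  have h: "homeomorphism X Y F G" using c by (simp add: coh_homeo_def)
  have cs: "coh X ?a f \<longleftrightarrow> coh Y ?b (\<lambda>y. f (G y))" if "locc X f" for f
    using coh_homeo_sym[OF c] that by (simp add: coh_homeo_def)
  define T where "T f = ext0 Y (\<lambda>y. f (G y))" for f :: "'a \<Rightarrow> int"
  define T' where "T' g = ext0 X (\<lambda>x. g (F x))" for g :: "'b \<Rightarrow> int"
  have T: "T f \<in> CZ Y" if "f \<in> CZ X" for f
    unfolding T_def by (rule ext0_CZ[OF homeomorphismD(8)[OF h]]) (use that in \<open>simp add: CZ_iff\<close>)
  have T': "T' g \<in> CZ X" if "g \<in> CZ Y" for g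
    unfolding T'_def by (rule ext0_CZ[OF homeomorphismD(7)[OF h]]) (use that in \<open>simp add: CZ_iff\<close>)
  have TT': "T (T' g) = g" if "g \<in> CZ Y" for g
    using that homeomorphismD(2,4)[OF h] by (auto simp: T_def T'_def ext0_def CZ_iff)
  have coT: "coh X ?a (\<lambda>x. f x - g x) \<longleftrightarrow> coh Y ?b (\<lambda>y. T f y - T g y)" if "f \<in> CZ X" "g \<in> CZ X" for f g
  proof -
    have "locc X (\<lambda>x. f x - g x)" using CZ_diff[OF that] by (simp add: CZ_iff)
    from cs[OF this] show ?thesis using coh_cong[of Y "\<lambda>y. f (G y) - g (G y)" "\<lambda>y. T f y - T g y" ?b]
      by (simp add: T_def ext0_def)
  qed
  define \<Phi> where "\<Phi> C = T ` C" for C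
  have \<Phi>: "\<Phi> (k0cls X \<alpha> f) = k0cls Y \<beta> (T f)" if f: "f \<in> CZ X" for f
  proof
    show "\<Phi> (k0cls X \<alpha> f) \<subseteq> k0cls Y \<beta> (T f)"
      unfolding \<Phi>_def k0cls_eq[OF X f] k0cls_eq[OF Y T[OF f]] using T coT[OF _ f] by auto
    show "k0cls Y \<beta> (T f) \<subseteq> \<Phi> (k0cls X \<alpha> f)"
    proof
      fix g assume "g \<in> k0cls Y \<beta> (T f)"
      then have g: "g \<in> CZ Y" "coh Y ?b (\<lambda>y. g y - T f y)" by (simp_all add: k0cls_eq[OF Y T[OF f]])
      have "coh X ?a (\<lambda>x. T' g x - f x)" using coT[OF T'[OF g(1)] f] TT'[OF g(1)] g(2) by simp
      then have "T' g \<in> k0cls X \<alpha> f" using T'[OF g(1)] by (simp add: k0cls_eq[OF X f])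
      then show "g \<in> \<Phi> (k0cls X \<alpha> f)" unfolding \<Phi>_def using TT'[OF g(1)] by (metis image_eqI)
    qed
  qed
  have "bij_betw \<Phi> (K0 X \<alpha>) (K0 Y \<beta>)"
  proof (rule bij_betw_imageI)
    show "inj_on \<Phi> (K0 X \<alpha>)"
    proof (rule inj_onI)
      fix C D assume "C \<in> K0 X \<alpha>" "D \<in> K0 X \<alpha>" and e: "\<Phi> C = \<Phi> D"
      then obtain f g where f: "f \<in> CZ X" "C = k0cls X \<alpha> f" and g: "g \<in> CZ X" "D = k0cls X \<alpha> g" by (auto simp: K0_def)
      have "k0cls Y \<beta> (T f) = k0cls Y \<beta> (T g)" using e \<Phi> f g by simp
      then have "coh X ?a (\<lambda>x. f x - g x)" unfolding k0cls_eq_iff[OF Y T[OF f(1)] T[OF g(1)]] coT[OF f(1) g(1)] .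
      then show "C = D" using k0cls_eq_iff[OF X f(1) g(1)] f g by simp
    qed
    show "\<Phi> ` K0 X \<alpha> = K0 Y \<beta>"
    proof
      show "\<Phi> ` K0 X \<alpha> \<subseteq> K0 Y \<beta>" unfolding K0_def using \<Phi> T by auto
      show "K0 Y \<beta> \<subseteq> \<Phi> ` K0 X \<alpha>"
      proof
        fix C assume "C \<in> K0 Y \<beta>"
        then obtain g where g: "g \<in> CZ Y" "C = k0cls Y \<beta> g" by (auto simp: K0_def)
        then have "C = \<Phi> (k0cls X \<alpha> (T' g))" using \<Phi>[OF T'[OF g(1)]] TT'[OF g(1)] by simp
        then show "C \<in> \<Phi> ` K0 X \<alpha>" unfolding K0_def using T'[OF g(1)] by blast
      qed
    qed
  qed
  moreover have "\<Phi> (kplus C D) = kplus (\<Phi> C) (\<Phi> D)" if "C \<in> K0 X \<alpha>" "D \<in> K0 X \<alpha>" for C D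
  proof -
    obtain f g where f: "f \<in> CZ X" "C = k0cls X \<alpha> f" and g: "g \<in> CZ X" "D = k0cls X \<alpha> g" using \<open>C \<in> K0 X \<alpha>\<close> \<open>D \<in> K0 X \<alpha>\<close> by (auto simp: K0_def)
    have "T (\<lambda>x. f x + g x) = (\<lambda>y. T f y + T g y)" by (auto simp: T_def ext0_def)
    then show ?thesis using kplus_k0cls[OF X f(1) g(1)] kplus_k0cls[OF Y T[OF f(1)] T[OF g(1)]] \<Phi> CZ_add[OF f(1) g(1)] f g by simp
  qed
  moreover have "\<Phi> ` K0pos X \<alpha> = K0pos Y \<beta>"
  proof
    show "\<Phi> ` K0pos X \<alpha> \<subseteq> K0pos Y \<beta>"
    proof
      fix C assume "C \<in> \<Phi> ` K0pos X \<alpha>"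
      then obtain f where f: "f \<in> CZ X" "\<forall>x\<in>X. 0 \<le> f x" "C = k0cls Y \<beta> (T f)" using \<Phi> by (auto simp: K0pos_def)
      have "\<forall>y\<in>Y. 0 \<le> T f y" using f(2) homeomorphismD(2)[OF h] by (simp add: T_def ext0_def)
      then show "C \<in> K0pos Y \<beta>" unfolding K0pos_def using f T by blast
    qed
    show "K0pos Y \<beta> \<subseteq> \<Phi> ` K0pos X \<alpha>"
    proof
      fix C assume "C \<in> K0pos Y \<beta>"
      then obtain g where g: "g \<in> CZ Y" "\<forall>y\<in>Y. 0 \<le> g y" "C = k0cls Y \<beta> g" by (auto simp: K0pos_def)
      have "\<forall>x\<in>X. 0 \<le> T' g x" using g(2) homeomorphismD(1)[OF h] by (simp add: T'_def ext0_def)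
      then have "k0cls X \<alpha> (T' g) \<in> K0pos X \<alpha>" unfolding K0pos_def using T'[OF g(1)] by blast
      moreover have "C = \<Phi> (k0cls X \<alpha> (T' g))" using \<Phi>[OF T'[OF g(1)]] TT'[OF g(1)] g(3) by simp
      ultimately show "C \<in> \<Phi> ` K0pos X \<alpha>" by blast
    qed
  qed
  moreover have "\<Phi> (K0unit X \<alpha>) = K0unit Y \<beta>"
  proof -
    have "ext0 X (\<lambda>_. 1) \<in> CZ X" by (rule ext0_CZ) simp
    moreover have "T (ext0 X (\<lambda>_. 1)) = ext0 Y (\<lambda>_. 1)" using homeomorphismD(2)[OF h] by (auto simp: T_def ext0_def)
    ultimately show ?thesis unfolding K0unit_def ext0_def[symmetric] using \<Phi> by simp
  qed
  ultimately show ?thesis unfolding unital_order_iso_def by blast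
qed

lemma unital_order_iso_krel:
  assumes X: "cantor_minimal X \<alpha>" and Y: "cantor_minimal Y \<beta>" and \<Phi>: "unital_order_iso X \<alpha> Y \<beta> \<Phi>"
  shows "krel X (restr X \<alpha>) Y (restr Y \<beta>)
    (\<lambda>f g. locc X f \<and> locc Y g \<and> \<Phi> (k0cls X \<alpha> (ext0 X f)) = k0cls Y \<beta> (ext0 Y g))"
proof -
  interpret A: cms X "restr X \<alpha>" using cms_restr[OF X] .
  interpret B: cms Y "restr Y \<beta>" using cms_restr[OF Y] .
  let ?a = "restr X \<alpha>" and ?b = "restr Y \<beta>"
  define cl where "cl f = k0cls X \<alpha> (ext0 X f)" for f
  define cl' where "cl' g = k0cls Y \<beta> (ext0 Y g)" for g
  have bij: "bij_betw \<Phi> (K0 X \<alpha>) (K0 Y \<beta>)" and add: "\<And>c d. c \<in> K0 X \<alpha> \<Longrightarrow> d \<in> K0 X \<alpha> \<Longrightarrow> \<Phi> (kplus c d) = kplus (\<Phi> c) (\<Phi> d)"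
    and pos: "\<Phi> ` K0pos X \<alpha> = K0pos Y \<beta>" and unit: "\<Phi> (K0unit X \<alpha>) = K0unit Y \<beta>"
    using \<Phi> by (auto simp: unital_order_iso_def)
  have cl_eq: "cl f = cl g \<longleftrightarrow> coh X ?a (\<lambda>x. f x - g x)" if "locc X f" "locc X g" for f g
    unfolding cl_def k0cls_eq_iff[OF X ext0_CZ[OF that(1)] ext0_CZ[OF that(2)]] by (rule coh_cong) (simp add: ext0_def)
  have cl'_eq: "cl' f = cl' g \<longleftrightarrow> coh Y ?b (\<lambda>x. f x - g x)" if "locc Y f" "locc Y g" for f g
    unfolding cl'_def k0cls_eq_iff[OF Y ext0_CZ[OF that(1)] ext0_CZ[OF that(2)]] by (rule coh_cong) (simp add: ext0_def)
  have cl_in: "cl f \<in> K0 X \<alpha>" if "locc X f" for f unfolding cl_def K0_def using ext0_CZ[OF that] by blast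
  have e_add: "ext0 Z (\<lambda>x. f x + g x) = (\<lambda>x. ext0 Z f x + ext0 Z g x)" for Z :: "'z set" and f g by (auto simp: ext0_def)
  have cl_add: "kplus (cl f) (cl g) = cl (\<lambda>x. f x + g x)" if "locc X f" "locc X g" for f g
    unfolding cl_def e_add by (rule kplus_k0cls[OF X ext0_CZ[OF that(1)] ext0_CZ[OF that(2)]])
  have cl'_add: "kplus (cl' f) (cl' g) = cl' (\<lambda>x. f x + g x)" if "locc Y f" "locc Y g" for f g
    unfolding cl'_def e_add by (rule kplus_k0cls[OF Y ext0_CZ[OF that(1)] ext0_CZ[OF that(2)]])
  have \<Phi>_ex: "\<exists>g. locc Y g \<and> \<Phi> (cl f) = cl' g" if "locc X f" for f
  proof -
    have "\<Phi> (cl f) \<in> K0 Y \<beta>" using bij cl_in[OF that] by (rule bij_betw_apply)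
    then obtain g where g: "g \<in> CZ Y" "\<Phi> (cl f) = k0cls Y \<beta> g" by (auto simp: K0_def)
    then show ?thesis unfolding cl'_def using ext0_id[OF g(1)] by (intro exI[of _ g]) (simp add: CZ_iff)
  qed
  \<comment> \<open>Additivity is all that is known, so the image \<open>z\<close> of a difference
    is found by comparing \<open>z + g'\<close> with \<open>g\<close>.\<close>
  have \<Phi>_diff: "\<Phi> (cl (\<lambda>x. f x - f' x)) = cl' (\<lambda>y. g y - g' y)"
    if f: "locc X f" "locc X f'" and g: "locc Y g" "locc Y g'" and e: "\<Phi> (cl f) = cl' g" "\<Phi> (cl f') = cl' g'" for f f' g g'
  proof -
    have lf: "locc X (\<lambda>x. f x - f' x)" by (rule locc_map2[OF f, where g="(-)"])
    have lg: "locc Y (\<lambda>x. g x - g' x)" by (rule locc_map2[OF g, where g="(-)"])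
    obtain z where z: "locc Y z" "\<Phi> (cl (\<lambda>x. f x - f' x)) = cl' z" using \<Phi>_ex[OF lf] by blast
    have lz: "locc Y (\<lambda>y. z y + g' y)" by (rule locc_map2[OF z(1) g(2), where g="(+)"])
    have "kplus (cl (\<lambda>x. f x - f' x)) (cl f') = cl f" using cl_add[OF lf f(2)] by simp
    then have "kplus (cl' z) (cl' g') = cl' g" using add[OF cl_in[OF lf] cl_in[OF f(2)]] e z(2) by simp
    then have "cl' (\<lambda>y. z y + g' y) = cl' g" using cl'_add[OF z(1) g(2)] by simp
    then have "coh Y ?b (\<lambda>y. z y + g' y - g y)" using cl'_eq[OF lz g(1)] by simp
    then have "coh Y ?b (\<lambda>y. z y - (g y - g' y))" by (simp add: algebra_simps)
    then show ?thesis using cl'_eq[OF z(1) lg] z(2) by simp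
  qed
  have l1: "locc Z (\<lambda>_. 1 :: int)" "locc Z (\<lambda>_. 0 :: int)" for Z :: "'z::metric_space set" by simp_all
  have one: "\<Phi> (cl (\<lambda>_. 1)) = cl' (\<lambda>_. 1)" using unit by (simp add: K0unit_def cl_def cl'_def ext0_def)
  have zero: "\<Phi> (cl (\<lambda>_. 0)) = cl' (\<lambda>_. 0)" using \<Phi>_diff[OF l1(1) l1(1) l1(1) l1(1) one one] by simp
  show ?thesis unfolding cl_def[symmetric] cl'_def[symmetric]
  proof
    fix f g
    assume R: "locc X f \<and> locc Y g \<and> \<Phi> (cl f) = cl' g"
    then show "locc X f \<and> locc Y g" by blast
    have "coh X ?a f \<longleftrightarrow> cl f = cl (\<lambda>_. 0)" using cl_eq[of f "\<lambda>_. 0"] R by simp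
    also have "\<dots> \<longleftrightarrow> \<Phi> (cl f) = \<Phi> (cl (\<lambda>_. 0))"
      using bij cl_in[of f] cl_in[OF l1(2)] R by (metis bij_betw_inv_into_left)
    also have "\<dots> \<longleftrightarrow> cl' g = cl' (\<lambda>_. 0)" using R zero by simp
    also have "\<dots> \<longleftrightarrow> coh Y ?b g" using cl'_eq[of g "\<lambda>_. 0"] R by simp
    finally show "coh X ?a f \<longleftrightarrow> coh Y ?b g" .
    fix f' g'
    { assume R': "locc X f' \<and> locc Y g' \<and> \<Phi> (cl f') = cl' g'"
      show "locc X (\<lambda>x. f x - f' x) \<and> locc Y (\<lambda>y. g y - g' y) \<and> \<Phi> (cl (\<lambda>x. f x - f' x)) = cl' (\<lambda>y. g y - g' y)"
        using R R' \<Phi>_diff locc_map2[of X f f' "(-)"] locc_map2[of Y g g' "(-)"] by blast }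
    { assume "locc X f'" "locc Y g'" "coh X ?a (\<lambda>x. f' x - f x)" "coh Y ?b (\<lambda>y. g' y - g y)"
      then show "locc X f' \<and> locc Y g' \<and> \<Phi> (cl f') = cl' g'" using cl_eq[of f' f] cl'_eq[of g' g] R by simp }
  next
    fix f :: "'a \<Rightarrow> int" assume f: "locc X f" "\<forall>x\<in>X. 0 \<le> f x"
    have "cl f \<in> K0pos X \<alpha>" unfolding cl_def K0pos_def using ext0_CZ[OF f(1)] f(2) by (auto simp: ext0_def)
    then have "\<Phi> (cl f) \<in> K0pos Y \<beta>" using pos by blast
    then obtain g where g: "g \<in> CZ Y" "\<forall>y\<in>Y. 0 \<le> g y" "\<Phi> (cl f) = k0cls Y \<beta> g" by (auto simp: K0pos_def)
    then show "\<exists>g. (locc X f \<and> locc Y g \<and> \<Phi> (cl f) = cl' g) \<and> (\<forall>y\<in>Y. 0 \<le> g y)"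
      unfolding cl'_def using ext0_id[OF g(1)] f(1) by (intro exI[of _ g]) (simp add: CZ_iff)
  next
    fix g :: "'b \<Rightarrow> int" assume g: "locc Y g" "\<forall>y\<in>Y. 0 \<le> g y"
    have "cl' g \<in> K0pos Y \<beta>" unfolding cl'_def K0pos_def using ext0_CZ[OF g(1)] g(2) by (auto simp: ext0_def)
    then obtain C where "C \<in> K0pos X \<alpha>" "cl' g = \<Phi> C" using pos by blast
    then obtain f where f: "f \<in> CZ X" "\<forall>x\<in>X. 0 \<le> f x" "cl' g = \<Phi> (k0cls X \<alpha> f)" by (auto simp: K0pos_def)
    then show "\<exists>f. (locc X f \<and> locc Y g \<and> \<Phi> (cl f) = cl' g) \<and> (\<forall>x\<in>X. 0 \<le> f x)"
      unfolding cl_def using ext0_id[OF f(1)] g(1) by (intro exI[of _ f]) (simp add: CZ_iff)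
  next
    show "locc X (\<lambda>_. 1 :: int) \<and> locc Y (\<lambda>_. 1 :: int) \<and> \<Phi> (cl (\<lambda>_. 1)) = cl' (\<lambda>_. 1)" using one by simp
  qed
qed

lemma unital_order_iso_strong_orbit_equiv:
  assumes X: "cantor_minimal X \<alpha>" and Y: "cantor_minimal Y \<beta>" and \<Phi>: "unital_order_iso X \<alpha> Y \<beta> \<Phi>"
  shows "strong_orbit_equiv X \<alpha> Y \<beta>"
proof -
  let ?\<rho> = "\<lambda>f g. locc X f \<and> locc Y g \<and> \<Phi> (k0cls X \<alpha> (ext0 X f)) = k0cls Y \<beta> (ext0 Y g)"
  \<comment> \<open>Any two points will do; the realisation then also matches their images, as the
    interlacing requires.\<close>
  obtain p q where pq: "p \<in> X" "q \<in> Y" using X Y by (auto simp: cantor_minimal_def cantor_set_def)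
  obtain F G where "homeomorphism X Y F G" "F p = q" "F (restr X \<alpha> p) = restr Y \<beta> q"
    "\<forall>f. locc Y f \<longrightarrow> (coh Y (restr Y \<beta>) f \<longleftrightarrow> coh X (restr X \<alpha>) (\<lambda>x. f (F x)))"
    using krel.realisation[OF unital_order_iso_krel[OF X Y \<Phi>] pq] by blast
  then have c: "coh_homeo X (restr X \<alpha>) Y (restr Y \<beta>) F G" and e: "F (restr X \<alpha> p) = restr Y \<beta> (F p)"
    by (simp_all add: coh_homeo_def)
  show ?thesis by (rule pointed_coh_homeo_strong_orbit_equiv[OF X Y c pq(1) e])
qed

theorem theorem3p4:
  fixes X :: "'a::metric_space set" and \<alpha> :: "'a \<Rightarrow> 'a"
    and Y :: "'b::metric_space set" and \<beta> :: "'b \<Rightarrow> 'b"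
  assumes "cantor_minimal X \<alpha>" and "cantor_minimal Y \<beta>"
  shows "((\<exists>\<Phi>. unital_order_iso X \<alpha> Y \<beta> \<Phi>) \<longleftrightarrow> strong_orbit_equiv X \<alpha> Y \<beta>)
    \<and> (strong_orbit_equiv X \<alpha> Y \<beta> \<longleftrightarrow>
         (\<exists>F G. homeomorphism X Y F G
            \<and> TFG_closure X \<alpha> = conjh X F G ` TFG_closure Y \<beta>))
    \<and> ((\<exists>F G. homeomorphism X Y F G
            \<and> TFG_closure X \<alpha> = conjh X F G ` TFG_closure Y \<beta>) \<longleftrightarrow>
       (\<exists>F G (\<sigma>::nat \<Rightarrow> 'a \<Rightarrow> 'a) (\<tau>::nat \<Rightarrow> 'b \<Rightarrow> 'b). homeomorphism X Y F G
            \<and> (\<forall>k. \<sigma> k \<in> TFG X \<alpha>) \<and> (\<forall>k. \<tau> k \<in> TFG Y \<beta>)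
            \<and> uniform_limit Y (\<lambda>k y. F (\<sigma> k (\<alpha> (inv_into X (\<sigma> k) (G y))))) \<beta> sequentially
            \<and> uniform_limit X (\<lambda>k x. G (\<tau> k (\<beta> (inv_into Y (\<tau> k) (F x))))) \<alpha> sequentially))"
proof -
  note X = assms(1) and Y = assms(2)
  \<comment> \<open>The implications (1) to (2) to \<open>C\<close> to (1) form a cycle, while (3)
    and (4) are each equivalent to \<open>C\<close>. A homeomorphism witnessing (3) or (4) need not
    itself be a strong orbit equivalence: the way from \<open>C\<close> to (2) leads through (1) and
    builds a new one.\<close>
  define C where "C \<longleftrightarrow> (\<exists>F G. coh_homeo X (restr X \<alpha>) Y (restr Y \<beta>) F G)"
  have 1: "(\<exists>\<Phi>. unital_order_iso X \<alpha> Y \<beta> \<Phi>) \<Longrightarrow> strong_orbit_equiv X \<alpha> Y \<beta>"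
    using unital_order_iso_strong_orbit_equiv[OF X Y] by blast
  have 2: "strong_orbit_equiv X \<alpha> Y \<beta> \<Longrightarrow> C" unfolding C_def by (rule strong_orbit_equiv_coh_homeo[OF X Y])
  have 3: "C \<Longrightarrow> \<exists>\<Phi>. unital_order_iso X \<alpha> Y \<beta> \<Phi>" unfolding C_def using coh_homeo_unital_order_iso[OF X Y] by blast
  have 4: "(\<exists>F G. homeomorphism X Y F G \<and> TFG_closure X \<alpha> = conjh X F G ` TFG_closure Y \<beta>) \<longleftrightarrow> C"
    unfolding C_def using closure_conj_iff[OF X Y] by (metis coh_homeo_def)
  have 5: "C \<Longrightarrow> \<exists>F G (\<sigma>::nat \<Rightarrow> 'a \<Rightarrow> 'a) (\<tau>::nat \<Rightarrow> 'b \<Rightarrow> 'b). homeomorphism X Y F G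
            \<and> (\<forall>k. \<sigma> k \<in> TFG X \<alpha>) \<and> (\<forall>k. \<tau> k \<in> TFG Y \<beta>)
            \<and> uniform_limit Y (\<lambda>k y. F (\<sigma> k (\<alpha> (inv_into X (\<sigma> k) (G y))))) \<beta> sequentially
            \<and> uniform_limit X (\<lambda>k x. G (\<tau> k (\<beta> (inv_into Y (\<tau> k) (F x))))) \<alpha> sequentially"
  proof -
    assume C
    then obtain F G where c: "coh_homeo X (restr X \<alpha>) Y (restr Y \<beta>) F G" unfolding C_def by blast
    show ?thesis
      using coh_homeo_approx[OF X Y c] coh_homeo_approx[OF Y X coh_homeo_sym[OF c]] c[unfolded coh_homeo_def] by blast
  qed
  have 6: C if "\<exists>F G (\<sigma>::nat \<Rightarrow> 'a \<Rightarrow> 'a) (\<tau>::nat \<Rightarrow> 'b \<Rightarrow> 'b). homeomorphism X Y F G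
            \<and> (\<forall>k. \<sigma> k \<in> TFG X \<alpha>) \<and> (\<forall>k. \<tau> k \<in> TFG Y \<beta>)
            \<and> uniform_limit Y (\<lambda>k y. F (\<sigma> k (\<alpha> (inv_into X (\<sigma> k) (G y))))) \<beta> sequentially
            \<and> uniform_limit X (\<lambda>k x. G (\<tau> k (\<beta> (inv_into Y (\<tau> k) (F x))))) \<alpha> sequentially"
  proof -
    from that obtain F G and \<sigma> :: "nat \<Rightarrow> 'a \<Rightarrow> 'a" and \<tau> :: "nat \<Rightarrow> 'b \<Rightarrow> 'b" where h: "homeomorphism X Y F G"
      and s: "\<And>k. \<sigma> k \<in> TFG X \<alpha>" "uniform_limit Y (\<lambda>k y. F (\<sigma> k (\<alpha> (inv_into X (\<sigma> k) (G y))))) \<beta> sequentially"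
      and t: "\<And>k. \<tau> k \<in> TFG Y \<beta>" "uniform_limit X (\<lambda>k x. G (\<tau> k (\<beta> (inv_into Y (\<tau> k) (F x))))) \<alpha> sequentially" by blast
    show ?thesis unfolding C_def
      using coh_homeoI[OF h approx_coh[OF X Y h s] approx_coh[OF Y X homeomorphism_symD[OF h] t]] by blast
  qed
  show ?thesis using 1 2 3 4 5 6 by blast
qed

end
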